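(* Let $\omega$ be a radial weight and let $\nu\in\widehat{\mathcal{D}}$. Then the following conditions are equivalent: (i) $P_\omega: L^\infty_{\widehat{\nu}}\to H^\infty_{\widehat{\nu}}$ is bounded; (ii) $\nu\in\check{\mathcal{D}}$ and $\displaystyle \sup_{x\ge 0}\frac{\nu_x}{\omega_{2x}}\left(\frac{\omega}{\widehat{\nu}}\right)_x<\infty$; (iii) $\omega\in\widehat{\mathcal{D}}$, $\nu\in\check{\mathcal{D}}$ and $\displaystyle \sup_{0\le r<1}\frac{\widehat{\nu}(r)}{\widehat{\omega}(r)}\int_r^1\frac{\omega(s)}{\widehat{\nu}(s)}\,ds<\infty$; (iv) $\frac{\omega}{\widehat{\nu}}\in\mathcal{D}$ and $\nu\in\check{\mathcal{D}}$.
   Context: Let $\mathbb{D}$ be the open unit disc of $\mathbb{C}$, $\mathcal{H}(\mathbb{D})$ the space of analytic functions in $\mathbb{D}$, and $dA(z)=\frac{dx\,dy}{\pi}$ the normalized area measure. A radial weight is a nonnegative function $\omega\in L^1([0,1))$, extended to $\mathbb{D}$ by $\omega(z)=\omega(|z|)$. Write $\widehat{\omega}(z)=\widehat{\omega}(|z|)=\int_{|z|}^1\omega(s)\,ds$; it is assumed throughout that $\widehat{\omega}(z)>0$ for all $z\in\mathbb{D}$. The moments of a nonnegative function $\omega$ on $[0,1)$ are $\omega_x=\int_0^1 r^x\omega(r)\,dr$, $x\ge0$; in particular $\left(\frac{\omega}{\widehat{\nu}}\right)_x=\int_0^1 r^x\frac{\omega(r)}{\widehat{\nu}(r)}\,dr$.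 A radial weight $\omega$ belongs to $\widehat{\mathcal{D}}$ if there is $C>0$ such that $\widehat{\omega}(r)\le C\,\widehat{\omega}\left(\frac{1+r}{2}\right)$ as $r\to1^-$ (i.e. for all $r<1$ close enough to $1$). It belongs to $\check{\mathcal{D}}$ if there are $K>1$ and $C>1$ such that $\widehat{\omega}(r)\ge C\,\widehat{\omega}\left(1-\frac{1-r}{K}\right)$ as $r\to1^-$. Set $\mathcal{D}=\widehat{\mathcal{D}}\cap\check{\mathcal{D}}$. (Membership of a function in one of these classes includes that it is a radial weight.) For a radial weight $\omega$, the Bergman projection is $$P_\omega(f)(z)=\int_{\mathbb{D}}f(\zeta)\,\overline{B^\omega_z(\zeta)}\,\omega(\zeta)\,dA(\zeta),\qquad B^\omega_z(\zeta)=\sum_{n=0}^\infty\frac{(\overline{z}\zeta)^n}{2\omega_{2n+1}},$$ where $B^\omega_z$ is the reproducing kernel of the Bergman space $A^2_\omega=L^2(\mathbb{D},\omega\,dA)\cap\mathcal{H}(\mathbb{D})$. For a radial weight $\nu$, $L^\infty_{\widehat{\nu}}$ is the space of measurable $f:\mathbb{D}\to\mathbb{C}$ with $\|f\|_{\infty,\widehat{\nu}}=\operatorname{ess\,sup}_{z\in\mathbb{D}}|f(z)|\widehat{\nu}(z)<\infty$, and $H^\infty_{\widehat{\nu}}=L^\infty_{\widehat{\nu}}\cap\mathcal{H}(\mathbb{D})$. Boundedness of $P_\omega:X\to Y$ means that for every $f\in X$ the integral $\int_{\mathbb{D}}f(\zeta)\,\overline{B^\omega_z(\zeta)}\,\omega(\zeta)\,dA(\zeta)$,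 as a function of $z\in\mathbb{D}$, defines an element of $Y$, and $\|P_\omega f\|_Y\le C\|f\|_X$ with $C$ independent of $f$. *)

theory Defs
  imports "HOL-Probability.Essential_Supremum" "HOL-Complex_Analysis.Complex_Analysis"
begin

abbreviation unit_disc :: "complex set" where
  "unit_disc \<equiv> ball 0 1"

text \<open>
  A radial function on the disc is represented by its profile, a function on the reals of which
  only the values on \<open>[0,1)\<close> matter; its value at a point \<open>z\<close> of the disc is the profile
  at \<open>cmod z\<close>. All measurability and integrals are with respect to Lebesgue measure.
\<close>

definition tail :: "(real \<Rightarrow> real) \<Rightarrow> real \<Rightarrow> real" where
  "tail \<omega> r = (LINT s|lebesgue_on {r..<1}. \<omega> s)"

definition radial_weight :: "(real \<Rightarrow> real) \<Rightarrow> bool" where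
  "radial_weight \<omega> \<longleftrightarrow>
     (\<forall>r\<in>{0..<1}. 0 \<le> \<omega> r) \<and> integrable (lebesgue_on {0..<1}) \<omega> \<and> (\<forall>r\<in>{0..<1}. 0 < tail \<omega> r)"

text \<open>
  Moments are taken in \<open>[0,\<infinity>]\<close>, because they are also needed for nonnegative functions that
  are not known to be integrable. For \<open>x = 0\<close> the convention \<open>0 powr 0 = 0\<close> affects
  the integrand only at the single point \<open>r = 0\<close>.
\<close>

definition moment :: "(real \<Rightarrow> real) \<Rightarrow> real \<Rightarrow> ennreal" where
  "moment \<omega> x = (\<integral>\<^sup>+ r. ennreal (r powr x * \<omega> r) \<partial>lebesgue_on {0..<1})"

definition D_hat :: "(real \<Rightarrow> real) set" where
  "D_hat = {\<omega>. radial_weight \<omega> \<and>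
     (\<exists>C>0. \<forall>\<^sub>F r in at_left 1. tail \<omega> r \<le> C * tail \<omega> ((1 + r) / 2))}"

definition D_check :: "(real \<Rightarrow> real) set" where
  "D_check = {\<omega>. radial_weight \<omega> \<and>
     (\<exists>K>1. \<exists>C>1. \<forall>\<^sub>F r in at_left 1. tail \<omega> r \<ge> C * tail \<omega> (1 - (1 - r) / K))}"

definition D_class :: "(real \<Rightarrow> real) set" where
  "D_class = D_hat \<inter> D_check"

text \<open>For a radial weight the moments below are positive and finite, so \<open>enn2real\<close> loses nothing.\<close>

definition bergman_kernel :: "(real \<Rightarrow> real) \<Rightarrow> complex \<Rightarrow> complex \<Rightarrow> complex" where
  "bergman_kernel \<omega> z \<zeta> =
     (\<Sum>n. (cnj z * \<zeta>) ^ n / complex_of_real (2 * enn2real (moment \<omega> (2 * real n + 1))))"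

definition bergman_integrand ::
    "(real \<Rightarrow> real) \<Rightarrow> (complex \<Rightarrow> complex) \<Rightarrow> complex \<Rightarrow> complex \<Rightarrow> complex" where
  "bergman_integrand \<omega> f z \<zeta> =
     f \<zeta> * cnj (bergman_kernel \<omega> z \<zeta>) * complex_of_real (\<omega> (cmod \<zeta>))"

text \<open>The factor \<open>1/\<pi>\<close> normalizes the area measure of the disc.\<close>

definition bergman_projection ::
    "(real \<Rightarrow> real) \<Rightarrow> (complex \<Rightarrow> complex) \<Rightarrow> complex \<Rightarrow> complex" where
  "bergman_projection \<omega> f z =
     complex_of_real (1 / pi) * (LINT \<zeta>|lebesgue_on unit_disc. bergman_integrand \<omega> f z \<zeta>)"

definition norm_Linf :: "(real \<Rightarrow> real) \<Rightarrow> (complex \<Rightarrow> complex) \<Rightarrow> ennreal" where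
  "norm_Linf \<nu> f =
     esssup (lebesgue_on unit_disc) (\<lambda>z. ennreal (cmod (f z) * tail \<nu> (cmod z)))"

definition Linf :: "(real \<Rightarrow> real) \<Rightarrow> (complex \<Rightarrow> complex) set" where
  "Linf \<nu> = {f. f \<in> borel_measurable (lebesgue_on unit_disc) \<and> norm_Linf \<nu> f < \<infinity>}"

definition Hinf :: "(real \<Rightarrow> real) \<Rightarrow> (complex \<Rightarrow> complex) set" where
  "Hinf \<nu> = Linf \<nu> \<inter> {f. f holomorphic_on unit_disc}"

text \<open>
  The existence of the defining integral is required explicitly, since the Bochner integral of a
  non-integrable function is \<open>0\<close> by convention.
\<close>

definition bergman_projection_bounded :: "(real \<Rightarrow> real) \<Rightarrow> (real \<Rightarrow> real) \<Rightarrow> bool" where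
  "bergman_projection_bounded \<omega> \<nu> \<longleftrightarrow>
     (\<exists>C::real. \<forall>f\<in>Linf \<nu>.
        (\<forall>z\<in>unit_disc. integrable (lebesgue_on unit_disc) (bergman_integrand \<omega> f z)) \<and>
        bergman_projection \<omega> f \<in> Hinf \<nu> \<and>
        norm_Linf \<nu> (bergman_projection \<omega> f) \<le> ennreal C * norm_Linf \<nu> f)"

end

theory Submission imports Defs begin

text \<open>
  Put \<open>\<sigma> = \<omega> / tail \<nu>\<close>. Everything is compared with (iii), which says that the tail of \<open>\<omega>\<close> is comparable to
  the product of the tails of \<open>\<nu>\<close> and \<open>\<sigma>\<close>.

  Necessity. The test function \<open>Im Ln (1 - t \<zeta> / |\<zeta>|)\<close> divided by the tail of \<open>\<nu>\<close> has Fourier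
  coefficients of size \<open>t^n / n\<close>, so (i) bounds the tail of \<open>\<nu>\<close> at \<open>t\<close> times the sum of
  \<open>t^(2n) \<sigma>_(n+1) / (n \<omega>_(2n+1))\<close>. Since \<open>\<nu>\<close> is in \<open>D_hat\<close>, \<open>\<omega>_x\<close> is at most a constant times the tail of
  \<open>\<nu>\<close> at \<open>1 - 1/x\<close> times \<open>\<sigma>_(3x/4)\<close>. With \<open>t = 1 - 1/(4M)\<close> the terms \<open>4M \<le> n < 5M\<close> then say that
  \<open>\<sigma>_(5M)\<close> is at most a constant times \<open>\<sigma>_(6M)\<close>, which is \<open>D_hat\<close> for \<open>\<sigma>\<close>; a block of terms of large
  logarithmic length gives \<open>D_check\<close> for \<open>\<nu>\<close>.

  Sufficiency. The kernel coefficients \<open>a_n = 1 / (2 \<omega>_(2n+1))\<close> have first and second differences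
  \<open>O(a_n / n)\<close> and \<open>O(a_n / n^2)\<close>. Two summations by parts starting at \<open>n\<close> about \<open>1 / |\<theta>|\<close> bound the
  kernel at \<open>s e^(i\<theta>)\<close> by a constant times the sum of \<open>a_n s^(n/3) / (1 + (n\<theta>)^2)\<close>. Integrated against
  \<open>\<sigma>\<close>, this is controlled by the sum of \<open>t^n / n\<close> over the tail of \<open>\<nu>\<close> at \<open>1 - 1/n\<close>, which is
  comparable to its largest block because \<open>\<nu>\<close> is in both \<open>D_hat\<close> and \<open>D_check\<close>.
\<close>

section \<open>Rotations and radial integration in the disc\<close>

text \<open>The kernel is accessible only through the moments of \<open>\<omega>\<close>, so all
  estimates are made on moments; \<open>D_hat\<close> is what makes a moment of order
  \<open>x\<close> comparable to the tail at \<open>1 - 1 / (x + 2)\<close>. In the necessity part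
  this comparison is not yet available for \<open>\<omega>\<close>, so the upper bound for its
  moments rests on the doubling of \<open>\<nu>\<close> alone. That bound loses a quarter of the
  order. The kernel coefficient uses order \<open>2 * n + 1\<close> and the test function produces
  order \<open>n + 1\<close>, so about \<open>3 * n / 2\<close> is left, still beyond
  \<open>n\<close>; this surplus gives doubling for \<open>\<sigma>\<close> first, and
  \<open>\<omega>\<close> follows once the lost quarter can be absorbed. In the sufficiency part the
  modulus of the kernel must be integrated over the angle without losing a logarithm. One summation
  by parts gives decay like \<open>1 / (n * \<theta>)\<close>, whose angular integral has such a
  loss; two give \<open>1 / (1 + (n * \<theta>)\<^sup>2)\<close>, with integral of order
  \<open>1 / n\<close>. The differences also fall on the powers of the radius, and paying for them
  costs two thirds of the exponent, which is the origin of all cube roots of radii.\<close>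

lemma lborel_complex_eq_distr:
  "(lborel :: complex measure) = distr (lborel \<Otimes>\<^sub>M lborel) borel (\<lambda>(x, y). Complex x y)"
proof (rule lborel_eqI)
  have m[measurable]: "(\<lambda>(x, y). Complex x y) \<in> borel_measurable ((lborel :: real measure) \<Otimes>\<^sub>M (lborel :: real measure))"
  proof -
    have "(\<lambda>(x, y). Complex x y) = (\<lambda>p. complex_of_real (fst p) + \<i> * complex_of_real (snd p))"
      by (auto simp: fun_eq_iff Complex_eq)
    then show ?thesis by simp
  qed
  fix l u :: complex
  assume le: "\<And>b. b \<in> Basis \<Longrightarrow> l \<bullet> b \<le> u \<bullet> b"
  have le': "Re l \<le> Re u" "Im l \<le> Im u"
    using le[of 1] le[of \<i>] by (auto simp: Basis_complex_def)
  have "emeasure (distr (lborel \<Otimes>\<^sub>M lborel) borel (\<lambda>(x, y). Complex x y)) (box l u) =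
     emeasure (lborel \<Otimes>\<^sub>M lborel) ({Re l<..<Re u} \<times> {Im l<..<Im u})"
    by (subst emeasure_distr)
       (auto intro!: arg_cong2[where f=emeasure] simp: space_pair_measure box_def Basis_complex_def)
  also have "\<dots> = emeasure lborel {Re l<..<Re u} * emeasure lborel {Im l<..<Im u}"
    by (subst lborel.emeasure_pair_measure_Times) auto
  also have "\<dots> = ennreal (\<Prod>b\<in>Basis. (u - l) \<bullet> b)"
    using le' by (simp add: Basis_complex_def ennreal_mult complex_eq_iff)
  finally show "emeasure (distr (lborel \<Otimes>\<^sub>M lborel) borel (\<lambda>(x, y). Complex x y)) (box l u) =
     ennreal (\<Prod>b\<in>Basis. (u - l) \<bullet> b)" .
qed simp

lemma nn_integral_lborel_complex:
  assumes [measurable]: "f \<in> borel_measurable borel"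
  shows "(\<integral>\<^sup>+z. f z \<partial>(lborel :: complex measure)) = (\<integral>\<^sup>+x. \<integral>\<^sup>+y. f (Complex x y) \<partial>lborel \<partial>lborel)"
    and "(\<integral>\<^sup>+z. f z \<partial>(lborel :: complex measure)) = (\<integral>\<^sup>+y. \<integral>\<^sup>+x. f (Complex x y) \<partial>lborel \<partial>lborel)"
proof -
  have c: "(\<lambda>(x, y). Complex x y) = (\<lambda>p. complex_of_real (fst p) + \<i> * complex_of_real (snd p))"
    by (auto simp: fun_eq_iff Complex_eq)
  have m[measurable]: "(\<lambda>(x, y). Complex x y) \<in> borel_measurable ((lborel :: real measure) \<Otimes>\<^sub>M (lborel :: real measure))"
    unfolding c by simp
  have m2[measurable]: "(\<lambda>(x, y). f (Complex x y)) \<in> borel_measurable ((lborel :: real measure) \<Otimes>\<^sub>M (lborel :: real measure))"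
    using measurable_compose[OF m, of f] by (simp add: case_prod_unfold)
  have 1: "(\<integral>\<^sup>+z. f z \<partial>(lborel :: complex measure)) = (\<integral>\<^sup>+p. (case p of (x, y) \<Rightarrow> f (Complex x y)) \<partial>(lborel \<Otimes>\<^sub>M lborel))"
    by (subst lborel_complex_eq_distr, subst nn_integral_distr) (auto simp: case_prod_unfold)
  show "(\<integral>\<^sup>+z. f z \<partial>(lborel :: complex measure)) = (\<integral>\<^sup>+x. \<integral>\<^sup>+y. f (Complex x y) \<partial>lborel \<partial>lborel)"
    unfolding 1 by (subst lborel.nn_integral_fst[symmetric]) auto
  show "(\<integral>\<^sup>+z. f z \<partial>(lborel :: complex measure)) = (\<integral>\<^sup>+y. \<integral>\<^sup>+x. f (Complex x y) \<partial>lborel \<partial>lborel)"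
    unfolding 1 by (subst lborel_pair.nn_integral_snd[symmetric]) auto
qed

lemma nn_integral_lborel_translate:
  fixes f :: "real \<Rightarrow> ennreal"
  assumes [measurable]: "f \<in> borel_measurable borel"
  shows "(\<integral>\<^sup>+x. f (x + t) \<partial>lborel) = (\<integral>\<^sup>+x. f x \<partial>lborel)"
  using nn_integral_real_affine[OF assms, of 1 t] by (simp add: add.commute)

text \<open>For a fixed imaginary part the shear is a translation of the real line, so Fubini with
  the real coordinate inside suffices.\<close>

lemma nn_integral_shear_Re:
  assumes f[measurable]: "f \<in> borel_measurable (borel :: complex measure)"
  shows "(\<integral>\<^sup>+z. f (Complex (Re z + t * Im z) (Im z)) \<partial>lborel) = (\<integral>\<^sup>+z. f z \<partial>lborel)"
proof -
  have "(\<integral>\<^sup>+z. f (Complex (Re z + t * Im z) (Im z)) \<partial>lborel) =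
    (\<integral>\<^sup>+y. \<integral>\<^sup>+x. f (Complex (x + t * y) y) \<partial>lborel \<partial>lborel)"
    by (subst nn_integral_lborel_complex(2)) (simp_all add: Complex_eq)
  also have "\<dots> = (\<integral>\<^sup>+y. \<integral>\<^sup>+x. f (Complex x y) \<partial>lborel \<partial>lborel)"
    by (subst nn_integral_lborel_translate[of "\<lambda>x. f (Complex x _)"]) (simp_all add: Complex_eq)
  also have "\<dots> = (\<integral>\<^sup>+z. f z \<partial>lborel)"
    by (rule nn_integral_lborel_complex(2)[symmetric]) simp
  finally show ?thesis .
qed

lemma nn_integral_shear_Im:
  assumes f[measurable]: "f \<in> borel_measurable (borel :: complex measure)"
  shows "(\<integral>\<^sup>+z. f (Complex (Re z) (Im z + t * Re z)) \<partial>lborel) = (\<integral>\<^sup>+z. f z \<partial>lborel)"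
proof -
  have "(\<integral>\<^sup>+z. f (Complex (Re z) (Im z + t * Re z)) \<partial>lborel) =
    (\<integral>\<^sup>+x. \<integral>\<^sup>+y. f (Complex x (y + t * x)) \<partial>lborel \<partial>lborel)"
    by (subst nn_integral_lborel_complex(1)) (simp_all add: Complex_eq)
  also have "\<dots> = (\<integral>\<^sup>+x. \<integral>\<^sup>+y. f (Complex x y) \<partial>lborel \<partial>lborel)"
    by (subst nn_integral_lborel_translate[of "\<lambda>y. f (Complex _ y)"]) (simp_all add: Complex_eq)
  also have "\<dots> = (\<integral>\<^sup>+z. f z \<partial>lborel)"
    by (rule nn_integral_lborel_complex(1)[symmetric]) simp
  finally show ?thesis .
qed

text \<open>A rotation that is not a multiple of \<open>\<pi>\<close> is a product of three shears.\<close>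

lemma nn_integral_lborel_rotate:
  assumes f[measurable]: "f \<in> borel_measurable (borel :: complex measure)" and c: "cmod c = 1"
  shows "(\<integral>\<^sup>+z. f (c * z) \<partial>lborel) = (\<integral>\<^sup>+z. f z \<partial>lborel)"
proof -
  have gen: "(\<integral>\<^sup>+z. g (c * z) \<partial>lborel) = (\<integral>\<^sup>+z. g z \<partial>lborel)"
    if [measurable]: "g \<in> borel_measurable (borel :: complex measure)" and c: "cmod c = 1" and b: "Im c \<noteq> 0"
    for g and c :: complex
  proof -
    \<comment> \<open>For \<open>c = cis \<phi>\<close> the number \<open>t\<close> is
      \<open>- tan (\<phi> / 2)\<close>: a horizontal shear by \<open>t\<close>, a vertical one by
      \<open>b = sin \<phi>\<close> and again a horizontal one by \<open>t\<close> compose to the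
      rotation.\<close>
    define a b t where "a = Re c" and "b = Im c" and "t = (a - 1) / b"
    have ab: "a\<^sup>2 + b\<^sup>2 = 1" using c by (simp add: a_def b_def cmod_def)
    have bt: "b * t = a - 1" using b by (simp add: t_def b_def)
    have tt: "t * (1 + a) = - b"
    proof -
      have "b * (t * (1 + a)) = (a - 1) * (1 + a)"
        by (simp add: bt flip: mult.assoc)
      also have "\<dots> = b * (- b)"
        using ab by (simp add: algebra_simps power2_eq_square)
      finally have "b * (t * (1 + a) + b) = 0" by (simp add: algebra_simps)
      then show ?thesis using b by (simp add: b_def)
    qed
    let ?g1 = "\<lambda>z. g (Complex (Re z + t * Im z) (Im z))"
    let ?g2 = "\<lambda>z. ?g1 (Complex (Re z) (Im z + b * Re z))"
    have [measurable]: "?g1 \<in> borel_measurable borel" "?g2 \<in> borel_measurable borel"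
      by (simp_all add: Complex_eq)
    have "(\<integral>\<^sup>+z. g z \<partial>lborel) = (\<integral>\<^sup>+z. ?g2 (Complex (Re z + t * Im z) (Im z)) \<partial>lborel)"
    proof -
      have "(\<integral>\<^sup>+z. ?g2 (Complex (Re z + t * Im z) (Im z)) \<partial>lborel) = (\<integral>\<^sup>+z. ?g2 z \<partial>lborel)"
        by (rule nn_integral_shear_Re) measurable
      moreover have "(\<integral>\<^sup>+z. ?g2 z \<partial>lborel) = (\<integral>\<^sup>+z. ?g1 z \<partial>lborel)"
        by (rule nn_integral_shear_Im) measurable
      moreover have "(\<integral>\<^sup>+z. ?g1 z \<partial>lborel) = (\<integral>\<^sup>+z. g z \<partial>lborel)"
        by (rule nn_integral_shear_Re) measurable
      ultimately show ?thesis by (simp only:)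
    qed
    also have "\<dots> = (\<integral>\<^sup>+z. g (c * z) \<partial>lborel)"
    proof (intro nn_integral_cong arg_cong[where f=g])
      fix z :: complex
      have 1: "Im z + b * (Re z + t * Im z) = a * Im z + b * Re z"
        using bt by (simp add: algebra_simps) (metis bt distrib_right mult.assoc diff_add_cancel mult.left_neutral add.commute)
      have "Re z + t * Im z + t * (a * Im z + b * Re z) = Re z * (1 + b * t) + (t * (1 + a)) * Im z"
        by (simp add: algebra_simps)
      also have "\<dots> = a * Re z - b * Im z" using bt tt by simp
      finally show "Complex (Re (Complex (Re (Complex (Re z + t * Im z) (Im z))) (Im (Complex (Re z + t * Im z) (Im z)) + b * Re (Complex (Re z + t * Im z) (Im z)))) +
             t * Im (Complex (Re (Complex (Re z + t * Im z) (Im z))) (Im (Complex (Re z + t * Im z) (Im z)) + b * Re (Complex (Re z + t * Im z) (Im z)))))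
         (Im (Complex (Re (Complex (Re z + t * Im z) (Im z))) (Im (Complex (Re z + t * Im z) (Im z)) + b * Re (Complex (Re z + t * Im z) (Im z))))) = c * z"
        using 1 by (simp add: complex_eq_iff a_def b_def)
    qed
    finally show ?thesis ..
  qed
  show ?thesis
  proof (cases "Im c = 0")
    case False
    then show ?thesis using gen c f by blast
  next
    case True
    \<comment> \<open>The two excluded rotations, by 1 and by -1, are written as
      \<open>\<i> * (- \<i> * c)\<close>, a product of two rotations with nonzero imaginary
      part.\<close>
    have i: "cmod (- \<i> * c) = 1" "cmod \<i> = 1" "Im (- \<i> * c) \<noteq> 0" "Im \<i> \<noteq> 0"
      using c True by (auto simp: norm_mult cmod_def)
    have "(\<integral>\<^sup>+z. f z \<partial>lborel) = (\<integral>\<^sup>+z. f (\<i> * z) \<partial>lborel)"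
      by (rule gen[symmetric]) (use i in auto)
    also have "\<dots> = (\<integral>\<^sup>+z. f (\<i> * ((- \<i> * c) * z)) \<partial>lborel)"
      by (rule gen[symmetric, of "\<lambda>z. f (\<i> * z)"]) (use i in auto)
    finally show ?thesis by (simp add: algebra_simps)
  qed
qed

lemma distr_lborel_rotate:
  assumes c: "cmod c = 1"
  shows "distr lborel borel (\<lambda>z. c * z) = lborel"
proof (rule measure_eqI)
  fix A :: "complex set" assume "A \<in> sets (distr lborel borel ((*) c))"
  then have [measurable]: "A \<in> sets borel" by simp
  have "emeasure (distr lborel borel ((*) c)) A = (\<integral>\<^sup>+z. indicator A z \<partial>distr lborel borel ((*) c))"
    by simp
  also have "\<dots> = (\<integral>\<^sup>+z. indicator A (c * z) \<partial>lborel)"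
    by (subst nn_integral_distr) auto
  also have "\<dots> = emeasure lborel A"
    by (subst nn_integral_lborel_rotate[OF _ c]) auto
  finally show "emeasure (distr lborel borel ((*) c)) A = emeasure lborel A" .
qed simp

lemma emeasure_lborel_disc:
  fixes r :: real
  assumes "0 \<le> r"
  shows "emeasure lborel {z::complex. cmod z \<le> r} = ennreal (pi * r\<^sup>2)"
proof -
  have "{z::complex. cmod z \<le> r} = cball 0 r" by (auto simp: )
  then show ?thesis using emeasure_cball[of r "0::complex"] assms
    by (simp add: unit_ball_vol_2)
qed

text \<open>The half-lines generate the Borel sets, so the radial part of polar coordinates follows
  from the area \<open>pi * r\<^sup>2\<close> of discs alone, without a change of variables.\<close>

lemma distr_lborel_cmod:
  "distr (lborel :: complex measure) borel cmod = density lborel (\<lambda>r. ennreal (2 * pi * r) * indicator {0..} r)"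
proof (rule measure_eqI_generator_eq[where E="range atMost" and \<Omega>=UNIV and A="\<lambda>n. {.. real n}"])
  show "Int_stable (range atMost :: real set set)"
    by (auto simp: Int_stable_def)
  show "sets (distr (lborel :: complex measure) borel cmod) = sigma_sets UNIV (range atMost)"
    by (simp add: borel_eq_atMost)
  show "sets (density lborel (\<lambda>r. ennreal (2 * pi * r) * indicator {0..} r)) = sigma_sets UNIV (range atMost)"
    by (simp add: borel_eq_atMost)
  have m[measurable]: "(\<lambda>r::real. ennreal (2 * pi * r) * indicator {0..} r) \<in> borel_measurable borel"
    by measurable
  have *: "emeasure (distr (lborel :: complex measure) borel cmod) {..r} = (if r < 0 then 0 else ennreal (pi * r\<^sup>2))" for r
  proof -
    have "emeasure (distr (lborel :: complex measure) borel cmod) {..r} = emeasure lborel {z::complex. cmod z \<le> r}"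
      by (subst emeasure_distr) (auto intro!: arg_cong2[where f=emeasure])
    moreover have "{z::complex. cmod z \<le> r} = {}" if "r < 0" using that
      by (metis (mono_tags, lifting) Collect_empty_eq norm_ge_zero not_less order_trans)
    ultimately show ?thesis using emeasure_lborel_disc[of r] by auto
  qed
  have **: "emeasure (density lborel (\<lambda>r. ennreal (2 * pi * r) * indicator {0..} r)) {..r} =
    (if r < 0 then 0 else ennreal (pi * r\<^sup>2))" for r :: real
  proof (cases "r < 0")
    case True
    then have "(\<integral>\<^sup>+ x. ennreal (2 * pi * x) * indicator {0..} x * indicator {..r} x \<partial>lborel) = (\<integral>\<^sup>+ x. 0 \<partial>(lborel::real measure))"
      by (intro nn_integral_cong) (auto simp: indicator_def)
    then show ?thesis using True by (simp add: emeasure_density)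
  next
    case False
    have "(\<integral>\<^sup>+ x. ennreal (2 * pi * x) * indicator {0..} x * indicator {..r} x \<partial>lborel) =
      (\<integral>\<^sup>+ x. ennreal (2 * pi * x) * indicator {0..r} x \<partial>lborel)"
      by (intro nn_integral_cong) (auto simp: indicator_def)
    also have "\<dots> = ennreal (pi * r\<^sup>2 - pi * 0\<^sup>2)"
      using False by (intro nn_integral_FTC_Icc) (auto intro!: derivative_eq_intros)
    finally show ?thesis using False by (simp add: emeasure_density)
  qed
  show "emeasure (distr (lborel :: complex measure) borel cmod) X =
     emeasure (density lborel (\<lambda>r. ennreal (2 * pi * r) * indicator {0..} r)) X" if "X \<in> range atMost" for X
    using that * ** by auto
  show "emeasure (distr (lborel :: complex measure) borel cmod) {..real n} \<noteq> \<infinity>" for n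
    by (simp add: *)
  show "(\<Union>n. {..real n}) = UNIV" by (auto intro: real_arch_simple)
qed auto


text \<open>Weights are only Lebesgue measurable, so composing them with \<open>cmod\<close>
  requires that preimages of null sets be null; continuity of \<open>cmod\<close> would not give
  this, the density of its distribution does.\<close>

lemma cmod_vimage_null_sets:
  assumes "N \<in> null_sets (lborel :: real measure)"
  shows "cmod -` N \<in> null_sets (lborel :: complex measure)"
proof -
  have [measurable]: "N \<in> sets borel" using assms by auto
  have "emeasure (lborel :: complex measure) (cmod -` N) = emeasure (distr (lborel :: complex measure) borel cmod) N"
    by (subst emeasure_distr) auto
  also have "\<dots> = (\<integral>\<^sup>+ x. ennreal (2 * pi * x) * indicator {0..} x * indicator N x \<partial>lborel)"
    unfolding distr_lborel_cmod by (subst emeasure_density) auto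
  also have "\<dots> = (\<integral>\<^sup>+ x. 0 \<partial>(lborel :: real measure))"
    by (intro nn_integral_cong_AE, use AE_not_in[OF assms] in eventually_elim) auto
  finally show ?thesis by (simp add: null_sets_def vimage_def)
qed

lemma cmod_measurable_lebesgue [measurable]: "cmod \<in> lebesgue \<rightarrow>\<^sub>M lebesgue"
proof (rule completion.measurable_completion2)
  show "cmod \<in> lebesgue \<rightarrow>\<^sub>M lborel"
    by (simp add: measurable_completion)
  show "null_sets lborel \<subseteq> null_sets (distr lebesgue lborel cmod)"
  proof
    fix N :: "real set" assume N: "N \<in> null_sets lborel"
    then have "cmod -` N \<in> null_sets lborel" by (rule cmod_vimage_null_sets)
    then show "N \<in> null_sets (distr lebesgue lborel cmod)"
      using N by (subst null_sets_distr_iff) (auto simp: measurable_completion null_sets_completionI)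
  qed
qed

lemma cmod_measurable_disc [measurable]: "cmod \<in> lebesgue_on unit_disc \<rightarrow>\<^sub>M lebesgue_on {0..<1}"
  by (rule measurable_restrict_space3) (auto simp: )

lemma nn_integral_disc_radial:
  fixes g :: "real \<Rightarrow> ennreal"
  assumes g: "g \<in> borel_measurable (lebesgue_on {0..<1})"
  shows "(\<integral>\<^sup>+z. g (cmod z) \<partial>lebesgue_on unit_disc) = (\<integral>\<^sup>+r. ennreal (2 * pi * r) * g r \<partial>lebesgue_on {0..<1})"
proof -
  let ?g = "\<lambda>r. g r * indicator {0..<1} r"
  have m: "?g \<in> borel_measurable lebesgue"
    using g by (subst (asm) borel_measurable_restrict_space_iff_ennreal) auto
  \<comment> \<open>The distribution identity is one between Borel measures, hence the passage to a
    Borel representative; the exceptional set pulls back to a null set of the plane.\<close>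
  obtain h where h[measurable]: "h \<in> borel_measurable lborel" and ae: "AE r in lborel. ?g r = h r"
    using completion_ex_borel_measurable[OF m] by auto
  obtain N where N: "N \<in> null_sets lborel" "{r \<in> space lborel. ?g r \<noteq> h r} \<subseteq> N"
    using ae by (auto simp: eventually_ae_filter)
  have ae2: "AE z in (lborel :: complex measure). ?g (cmod z) = h (cmod z)"
    unfolding eventually_ae_filter
    by (rule bexI[OF _ cmod_vimage_null_sets[OF N(1)]]) (use N(2) in auto)
  have ae3: "AE z in (lebesgue :: complex measure). ?g (cmod z) = h (cmod z)"
    using ae2 by (rule AE_completion)
  have "(\<integral>\<^sup>+z. g (cmod z) \<partial>lebesgue_on unit_disc) = (\<integral>\<^sup>+z. g (cmod z) * indicator unit_disc z \<partial>lebesgue)"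
    by (subst nn_integral_restrict_space) auto
  also have "\<dots> = (\<integral>\<^sup>+z. ?g (cmod z) \<partial>lebesgue)"
    by (intro nn_integral_cong) (auto simp: indicator_def)
  also have "\<dots> = (\<integral>\<^sup>+z. h (cmod z) \<partial>lebesgue)"
    by (rule nn_integral_cong_AE[OF ae3])
  also have "\<dots> = (\<integral>\<^sup>+z. h (cmod z) \<partial>lborel)"
    by (rule nn_integral_completion)
  also have "\<dots> = (\<integral>\<^sup>+r. h r \<partial>distr (lborel :: complex measure) borel cmod)"
    by (subst nn_integral_distr) auto
  also have "\<dots> = (\<integral>\<^sup>+r. ennreal (2 * pi * r) * indicator {0..} r * h r \<partial>lborel)"
    unfolding distr_lborel_cmod by (subst nn_integral_density) auto
  also have "\<dots> = (\<integral>\<^sup>+r. ennreal (2 * pi * r) * indicator {0..} r * h r \<partial>lebesgue)"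
    by (rule nn_integral_completion[symmetric])
  also have "\<dots> = (\<integral>\<^sup>+r. ennreal (2 * pi * r) * indicator {0..} r * ?g r \<partial>lebesgue)"
    by (intro nn_integral_cong_AE, use AE_completion[OF ae] in eventually_elim) auto
  also have "\<dots> = (\<integral>\<^sup>+r. (ennreal (2 * pi * r) * g r) * indicator {0..<1} r \<partial>lebesgue)"
    by (intro nn_integral_cong) (auto simp: indicator_def)
  also have "\<dots> = (\<integral>\<^sup>+r. ennreal (2 * pi * r) * g r \<partial>lebesgue_on {0..<1})"
    by (subst nn_integral_restrict_space) auto
  finally show ?thesis .
qed

lemma rotate_measurable_disc:
  assumes c: "cmod c = 1"
  shows "(\<lambda>z. c * z) \<in> lebesgue_on unit_disc \<rightarrow>\<^sub>M lebesgue_on unit_disc"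
proof (rule measurable_restrict_space3)
  show "(\<lambda>z. c * z) \<in> lebesgue \<rightarrow>\<^sub>M lebesgue"
  proof (rule completion.measurable_completion2)
    have "distr lebesgue lborel (\<lambda>z. c * z) = distr lborel borel (\<lambda>z. c * z)"
      by (subst distr_completion) (auto cong: distr_cong)
    then show "null_sets lborel \<subseteq> null_sets (distr lebesgue lborel (\<lambda>z. c * z))"
      using distr_lborel_rotate[OF c] by simp
  qed (simp add: measurable_completion)
qed (use c in \<open>auto simp: norm_mult\<close>)

lemma distr_disc_rotate:
  assumes c: "cmod c = 1"
  shows "distr (lebesgue_on unit_disc) (lebesgue_on unit_disc) (\<lambda>z. c * z) = lebesgue_on unit_disc"
proof (rule measure_eqI)
  note [measurable] = rotate_measurable_disc[OF c]
  fix A assume A: "A \<in> sets (distr (lebesgue_on unit_disc) (lebesgue_on unit_disc) ((*) c))"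
  then have A': "A \<in> sets (lebesgue_on unit_disc)" by simp
  then have AL: "A \<in> sets lebesgue" and Ad: "A \<subseteq> unit_disc"
    by (auto simp: sets_restrict_space_iff)
  have cm: "(\<lambda>z. c * z) \<in> lebesgue \<rightarrow>\<^sub>M lborel" by (simp add: measurable_completion)
  have d: "distr lebesgue lborel ((*) c) = lborel"
    using distr_lborel_rotate[OF c] by (subst distr_completion) (auto cong: distr_cong)
  have "distr lebesgue lebesgue ((*) c) = completion (distr lebesgue lborel ((*) c))"
    by (subst completion.completion_distr_eq[OF cm]) (auto simp: d)
  then have L: "distr lebesgue lebesgue ((*) c) = lebesgue" by (simp add: d)
  have cL: "(\<lambda>z. c * z) \<in> lebesgue \<rightarrow>\<^sub>M lebesgue"
    by (rule completion.measurable_completion2[OF cm]) (simp add: d)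
  have vd: "(\<lambda>z. c * z) -` A \<subseteq> unit_disc"
  proof
    fix x assume "x \<in> (\<lambda>z. c * z) -` A"
    then have "c * x \<in> unit_disc" using Ad by auto
    then show "x \<in> unit_disc" using c by (simp add: norm_mult)
  qed
  have "emeasure (distr (lebesgue_on unit_disc) (lebesgue_on unit_disc) ((*) c)) A
      = emeasure (lebesgue_on unit_disc) ((\<lambda>z. c * z) -` A \<inter> unit_disc)"
    using A' by (subst emeasure_distr) auto
  also have "(\<lambda>z. c * z) -` A \<inter> unit_disc = (\<lambda>z. c * z) -` A"
    using vd by auto
  also have "emeasure (lebesgue_on unit_disc) ((\<lambda>z. c * z) -` A) = emeasure lebesgue ((\<lambda>z. c * z) -` A)"
    using vd by (subst emeasure_restrict_space) auto
  also have "\<dots> = emeasure (distr lebesgue lebesgue ((*) c)) A"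
    using AL cL by (subst emeasure_distr) auto
  also have "\<dots> = emeasure lebesgue A" by (simp add: L)
  also have "\<dots> = emeasure (lebesgue_on unit_disc) A"
    using Ad by (subst emeasure_restrict_space) auto
  finally show "emeasure (distr (lebesgue_on unit_disc) (lebesgue_on unit_disc) ((*) c)) A = emeasure (lebesgue_on unit_disc) A" .
qed simp

lemma nn_integral_disc_rotate:
  assumes "cmod c = 1" "f \<in> borel_measurable (lebesgue_on unit_disc)"
  shows "(\<integral>\<^sup>+z. f (c * z) \<partial>lebesgue_on unit_disc) = (\<integral>\<^sup>+z. f z \<partial>lebesgue_on unit_disc)"
  using nn_integral_distr[OF rotate_measurable_disc, of c f] assms
  by (simp add: distr_disc_rotate)

lemma integral_disc_rotate:
  fixes f :: "complex \<Rightarrow> complex"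
  assumes "cmod c = 1" "f \<in> borel_measurable (lebesgue_on unit_disc)"
  shows "(LINT z|lebesgue_on unit_disc. f (c * z)) = (LINT z|lebesgue_on unit_disc. f z)"
  using integral_distr[OF rotate_measurable_disc, of c f] assms
  by (simp add: distr_disc_rotate)

section \<open>Tails and moments of radial weights\<close>

abbreviation unit_itv :: "real measure" where
  "unit_itv \<equiv> lebesgue_on {0..<1}"

text \<open>Real-valued counterpart of \<open>moment\<close>, for ordinary arithmetic. The two agree
  on radial weights by \<open>moment_eq_mom\<close>; without integrability the Bochner integral
  would silently be 0.\<close>

definition mom :: "(real \<Rightarrow> real) \<Rightarrow> real \<Rightarrow> real" where
  "mom \<omega> x = (LINT r|unit_itv. r powr x * \<omega> r)"

lemma radial_weight_nonneg: "radial_weight \<omega> \<Longrightarrow> 0 \<le> r \<Longrightarrow> r < 1 \<Longrightarrow> 0 \<le> \<omega> r"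
  and radial_weight_integrable: "radial_weight \<omega> \<Longrightarrow> integrable unit_itv \<omega>"
  and tail_pos: "radial_weight \<omega> \<Longrightarrow> 0 \<le> r \<Longrightarrow> r < 1 \<Longrightarrow> 0 < tail \<omega> r"
  by (auto simp: radial_weight_def)

lemma borel_measurable_unit_itv:
  fixes f :: "real \<Rightarrow> real"
  assumes "f \<in> borel_measurable borel"
  shows "f \<in> borel_measurable unit_itv"
  using assms by (simp add: measurable_completion measurable_restrict_space1)

lemma integrable_bounded_mult:
  fixes \<omega> g :: "real \<Rightarrow> real"
  assumes "integrable unit_itv \<omega>" "g \<in> borel_measurable unit_itv" "\<And>r. 0 \<le> r \<Longrightarrow> r < 1 \<Longrightarrow> \<bar>g r\<bar> \<le> B"
  shows "integrable unit_itv (\<lambda>r. g r * \<omega> r)"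
proof (rule Bochner_Integration.integrable_bound)
  show "integrable unit_itv (\<lambda>r. B * \<omega> r)" using assms by simp
  show "(\<lambda>r. g r * \<omega> r) \<in> borel_measurable unit_itv"
    using assms by (intro borel_measurable_times) auto
  show "AE r in unit_itv. norm (g r * \<omega> r) \<le> norm (B * \<omega> r)"
    using assms(3) by (intro AE_I2) (force simp: abs_mult intro!: mult_right_mono)
qed

lemma tail_eq_indicator:
  assumes "0 \<le> r"
  shows "tail \<omega> r = (LINT s|unit_itv. indicator {r..<1} s * \<omega> s)"
proof -
  have "tail \<omega> r = (LINT s|lebesgue. indicator {r..<1} s * \<omega> s)"
    unfolding tail_def by (subst integral_restrict_space) auto
  also have "\<dots> = (LINT s|lebesgue. indicator {0..<1} s * (indicator {r..<1} s * \<omega> s))"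
    using assms by (intro Bochner_Integration.integral_cong) (auto simp: indicator_def)
  also have "\<dots> = (LINT s|unit_itv. indicator {r..<1} s * \<omega> s)"
    by (subst integral_restrict_space) auto
  finally show ?thesis .
qed

lemma integrable_indicator_tail:
  assumes "integrable unit_itv \<omega>"
  shows "integrable unit_itv (\<lambda>s. indicator {r..<1} s * \<omega> s :: real)"
  by (rule integrable_bounded_mult[OF assms, of _ 1])
     (auto intro!: borel_measurable_unit_itv simp: indicator_def)

lemma integral_unit_itv_mono:
  fixes f g :: "real \<Rightarrow> real"
  assumes "integrable unit_itv f" "integrable unit_itv g" "\<And>r. 0 \<le> r \<Longrightarrow> r < 1 \<Longrightarrow> f r \<le> g r"
  shows "(LINT r|unit_itv. f r) \<le> (LINT r|unit_itv. g r)"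
  using assms by (intro integral_mono) auto

lemma tail_antimono:
  assumes "radial_weight \<omega>" "0 \<le> r" "r \<le> s"
  shows "tail \<omega> s \<le> tail \<omega> r"
proof -
  note i = integrable_indicator_tail[OF radial_weight_integrable[OF assms(1)]]
  show ?thesis
    using assms unfolding tail_eq_indicator[OF assms(2)] tail_eq_indicator[OF order_trans[OF assms(2,3)]]
    by (intro integral_unit_itv_mono i) (auto simp: indicator_def radial_weight_nonneg)
qed

lemma powr_le_one: "0 \<le> r \<Longrightarrow> r < 1 \<Longrightarrow> 0 \<le> x \<Longrightarrow> r powr x \<le> (1::real)"
  by (simp add: powr_le1)

lemma mom_integrable:
  assumes "radial_weight \<omega>" "0 \<le> x"
  shows "integrable unit_itv (\<lambda>r. r powr x * \<omega> r)"
  using assms by (intro integrable_bounded_mult[of _ _ 1] radial_weight_integrable)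
     (auto intro!: borel_measurable_unit_itv powr_le_one)

lemma mom_antimono:
  assumes "radial_weight \<omega>" "0 \<le> x" "x \<le> y"
  shows "mom \<omega> y \<le> mom \<omega> x"
  unfolding mom_def using assms
  by (intro integral_unit_itv_mono mom_integrable mult_right_mono)
     (auto simp: radial_weight_nonneg powr_mono')

lemma mom_ge_tail:
  assumes w: "radial_weight \<omega>" and "0 \<le> x" "0 < r" "r < 1"
  shows "r powr x * tail \<omega> r \<le> mom \<omega> x"
proof -
  have "r powr x * tail \<omega> r = (LINT s|unit_itv. r powr x * (indicator {r..<1} s * \<omega> s))"
    using assms by (simp add: tail_eq_indicator)
  also have "\<dots> \<le> mom \<omega> x"
    unfolding mom_def using assms
    by (intro integral_unit_itv_mono mom_integrable integrable_mult_right
         integrable_indicator_tail radial_weight_integrable)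
       (auto simp: indicator_def radial_weight_nonneg intro!: mult_right_mono powr_mono2)
  finally show ?thesis .
qed

lemma mom_pos:
  assumes "radial_weight \<omega>" "0 \<le> x"
  shows "0 < mom \<omega> x"
proof -
  have "0 < (1/2) powr x * tail \<omega> (1/2)" using assms by (simp add: tail_pos)
  also have "\<dots> \<le> mom \<omega> x" by (rule mom_ge_tail) (use assms in auto)
  finally show ?thesis .
qed

lemma tail_0: "tail \<omega> 0 = (LINT r|unit_itv. \<omega> r)"
  by (simp add: tail_def)

lemma mom_le_tail_0:
  assumes "radial_weight \<omega>" "0 \<le> x"
  shows "mom \<omega> x \<le> tail \<omega> 0"
  unfolding mom_def tail_0 using assms
  by (intro integral_unit_itv_mono mom_integrable radial_weight_integrable mult_left_le_one_le)
     (auto simp: radial_weight_nonneg powr_le_one)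

text \<open>Below \<open>t\<close> the part \<open>y\<close> of the exponent is spent on
  \<open>r powr y \<le> t powr y\<close>; from \<open>t\<close> on the power is bounded by
  1.\<close>

lemma mom_split:
  assumes w: "radial_weight \<omega>" and y: "0 \<le> y" "y \<le> x" and t: "0 \<le> t" "t < 1"
  shows "mom \<omega> x \<le> tail \<omega> t + t powr y * mom \<omega> (x - y)"
proof -
  have i: "integrable unit_itv (\<lambda>s. indicator {t..<1} s * \<omega> s)"
    "integrable unit_itv (\<lambda>s. t powr y * (s powr (x - y) * \<omega> s))"
    "integrable unit_itv (\<lambda>r. r powr x * \<omega> r)"
    by (intro integrable_indicator_tail radial_weight_integrable w,
        intro integrable_mult_right mom_integrable w, use y in simp,
        intro mom_integrable w, use y in simp)
  have "mom \<omega> x \<le> (LINT s|unit_itv. indicator {t..<1} s * \<omega> s + t powr y * (s powr (x - y) * \<omega> s))"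
    unfolding mom_def
  proof (intro integral_unit_itv_mono Bochner_Integration.integrable_add i)
    fix r :: real assume r: "0 \<le> r" "r < 1"
    have o: "0 \<le> \<omega> r" using r w by (simp add: radial_weight_nonneg)
    show "r powr x * \<omega> r \<le> indicator {t..<1} r * \<omega> r + t powr y * (r powr (x - y) * \<omega> r)"
    proof (cases "t \<le> r")
      case True
      have "r powr x * \<omega> r \<le> 1 * \<omega> r"
        using r y o by (intro mult_right_mono powr_le_one) auto
      moreover have "0 \<le> t powr y * (r powr (x - y) * \<omega> r)" using o by simp
      ultimately show ?thesis using True r by simp
    next
      case False
      have "r powr x = r powr y * r powr (x - y)" by (simp flip: powr_add)
      also have "\<dots> \<le> t powr y * r powr (x - y)"
        using False r y by (intro mult_right_mono powr_mono2) auto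
      finally have "r powr x * \<omega> r \<le> t powr y * r powr (x - y) * \<omega> r"
        using o by (intro mult_right_mono) auto
      then show ?thesis using False by (simp add: mult.assoc)
    qed
  qed
  also have "\<dots> = tail \<omega> t + t powr y * mom \<omega> (x - y)"
    using t unfolding tail_eq_indicator[OF t(1)] mom_def
    by (subst Bochner_Integration.integral_add[OF i(1,2)]) simp
  finally show ?thesis .
qed

lemma moment_eq_mom:
  assumes "radial_weight \<omega>" "0 \<le> x"
  shows "moment \<omega> x = ennreal (mom \<omega> x)"
  unfolding moment_def mom_def using assms
  by (intro nn_integral_eq_integral mom_integrable)
     (auto intro!: AE_I2 simp: radial_weight_nonneg)

lemma powr_le_exp:
  fixes r x :: real
  assumes "0 \<le> r" "0 \<le> x"
  shows "r powr x \<le> exp (- x * (1 - r))"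
proof (cases "r = 0")
  case False
  then have "ln r \<le> r - 1" using assms by (intro ln_le_minus_one) auto
  then have "x * ln r \<le> x * (r - 1)" using assms by (intro mult_left_mono) auto
  then show ?thesis using False by (simp add: powr_def algebra_simps)
qed auto

lemma powr_ge_exp:
  fixes u x :: real
  assumes "0 \<le> u" "u < 1" "0 \<le> x"
  shows "exp (- x * (u / (1 - u))) \<le> (1 - u) powr x"
proof -
  have "- ln (1 - u) = ln (1 / (1 - u))" using assms by (simp add: ln_div)
  also have "\<dots> \<le> 1 / (1 - u) - 1" using assms by (intro ln_le_minus_one) auto
  also have "\<dots> = u / (1 - u)" using assms by (simp add: field_simps)
  finally have "- (u / (1 - u)) \<le> ln (1 - u)" by simp
  then have "x * - (u / (1 - u)) \<le> x * ln (1 - u)" using assms by (intro mult_left_mono) auto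
  then show ?thesis using assms by (simp add: powr_def)
qed

text \<open>At the point \<open>1 - 1 / (x + 2)\<close> the power of order \<open>x\<close> is still
  at least \<open>exp (- 1)\<close>. The summand 2 keeps the point inside the open interval for
  every \<open>x \<ge> 0\<close>.\<close>

lemma tail_le_mom:
  assumes w: "radial_weight \<omega>" and x: "0 \<le> x"
  shows "tail \<omega> (1 - 1 / (x + 2)) \<le> exp 1 * mom \<omega> x"
proof -
  have "exp (-1) \<le> exp (- x * ((1 / (x + 2)) / (1 - 1 / (x + 2))))"
    using x by (simp add: field_simps)
  also have "\<dots> \<le> (1 - 1 / (x + 2)) powr x"
    using x by (intro powr_ge_exp) (auto simp: field_simps)
  finally have "exp (-1) * tail \<omega> (1 - 1 / (x + 2)) \<le> (1 - 1 / (x + 2)) powr x * tail \<omega> (1 - 1 / (x + 2))"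
    using x w by (intro mult_right_mono less_imp_le[OF tail_pos]) auto
  also have "\<dots> \<le> mom \<omega> x"
    using x w by (intro mom_ge_tail) (auto simp: field_simps)
  finally show ?thesis by (simp add: exp_minus field_simps)
qed

lemma power_le_exp:
  fixes \<epsilon> :: real
  assumes "0 < \<epsilon>"
  shows "\<exists>C\<ge>1. \<forall>u\<ge>0. u ^ \<beta> \<le> C * exp (\<epsilon> * u)"
proof (cases "\<beta> = 0")
  case True
  then show ?thesis using assms by (intro exI[of _ 1]) auto
next
  case False
  have b: "u ^ \<beta> \<le> (max 1 (\<beta> / \<epsilon>)) ^ \<beta> * exp (\<epsilon> * u)" if "0 \<le> u" for u :: real
  proof -
    have "u = (\<beta> / \<epsilon>) * (\<epsilon> * u / \<beta>)" using False assms by simp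
    also have "\<dots> \<le> (\<beta> / \<epsilon>) * exp (\<epsilon> * u / \<beta>)"
    proof (intro mult_left_mono)
      show "\<epsilon> * u / \<beta> \<le> exp (\<epsilon> * u / \<beta>)"
        using exp_ge_add_one_self[of "\<epsilon> * u / \<beta>"] by linarith
    qed (use assms in auto)
    also have "\<dots> \<le> max 1 (\<beta> / \<epsilon>) * exp (\<epsilon> * u / \<beta>)" by (intro mult_right_mono) auto
    finally have "u ^ \<beta> \<le> (max 1 (\<beta> / \<epsilon>) * exp (\<epsilon> * u / \<beta>)) ^ \<beta>"
      using that by (intro power_mono) auto
    also have "\<dots> = (max 1 (\<beta> / \<epsilon>)) ^ \<beta> * exp (\<epsilon> * u)"
      using False by (simp add: power_mult_distrib flip: exp_of_nat_mult)
    finally show ?thesis .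
  qed
  show ?thesis
    by (rule exI[of _ "(max 1 (\<beta> / \<epsilon>)) ^ \<beta>"]) (use b in \<open>auto intro: one_le_power\<close>)
qed

section \<open>Doubling of tails and of moments\<close>

lemma D_hat_radial_weight: "\<omega> \<in> D_hat \<Longrightarrow> radial_weight \<omega>"
  and D_check_radial_weight: "\<omega> \<in> D_check \<Longrightarrow> radial_weight \<omega>"
  by (auto simp: D_hat_def D_check_def)

text \<open>Away from 1 the inequality costs only a constant: the left side is at most
  \<open>tail \<omega> 0\<close>, and the right side is bounded below because tails are positive and
  decreasing.\<close>

lemma D_hat_half:
  assumes "\<omega> \<in> D_hat"
  shows "\<exists>C\<ge>1. \<forall>r. 0 \<le> r \<and> r < 1 \<longrightarrow> tail \<omega> r \<le> C * tail \<omega> ((1 + r) / 2)"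
proof -
  have w: "radial_weight \<omega>" using assms by (rule D_hat_radial_weight)
  obtain C where "C > 0" and ev: "\<forall>\<^sub>F r in at_left 1. tail \<omega> r \<le> C * tail \<omega> ((1 + r) / 2)"
    using assms by (auto simp: D_hat_def)
  then obtain b where b: "b < 1" "\<And>r. b < r \<Longrightarrow> r < 1 \<Longrightarrow> tail \<omega> r \<le> C * tail \<omega> ((1 + r) / 2)"
    by (auto simp: eventually_at_left_field)
  define b' where "b' = max b 0"
  have b': "0 \<le> b'" "b' < 1" using b by (auto simp: b'_def)
  define D where "D = max (max 1 C) (tail \<omega> 0 / tail \<omega> ((1 + b') / 2))"
  have D: "1 \<le> D" "C \<le> D" "tail \<omega> 0 / tail \<omega> ((1 + b') / 2) \<le> D" by (auto simp: D_def)
  have "tail \<omega> r \<le> D * tail \<omega> ((1 + r) / 2)" if r: "0 \<le> r" "r < 1" for r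
  proof (cases "b < r")
    case True
    then have "tail \<omega> r \<le> C * tail \<omega> ((1 + r) / 2)" using b r by auto
    also have "\<dots> \<le> D * tail \<omega> ((1 + r) / 2)"
      using r D less_imp_le[OF tail_pos[OF w, of "(1 + r) / 2"]] by (intro mult_right_mono) auto
    finally show ?thesis .
  next
    case False
    then have rb: "r \<le> b'" by (auto simp: b'_def)
    have p: "0 < tail \<omega> ((1 + b') / 2)" using b' by (intro tail_pos w) auto
    have "tail \<omega> r \<le> tail \<omega> 0" using r by (intro tail_antimono w) auto
    also have "\<dots> = tail \<omega> 0 / tail \<omega> ((1 + b') / 2) * tail \<omega> ((1 + b') / 2)" using p by simp
    also have "\<dots> \<le> D * tail \<omega> ((1 + r) / 2)"
      using D p rb r b' by (intro mult_mono tail_antimono w) auto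
    finally show ?thesis .
  qed
  then show ?thesis using D(1) by blast
qed

lemma D_hat_iterate:
  assumes w: "radial_weight \<omega>" and C: "0 \<le> C"
    and h: "\<And>r. 0 \<le> r \<Longrightarrow> r < 1 \<Longrightarrow> tail \<omega> r \<le> C * tail \<omega> ((1 + r) / 2)"
    and u: "0 < u" "u \<le> 1"
  shows "tail \<omega> (1 - u) \<le> C ^ k * tail \<omega> (1 - u / 2 ^ k)"
proof (induction k)
  case (Suc k)
  have p: "(1::real) \<le> 2 ^ k" by simp
  have "u / 2 ^ k \<le> u / 1" using p u by (intro divide_left_mono) auto
  moreover have "u \<le> 2 ^ k" using p u by linarith
  ultimately have "tail \<omega> (1 - u / 2 ^ k) \<le> C * tail \<omega> ((1 + (1 - u / 2 ^ k)) / 2)"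
    using u by (intro h) auto
  then have "C ^ k * tail \<omega> (1 - u / 2 ^ k) \<le> C ^ k * (C * tail \<omega> ((1 + (1 - u / 2 ^ k)) / 2))"
    using C by (intro mult_left_mono) auto
  also have "(1 + (1 - u / 2 ^ k)) / 2 = 1 - u / 2 ^ Suc k" by (simp add: field_simps)
  finally show ?case using Suc.IH by (simp add: mult_ac)
qed simp

text \<open>Halving the distance to 1 about \<open>log 2 (u / v)\<close> times costs a power of the
  doubling constant; bounding that constant by \<open>2 ^ \<beta>\<close> turns the cost into a
  power of \<open>u / v\<close>. The exponent is a natural number so that
  \<open>power_le_exp\<close> applies to it.\<close>

lemma D_hat_poly:
  assumes "\<omega> \<in> D_hat"
  shows "\<exists>C\<ge>1. \<exists>\<beta>::nat. \<forall>u v. 0 < v \<and> v \<le> u \<and> u \<le> 1 \<longrightarrow> tail \<omega> (1 - u) \<le> C * (u / v) ^ \<beta> * tail \<omega> (1 - v)"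
proof -
  have w: "radial_weight \<omega>" using assms by (rule D_hat_radial_weight)
  obtain C where C: "1 \<le> C" "\<And>r. 0 \<le> r \<Longrightarrow> r < 1 \<Longrightarrow> tail \<omega> r \<le> C * tail \<omega> ((1 + r) / 2)"
    using D_hat_half[OF assms] by blast
  obtain \<beta> :: nat where \<beta>: "C < 2 ^ \<beta>" using real_arch_pow[of 2 C] by auto
  have "tail \<omega> (1 - u) \<le> 2 ^ \<beta> * (u / v) ^ \<beta> * tail \<omega> (1 - v)" if uv: "0 < v" "v \<le> u" "u \<le> 1" for u v
  proof -
    \<comment> \<open>Minimality gives \<open>2 ^ n \<le> 2 * (u / v)\<close>, which converts the
      number of halvings back into the ratio.\<close>
    define n where "n = (LEAST n. u / v < 2 ^ n)"
    have ex: "\<exists>n. u / v < 2 ^ n" using real_arch_pow[of 2 "u / v"] by auto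
    have n: "u / v < 2 ^ n" unfolding n_def by (rule LeastI_ex[OF ex])
    have n2: "2 ^ n \<le> 2 * (u / v)"
    proof (cases n)
      case 0
      then show ?thesis using n uv by (simp add: field_simps)
    next
      case (Suc m)
      then have "\<not> u / v < 2 ^ m" unfolding n_def using not_less_Least[of m "\<lambda>n. u / v < 2 ^ n"] by auto
      then show ?thesis using Suc by simp
    qed
    have pv: "0 \<le> tail \<omega> (1 - v)" using uv less_imp_le[OF tail_pos[OF w, of "1 - v"]] by auto
    have "u / 2 ^ n \<le> v" using n uv by (simp add: field_simps)
    moreover have "u / 2 ^ n \<le> u / 1" using uv by (intro divide_left_mono) auto
    ultimately have "tail \<omega> (1 - u / 2 ^ n) \<le> tail \<omega> (1 - v)" using uv by (intro tail_antimono w) auto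
    then have "C ^ n * tail \<omega> (1 - u / 2 ^ n) \<le> C ^ n * tail \<omega> (1 - v)"
      using C by (intro mult_left_mono) auto
    also have "\<dots> \<le> (2 ^ \<beta>) ^ n * tail \<omega> (1 - v)"
      using C \<beta> pv by (intro mult_right_mono power_mono) auto
    also have "((2::real) ^ \<beta>) ^ n = (2 ^ n) ^ \<beta>" by (simp flip: power_mult add: mult.commute)
    also have "\<dots> * tail \<omega> (1 - v) \<le> (2 * (u / v)) ^ \<beta> * tail \<omega> (1 - v)"
      using pv n2 by (intro mult_right_mono power_mono) auto
    finally have "C ^ n * tail \<omega> (1 - u / 2 ^ n) \<le> 2 ^ \<beta> * (u / v) ^ \<beta> * tail \<omega> (1 - v)"
      by (simp add: power_mult_distrib power_divide)
    moreover have "tail \<omega> (1 - u) \<le> C ^ n * tail \<omega> (1 - u / 2 ^ n)"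
      using C uv by (intro D_hat_iterate w) auto
    ultimately show ?thesis by linarith
  qed
  then show ?thesis by (intro exI[of _ "2 ^ \<beta>"] conjI exI[of _ \<beta>]) auto
qed

lemma D_hat_scale:
  assumes "\<omega> \<in> D_hat" "1 \<le> A"
  shows "\<exists>C\<ge>1. \<forall>u. 0 < u \<and> u \<le> 1 \<longrightarrow> tail \<omega> (1 - u) \<le> C * tail \<omega> (1 - u / A)"
proof -
  obtain C \<beta> where C: "1 \<le> C" "\<And>u v. 0 < v \<Longrightarrow> v \<le> u \<Longrightarrow> u \<le> 1 \<Longrightarrow> tail \<omega> (1 - u) \<le> C * (u / v) ^ \<beta> * tail \<omega> (1 - v)"
    using D_hat_poly[OF assms(1)] by blast
  have "tail \<omega> (1 - u) \<le> C * A ^ \<beta> * tail \<omega> (1 - u / A)" if "0 < u" "u \<le> 1" for u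
    using C(2)[of "u / A" u] that assms(2) by (simp add: divide_le_eq mult_le_cancel_left1)
  moreover have "1 * 1 \<le> C * A ^ \<beta>" using C(1) assms(2) by (intro mult_mono one_le_power) auto
  ultimately show ?thesis by (intro exI[of _ "C * A ^ \<beta>"]) auto
qed


text \<open>Induction on the scale of \<open>x\<close>: splitting the moment at \<open>1 - M / (x + 2)\<close> reduces \<open>x\<close> to \<open>x / 2\<close> with a
  factor \<open>exp (- M / 4)\<close>, which beats the doubling constant.\<close>

lemma mom_le_tail:
  assumes "\<omega> \<in> D_hat"
  shows "\<exists>C>0. \<forall>x\<ge>0. mom \<omega> x \<le> C * tail \<omega> (1 - 1 / (x + 2))"
proof -
  have w: "radial_weight \<omega>" using assms by (rule D_hat_radial_weight)
  obtain C2 where C2: "1 \<le> C2" "\<And>u. 0 < u \<Longrightarrow> u \<le> 1 \<Longrightarrow> tail \<omega> (1 - u) \<le> C2 * tail \<omega> (1 - u / 2)"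
    using D_hat_scale[OF assms, of 2] by auto
  \<comment> \<open>Chosen so that \<open>exp (- M / 4) * C2 = 1 / 2\<close>. The quarter is half of
    the exponent, which is what the splitting spends, times
    \<open>x / (x + 2) \<ge> 1 / 2\<close>.\<close>
  define M where "M = 4 * ln (2 * C2)"
  have M: "0 < M" "exp (- M / 4) * C2 = 1 / 2" using C2 by (auto simp: M_def exp_minus field_simps)
  define M' where "M' = max 1 M"
  have M': "1 \<le> M'" "M \<le> M'" by (auto simp: M'_def)
  obtain CM where CM: "1 \<le> CM" "\<And>u. 0 < u \<Longrightarrow> u \<le> 1 \<Longrightarrow> tail \<omega> (1 - u) \<le> CM * tail \<omega> (1 - u / M')"
    using D_hat_scale[OF assms, of M'] M' by blast
  define x0 where "x0 = M' + 2"
  define T where "T x = tail \<omega> (1 - 1 / (x + 2))" for x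
  have Tpos: "0 < T x" if "0 \<le> x" for x using that unfolding T_def by (intro tail_pos w) auto
  have Tmono: "T y \<le> T x" if "0 \<le> x" "x \<le> y" for x y
    using that unfolding T_def by (intro tail_antimono w) (auto simp: frac_le)
  \<comment> \<open>The first entry closes the induction step in the form
    \<open>CM + A / 2 \<le> A\<close>; the second covers the base range
    \<open>x \<le> x0\<close>.\<close>
  define A where "A = max (2 * CM) (tail \<omega> 0 / T x0)"
  have A: "2 * CM \<le> A" "tail \<omega> 0 / T x0 \<le> A" "0 < A" using CM by (auto simp: A_def)
  have "mom \<omega> x \<le> A * T x" if "0 \<le> x" "x \<le> 2 ^ n * x0" for x n
    using that
  proof (induction n arbitrary: x)
    case 0
    have p: "0 < T x0" using M' by (intro Tpos) (auto simp: x0_def)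
    have "mom \<omega> x \<le> tail \<omega> 0" using 0 by (intro mom_le_tail_0 w)
    also have "\<dots> = tail \<omega> 0 / T x0 * T x0" using p by simp
    also have "\<dots> \<le> A * T x" using A p 0 by (intro mult_mono Tmono) auto
    finally show ?case .
  next
    case (Suc n)
    show ?case
    proof (cases "x \<le> x0")
      case True
      have "(1::real) \<le> 2 ^ n" by simp
      then have "1 * x0 \<le> 2 ^ n * x0" using M' by (intro mult_right_mono) (auto simp: x0_def)
      then show ?thesis using Suc True by simp
    next
      case False
      then have x: "M' + 2 < x" by (simp add: x0_def)
      have t0: "0 \<le> 1 - M' / (x + 2)" "1 - M' / (x + 2) < 1"
        using x M' by (auto simp: field_simps)
      have "mom \<omega> x \<le> tail \<omega> (1 - M' / (x + 2)) + (1 - M' / (x + 2)) powr (x / 2) * mom \<omega> (x - x / 2)"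
        using x M' t0 by (intro mom_split w) auto
      moreover have "tail \<omega> (1 - M' / (x + 2)) \<le> CM * T x"
        using CM(2)[of "M' / (x + 2)"] x M' by (simp add: T_def)
      moreover have "(1 - M' / (x + 2)) powr (x / 2) * mom \<omega> (x - x / 2) \<le> exp (- M / 4) * (A * (C2 * T x))"
      proof (intro mult_mono)
        have "M * (x + 2) \<le> M' * (2 * x)" using x M M' by (intro mult_mono) auto
        then have "M / 4 \<le> x / 2 * (M' / (x + 2))" using x M' by (simp add: field_simps)
        then have "exp (- (x / 2) * (1 - (1 - M' / (x + 2)))) \<le> exp (- M / 4)" by simp
        moreover have "(1 - M' / (x + 2)) powr (x / 2) \<le> exp (- (x / 2) * (1 - (1 - M' / (x + 2))))"
          using x M' t0 by (intro powr_le_exp) auto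
        ultimately show "(1 - M' / (x + 2)) powr (x / 2) \<le> exp (- M / 4)" by linarith
        have "mom \<omega> (x / 2) \<le> A * T (x / 2)" using Suc x M' by (intro Suc.IH) auto
        also have "T (x / 2) \<le> C2 * T (x + 2)"
        proof -
          have e: "1 / (x / 2 + 2) / 2 = 1 / (x + 2 + 2)" using x M' by (simp add: field_simps)
          show ?thesis using C2(2)[of "1 / (x / 2 + 2)"] x M' unfolding e T_def by simp
        qed
        also have "\<dots> \<le> C2 * T x" using C2 x M' by (intro mult_left_mono Tmono) auto
        finally show "mom \<omega> (x - x / 2) \<le> A * (C2 * T x)" using A by simp
      qed (use x M' in \<open>auto intro!: less_imp_le[OF mom_pos] w\<close>)
      moreover have "exp (- M / 4) * (A * (C2 * T x)) = A / 2 * T x"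
        using M(2) by (metis (no_types, opaque_lifting) mult.assoc mult.commute times_divide_eq_right mult.right_neutral)
      ultimately have "mom \<omega> x \<le> (CM + A / 2) * T x" unfolding distrib_right by linarith
      also have "\<dots> \<le> A * T x" using A Tpos[of x] x M' by (intro mult_right_mono) auto
      finally show ?thesis .
    qed
  qed
  moreover have "\<exists>n. x \<le> 2 ^ n * x0" for x
  proof -
    obtain n where "x / x0 < 2 ^ n" using real_arch_pow[of 2 "x / x0"] by auto
    then show ?thesis using M' by (intro exI[of _ n]) (auto simp: x0_def field_simps)
  qed
  ultimately show ?thesis using A unfolding T_def by blast
qed

text \<open>Moments are comparable to tails at distance \<open>1 / (x + 2)\<close> from 1, and an
  affine change of \<open>x\<close> alters this distance by at most the factor
  \<open>A = a + b + 1\<close>, which the tail absorbs.\<close>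

lemma D_hat_mom_doubling:
  assumes "\<omega> \<in> D_hat" "0 \<le> a" "0 \<le> b"
  shows "\<exists>C>0. \<forall>x\<ge>0. mom \<omega> x \<le> C * mom \<omega> (a * x + b)"
proof -
  have w: "radial_weight \<omega>" using assms by (auto intro: D_hat_radial_weight)
  obtain C where C: "0 < C" "\<And>x. 0 \<le> x \<Longrightarrow> mom \<omega> x \<le> C * tail \<omega> (1 - 1 / (x + 2))"
    using mom_le_tail[OF assms(1)] by blast
  define A where "A = a + b + 1"
  obtain D where D: "1 \<le> D" "\<And>u. 0 < u \<Longrightarrow> u \<le> 1 \<Longrightarrow> tail \<omega> (1 - u) \<le> D * tail \<omega> (1 - u / A)"
    using D_hat_scale[OF assms(1), of A] assms by (auto simp: A_def)
  have "mom \<omega> x \<le> C * D * exp 1 * mom \<omega> (a * x + b)" if x: "0 \<le> x" for x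
  proof -
    have y: "0 \<le> a * x + b" using x assms by simp
    have yx: "a * x + b + 2 \<le> A * (x + 2)" using x assms by (simp add: A_def algebra_simps)
    have "tail \<omega> (1 - 1 / (x + 2)) \<le> D * tail \<omega> (1 - 1 / (x + 2) / A)"
      using x by (intro D) auto
    also have "tail \<omega> (1 - 1 / (x + 2) / A) \<le> tail \<omega> (1 - 1 / (a * x + b + 2))"
    proof (intro tail_antimono w)
      show "1 - 1 / (a * x + b + 2) \<le> 1 - 1 / (x + 2) / A"
        using yx y x by (simp add: frac_le mult.commute)
    qed (use y in auto)
    also have "\<dots> \<le> exp 1 * mom \<omega> (a * x + b)" by (rule tail_le_mom[OF w y])
    finally have "C * tail \<omega> (1 - 1 / (x + 2)) \<le> C * (D * (exp 1 * mom \<omega> (a * x + b)))"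
      using C D by (intro mult_left_mono) auto
    then show ?thesis using C(2)[OF x] by (simp add: mult_ac)
  qed
  then show ?thesis using C D by (intro exI[of _ "C * D * exp 1"]) auto
qed

text \<open>Iterating the hypothesis \<open>k\<close> times costs a power of \<open>q ^ k\<close>, whereas the part of the moment of order
  \<open>q ^ k * x\<close> below \<open>1 - 1 / x\<close> carries a factor \<open>exp (- (q ^ k - 1))\<close>.\<close>

lemma mom_doubling_imp_D_hat:
  assumes w: "radial_weight \<omega>" and q: "1 < q" and C0: "0 \<le> x0"
    and dbl: "\<And>x. x0 \<le> x \<Longrightarrow> mom \<omega> x \<le> C * mom \<omega> (q * x)"
  shows "\<omega> \<in> D_hat"
proof -
  \<comment> \<open>Writing the constant as a power of \<open>q\<close> makes the cost of
    \<open>k\<close> iterations a fixed power of the factor \<open>q ^ k\<close> by which the order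
    has grown.\<close>
  obtain \<beta> :: nat where \<beta>: "max 1 C < q ^ \<beta>" using real_arch_pow[OF q] by blast
  have it: "mom \<omega> x \<le> (q ^ k) ^ \<beta> * mom \<omega> (q ^ k * x)" if x: "x0 \<le> x" for x k
  proof (induction k)
    case (Suc k)
    have qk: "1 \<le> q ^ k" "0 \<le> x" using q x C0 by auto
    then have "1 * x \<le> q ^ k * x" by (intro mult_right_mono) auto
    then have "mom \<omega> (q ^ k * x) \<le> C * mom \<omega> (q * (q ^ k * x))" using x by (intro dbl) auto
    also have "\<dots> \<le> q ^ \<beta> * mom \<omega> (q * (q ^ k * x))"
      using \<beta> q qk by (intro mult_right_mono less_imp_le[OF mom_pos] w) auto
    finally have "(q ^ k) ^ \<beta> * mom \<omega> (q ^ k * x) \<le> (q ^ k) ^ \<beta> * (q ^ \<beta> * mom \<omega> (q * (q ^ k * x)))"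
      using q by (intro mult_left_mono) auto
    with Suc.IH show ?case by (simp add: power_mult_distrib mult_ac)
  qed simp
  obtain D :: real where D: "1 \<le> D" "\<And>u. 0 \<le> u \<Longrightarrow> u ^ \<beta> \<le> D * exp (u / 2)"
    using power_le_exp[of "1/2" \<beta>] by auto
  \<comment> \<open>With \<open>Q = q ^ k\<close> this size of \<open>Q\<close> yields
    \<open>Q ^ \<beta> * exp (- (Q - 1)) \<le> 1 / 2\<close>, so that in \<open>main\<close> the
    moment on the right can be absorbed into the left side.\<close>
  obtain k where k: "max 2 (2 * (ln (2 * D) + 1)) < q ^ k" using real_arch_pow[OF q] by blast
  define Q where "Q = q ^ k"
  have Q: "2 < Q" "2 * (ln (2 * D) + 1) < Q" using k by (auto simp: Q_def)
  have small: "Q ^ \<beta> * exp (- (Q - 1)) \<le> 1 / 2"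
  proof -
    have "Q ^ \<beta> * exp (- (Q - 1)) \<le> D * exp (Q / 2) * exp (- (Q - 1))"
      using D Q by (intro mult_right_mono) auto
    also have "\<dots> = D * exp (1 - Q / 2)" by (simp flip: exp_add)
    also have "\<dots> \<le> D * exp (- ln (2 * D))" using D Q by (intro mult_left_mono) auto
    also have "\<dots> = 1 / 2" using D by (simp add: exp_minus)
    finally show ?thesis .
  qed
  define x1 where "x1 = max x0 2"
  have x1: "x0 \<le> x1" "2 \<le> x1" by (auto simp: x1_def)
  have main: "mom \<omega> x \<le> 2 * Q ^ \<beta> * tail \<omega> (1 - 1 / x)" if x: "x1 \<le> x" for x
  proof -
    have xx: "x0 \<le> x" "2 \<le> x" "x \<le> Q * x" using x x1 Q by (auto simp: mult_le_cancel_right1)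
    have "mom \<omega> (Q * x) \<le> tail \<omega> (1 - 1 / x) + (1 - 1 / x) powr (Q * x - x) * mom \<omega> (Q * x - (Q * x - x))"
      using xx by (intro mom_split w) auto
    also have "(1 - 1 / x) powr (Q * x - x) \<le> exp (- (Q * x - x) * (1 - (1 - 1 / x)))"
      using xx by (intro powr_le_exp) auto
    also have "- (Q * x - x) * (1 - (1 - 1 / x)) = - (Q - 1)" using xx by (simp add: field_simps)
    finally have 1: "mom \<omega> (Q * x) \<le> tail \<omega> (1 - 1 / x) + exp (- (Q - 1)) * mom \<omega> x"
      using mom_pos[OF w, of x] xx by simp
    have "mom \<omega> x \<le> Q ^ \<beta> * mom \<omega> (Q * x)" using it[OF xx(1), of k] by (simp add: Q_def)
    also have "\<dots> \<le> Q ^ \<beta> * (tail \<omega> (1 - 1 / x) + exp (- (Q - 1)) * mom \<omega> x)"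
      using 1 Q by (intro mult_left_mono) auto
    also have "\<dots> = Q ^ \<beta> * tail \<omega> (1 - 1 / x) + Q ^ \<beta> * exp (- (Q - 1)) * mom \<omega> x"
      by (simp add: algebra_simps)
    also have "\<dots> \<le> Q ^ \<beta> * tail \<omega> (1 - 1 / x) + 1 / 2 * mom \<omega> x"
      using small mom_pos[OF w, of x] xx by (intro add_left_mono mult_right_mono) auto
    finally show ?thesis by simp
  qed
  have fin: "tail \<omega> r \<le> exp 2 * Q ^ \<beta> * (2 * Q ^ \<beta>) * tail \<omega> ((1 + r) / 2)" if r: "1 - 1 / x1 < r" "r < 1" for r
  proof -
    define x where "x = 1 / (1 - r)"
    have x: "x1 \<le> x" using r x1 by (simp add: x_def field_simps)
    then have x': "2 \<le> x" "x0 \<le> x" using x1 by auto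
    have rx: "r = 1 - 1 / x" using r by (simp add: x_def)
    have "exp (-2) \<le> exp (- x * ((1 / x) / (1 - 1 / x)))" using x' by (simp add: field_simps)
    also have "\<dots> \<le> (1 - 1 / x) powr x" using x' by (intro powr_ge_exp) auto
    finally have "exp (-2) * tail \<omega> r \<le> r powr x * tail \<omega> r"
      using x' unfolding rx by (intro mult_right_mono less_imp_le[OF tail_pos] w) auto
    also have "\<dots> \<le> mom \<omega> x"
    proof (intro mom_ge_tail w)
      have "1 / x1 \<le> 1 / 2" using x1 by simp
      then show "0 < r" using r by linarith
    qed (use x' r in auto)
    also have "\<dots> \<le> Q ^ \<beta> * mom \<omega> (Q * x)" using it[OF x'(2), of k] by (simp add: Q_def)
    \<comment> \<open>Here \<open>Q > 2\<close> is used. Applying \<open>main\<close> at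
      \<open>2 * x\<close> instead of \<open>x\<close> lands at \<open>1 - 1 / (2 * x)\<close>,
      which is the midpoint between \<open>r\<close> and 1.\<close>
    also have "\<dots> \<le> Q ^ \<beta> * mom \<omega> (2 * x)"
      using Q x' by (intro mult_left_mono mom_antimono w) auto
    also have "\<dots> \<le> Q ^ \<beta> * (2 * Q ^ \<beta> * tail \<omega> (1 - 1 / (2 * x)))"
      using Q x x1 by (intro mult_left_mono main) auto
    also have "1 - 1 / (2 * x) = (1 + r) / 2" unfolding rx using x' by (simp add: field_simps)
    finally show ?thesis by (simp add: exp_minus field_simps)
  qed
  have "\<forall>\<^sub>F r in at_left 1. tail \<omega> r \<le> exp 2 * Q ^ \<beta> * (2 * Q ^ \<beta>) * tail \<omega> ((1 + r) / 2)"
    unfolding eventually_at_left_field using fin x1 by (intro exI[of _ "1 - 1 / x1"]) auto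
  moreover have "0 < exp 2 * Q ^ \<beta> * (2 * Q ^ \<beta>)" using Q by simp
  ultimately show ?thesis using w unfolding D_hat_def by blast
qed


text \<open>A quarter of the power is spent on \<open>tail \<nu> r\<close>, which by doubling
  exceeds its value at \<open>1 - 1 / (x + 2)\<close> at most polynomially; the other three quarters
  stay with \<open>\<sigma>\<close>. What counts later is that more than half remains: at order
  \<open>2 * x\<close> the moment of \<open>\<sigma>\<close> still has order
  \<open>3 / 2 * x\<close>.\<close>

lemma weight_product_mom_le:
  assumes nu: "\<nu> \<in> D_hat" and w: "radial_weight \<omega>" and s: "radial_weight \<sigma>"
    and eq: "\<And>r. 0 \<le> r \<Longrightarrow> r < 1 \<Longrightarrow> \<omega> r = \<sigma> r * tail \<nu> r"
  shows "\<exists>C>0. \<forall>x\<ge>0. mom \<omega> x \<le> C * tail \<nu> (1 - 1 / (x + 2)) * mom \<sigma> (3 * x / 4)"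
proof -
  have n: "radial_weight \<nu>" using nu by (rule D_hat_radial_weight)
  obtain C \<beta> where C: "1 \<le> C" "\<And>u v. 0 < v \<Longrightarrow> v \<le> u \<Longrightarrow> u \<le> 1 \<Longrightarrow> tail \<nu> (1 - u) \<le> C * (u / v) ^ \<beta> * tail \<nu> (1 - v)"
    using D_hat_poly[OF nu] by blast
  \<comment> \<open>The rate \<open>1 / 4\<close> matches the quarter of the power: with
    \<open>v = 1 / (x + 2)\<close> the exponents \<open>- (x / 4) * u\<close> and
    \<open>(u / v) / 4\<close> add up to \<open>u / 2\<close>, hence the harmless factor
    \<open>exp 1\<close> in \<open>E\<close>.\<close>
  obtain D :: real where D: "1 \<le> D" "\<And>u. 0 \<le> u \<Longrightarrow> u ^ \<beta> \<le> D * exp (u / 4)"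
    using power_le_exp[of "1/4" \<beta>] by auto
  define E where "E = C * D * exp 1"
  have E: "1 \<le> E"
  proof -
    have "1 * 1 * 1 \<le> C * D * exp 1" using C D by (intro mult_mono) auto
    then show ?thesis by (simp add: E_def)
  qed
  have pw: "r powr (x / 4) * tail \<nu> r \<le> E * tail \<nu> (1 - 1 / (x + 2))"
    if x: "0 \<le> x" and r: "0 \<le> r" "r < 1" for x r :: real
  proof -
    define v where "v = 1 / (x + 2)"
    have v: "0 < v" "v \<le> 1" using x by (auto simp: v_def)
    have tv: "0 < tail \<nu> (1 - v)" using v by (intro tail_pos n) auto
    show ?thesis
    proof (cases "1 - v \<le> r")
      case True
      have "r powr (x / 4) * tail \<nu> r \<le> 1 * tail \<nu> (1 - v)"
        using r x True v less_imp_le[OF tail_pos[OF n r]] by (intro mult_mono powr_le_one tail_antimono n) auto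
      also have "\<dots> \<le> E * tail \<nu> (1 - v)" using E tv by (intro mult_right_mono) auto
      finally show ?thesis by (simp add: v_def)
    next
      case False
      define u where "u = 1 - r"
      have u: "v \<le> u" "u \<le> 1" "r = 1 - u" using False r by (auto simp: u_def)
      have "r powr (x / 4) * tail \<nu> r \<le> exp (- (x / 4) * u) * (C * (u / v) ^ \<beta> * tail \<nu> (1 - v))"
        using r x u v less_imp_le[OF tail_pos[OF n r]] powr_le_exp[of r "x / 4"] C(2)[of v u]
        by (intro mult_mono) auto
      also have "\<dots> \<le> exp (- (x / 4) * u) * (C * (D * exp ((u / v) / 4)) * tail \<nu> (1 - v))"
        using C D u v tv by (intro mult_left_mono mult_right_mono D) auto
      also have "\<dots> = C * D * exp (u / 2) * tail \<nu> (1 - v)"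
      proof -
        have "- (x / 4) * u + (u / v) / 4 = u / 2" using x by (simp add: v_def field_simps)
        then have "exp (- (x / 4) * u) * exp ((u / v) / 4) = exp (u / 2)" by (simp only: flip: exp_add)
        then show ?thesis by (simp add: mult_ac)
      qed
      also have "\<dots> \<le> E * tail \<nu> (1 - v)"
        unfolding E_def using C D u tv by (intro mult_right_mono mult_left_mono) auto
      finally show ?thesis by (simp add: v_def)
    qed
  qed
  have "mom \<omega> x \<le> E * tail \<nu> (1 - 1 / (x + 2)) * mom \<sigma> (3 * x / 4)" if x: "0 \<le> x" for x
  proof -
    have "mom \<omega> x \<le> (LINT r|unit_itv. E * tail \<nu> (1 - 1 / (x + 2)) * (r powr (3 * x / 4) * \<sigma> r))"
      unfolding mom_def
    proof (intro integral_unit_itv_mono)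
      show "integrable unit_itv (\<lambda>r. r powr x * \<omega> r)" using x by (intro mom_integrable w)
      show "integrable unit_itv (\<lambda>r. E * tail \<nu> (1 - 1 / (x + 2)) * (r powr (3 * x / 4) * \<sigma> r))"
        using x by (intro integrable_mult_right mom_integrable s) auto
      fix r :: real assume r: "0 \<le> r" "r < 1"
      have "r powr x * \<omega> r = r powr (x / 4) * tail \<nu> r * (r powr (3 * x / 4) * \<sigma> r)"
        using eq[OF r] by (simp add: algebra_simps flip: powr_add)
      also have "\<dots> \<le> E * tail \<nu> (1 - 1 / (x + 2)) * (r powr (3 * x / 4) * \<sigma> r)"
        using pw[OF x r] r s by (intro mult_right_mono) (auto simp: radial_weight_nonneg)
      finally show "r powr x * \<omega> r \<le> E * tail \<nu> (1 - 1 / (x + 2)) * (r powr (3 * x / 4) * \<sigma> r)" .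
    qed
    then show ?thesis by (simp add: mom_def)
  qed
  then show ?thesis using E by (intro exI[of _ E]) auto
qed

text \<open>The tail of \<open>\<nu>\<close> is decreasing, so between \<open>r\<close> and
  \<open>t\<close> it lies between its two end values, and beyond \<open>t\<close> it is at most
  \<open>tail \<nu> t\<close>.\<close>

lemma weight_product_tail_bounds:
  assumes n: "radial_weight \<nu>" and w: "radial_weight \<omega>" and s: "radial_weight \<sigma>"
    and eq: "\<And>r. 0 \<le> r \<Longrightarrow> r < 1 \<Longrightarrow> \<omega> r = \<sigma> r * tail \<nu> r"
    and rt: "0 \<le> r" "r \<le> t" "t < 1"
  shows "tail \<nu> t * (tail \<sigma> r - tail \<sigma> t) \<le> tail \<omega> r"
    and "tail \<omega> r \<le> tail \<nu> r * (tail \<sigma> r - tail \<sigma> t) + tail \<nu> t * tail \<sigma> t"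
    and "tail \<omega> r \<le> tail \<nu> r * tail \<sigma> r"
proof -
  have t0: "0 \<le> t" using rt by simp
  have iw: "integrable unit_itv (\<lambda>s. indicator {r..<1} s * \<omega> s)"
    by (intro integrable_indicator_tail radial_weight_integrable w)
  have iS: "integrable unit_itv (\<lambda>s. indicator {r..<1} s * \<sigma> s)" "integrable unit_itv (\<lambda>s. indicator {t..<1} s * \<sigma> s)"
    by (intro integrable_indicator_tail radial_weight_integrable s)+
  have t: "tail \<sigma> r = (LINT s|unit_itv. indicator {r..<1} s * \<sigma> s)" "tail \<sigma> t = (LINT s|unit_itv. indicator {t..<1} s * \<sigma> s)"
    "tail \<omega> r = (LINT s|unit_itv. indicator {r..<1} s * \<omega> s)"
    using rt t0 by (simp_all add: tail_eq_indicator)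
  have "tail \<nu> t * (tail \<sigma> r - tail \<sigma> t) =
    (LINT s|unit_itv. tail \<nu> t * (indicator {r..<1} s * \<sigma> s - indicator {t..<1} s * \<sigma> s))"
    unfolding t using iS by simp
  also have "\<dots> \<le> tail \<omega> r"
    unfolding t
  proof (intro integral_unit_itv_mono iw integrable_mult_right Bochner_Integration.integrable_diff iS)
    fix x :: real assume x: "0 \<le> x" "x < 1"
    have "0 \<le> \<sigma> x" "0 \<le> tail \<nu> x" using x s less_imp_le[OF tail_pos[OF n x]] by (auto simp: radial_weight_nonneg)
    moreover have "tail \<nu> t \<le> tail \<nu> x" if "x < t" using that x by (intro tail_antimono n) auto
    ultimately show "tail \<nu> t * (indicator {r..<1} x * \<sigma> x - indicator {t..<1} x * \<sigma> x) \<le> indicator {r..<1} x * \<omega> x"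
      using x rt by (auto simp: indicator_def eq mult.commute intro: mult_left_mono)
  qed
  finally show "tail \<nu> t * (tail \<sigma> r - tail \<sigma> t) \<le> tail \<omega> r" .
  have "tail \<omega> r \<le> (LINT s|unit_itv. tail \<nu> r * (indicator {r..<1} s * \<sigma> s - indicator {t..<1} s * \<sigma> s)
      + tail \<nu> t * (indicator {t..<1} s * \<sigma> s))"
    unfolding t(3)
  proof (intro integral_unit_itv_mono iw Bochner_Integration.integrable_add integrable_mult_right Bochner_Integration.integrable_diff iS)
    fix x :: real assume x: "0 \<le> x" "x < 1"
    have "0 \<le> \<sigma> x" using x s by (auto simp: radial_weight_nonneg)
    moreover have "tail \<nu> x \<le> tail \<nu> r" if "r \<le> x" using that rt by (intro tail_antimono n) auto
    moreover have "tail \<nu> x \<le> tail \<nu> t" if "t \<le> x" using that t0 by (intro tail_antimono n) auto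
    ultimately show "indicator {r..<1} x * \<omega> x \<le> tail \<nu> r * (indicator {r..<1} x * \<sigma> x - indicator {t..<1} x * \<sigma> x)
      + tail \<nu> t * (indicator {t..<1} x * \<sigma> x)"
      using x rt by (auto simp: indicator_def eq mult.commute intro: mult_left_mono)
  qed
  also have "\<dots> = tail \<nu> r * (tail \<sigma> r - tail \<sigma> t) + tail \<nu> t * tail \<sigma> t"
    unfolding t using iS by simp
  finally show b: "tail \<omega> r \<le> tail \<nu> r * (tail \<sigma> r - tail \<sigma> t) + tail \<nu> t * tail \<sigma> t" .
  have "tail \<nu> t * tail \<sigma> t \<le> tail \<nu> r * tail \<sigma> t"
    using rt t0 by (intro mult_right_mono tail_antimono n less_imp_le[OF tail_pos[OF s]])
  then show "tail \<omega> r \<le> tail \<nu> r * tail \<sigma> r" using b by (simp add: algebra_simps)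
qed

text \<open>Repetition makes the gain \<open>C ^ k\<close> as large as desired at the price of
  replacing \<open>K\<close> by \<open>K ^ k\<close>.\<close>

lemma D_check_iterate:
  assumes n: "\<nu> \<in> D_check" and "0 < \<epsilon>"
  shows "\<exists>K>1. \<exists>r0. 0 \<le> r0 \<and> r0 < 1 \<and> (\<forall>r. r0 < r \<and> r < 1 \<longrightarrow> tail \<nu> (1 - (1 - r) / K) \<le> \<epsilon> * tail \<nu> r)"
proof -
  have w: "radial_weight \<nu>" using n by (rule D_check_radial_weight)
  obtain K C where K: "1 < K" "1 < C" and ev: "\<forall>\<^sub>F r in at_left 1. tail \<nu> r \<ge> C * tail \<nu> (1 - (1 - r) / K)"
    using n by (auto simp: D_check_def)
  then obtain b where b: "b < 1" "\<And>r. b < r \<Longrightarrow> r < 1 \<Longrightarrow> tail \<nu> r \<ge> C * tail \<nu> (1 - (1 - r) / K)"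
    by (auto simp: eventually_at_left_field)
  define r0 where "r0 = max b 0"
  have r0: "0 \<le> r0" "r0 < 1" "b \<le> r0" using b by (auto simp: r0_def)
  have it: "C ^ k * tail \<nu> (1 - (1 - r) / K ^ k) \<le> tail \<nu> r" if r: "r0 < r" "r < 1" for r k
  proof (induction k)
    case (Suc k)
    have p: "1 \<le> K ^ k" using K by auto
    have "(1 - r) / K ^ k \<le> (1 - r) / 1" using p r by (intro divide_left_mono) auto
    then have "b < 1 - (1 - r) / K ^ k" using r r0 by simp
    then have "C * tail \<nu> (1 - (1 - (1 - (1 - r) / K ^ k)) / K) \<le> tail \<nu> (1 - (1 - r) / K ^ k)"
      using r K by (intro b) auto
    then have "C ^ k * (C * tail \<nu> (1 - (1 - (1 - (1 - r) / K ^ k)) / K)) \<le> C ^ k * tail \<nu> (1 - (1 - r) / K ^ k)"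
      using K by (intro mult_left_mono) auto
    with Suc.IH show ?case by (simp add: mult_ac)
  qed simp
  obtain k where k: "max 1 (1 / \<epsilon>) < C ^ k" using real_arch_pow[OF K(2)] by blast
  have k0: "k \<noteq> 0" using k by (auto intro: ccontr)
  have "tail \<nu> (1 - (1 - r) / K ^ k) \<le> \<epsilon> * tail \<nu> r" if r: "r0 < r" "r < 1" for r
  proof -
    have "(1 - r) / K ^ k \<le> (1 - r) / 1" using K r by (intro divide_left_mono) auto
    moreover have "0 < (1 - r) / K ^ k" using r K by simp
    ultimately have "0 \<le> 1 - (1 - r) / K ^ k \<and> 1 - (1 - r) / K ^ k < 1" using r r0 by auto
    then have t: "0 < tail \<nu> (1 - (1 - r) / K ^ k)" by (intro tail_pos w) auto
    have "1 / \<epsilon> * tail \<nu> (1 - (1 - r) / K ^ k) \<le> C ^ k * tail \<nu> (1 - (1 - r) / K ^ k)"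
      using k t by (intro mult_right_mono) auto
    also have "\<dots> \<le> tail \<nu> r" by (rule it[OF r])
    finally show ?thesis using assms by (simp add: field_simps)
  qed
  moreover have "1 < K ^ k" using K k0 by (simp add: one_less_power)
  ultimately show ?thesis using r0 by blast
qed

text \<open>Up to constants, the product of the tails of \<open>\<nu>\<close> and
  \<open>\<sigma>\<close> at \<open>r\<close> is at most the tail of \<open>\<omega>\<close> at
  \<open>r\<close>, then at the midpoint \<open>h\<close>, then the product of tails at
  \<open>h\<close>; there \<open>tail \<nu> h \<le> tail \<nu> r\<close>, and this factor
  cancels.\<close>

lemma ratio_bound_imp_D_hat:
  assumes w: "\<omega> \<in> D_hat" and n: "radial_weight \<nu>" and s: "radial_weight \<sigma>"
    and eq: "\<And>r. 0 \<le> r \<Longrightarrow> r < 1 \<Longrightarrow> \<omega> r = \<sigma> r * tail \<nu> r"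
    and B: "\<And>r. 0 \<le> r \<Longrightarrow> r < 1 \<Longrightarrow> tail \<nu> r * tail \<sigma> r \<le> B * tail \<omega> r"
  shows "\<sigma> \<in> D_hat"
proof -
  have w': "radial_weight \<omega>" using w by (rule D_hat_radial_weight)
  obtain C where C: "1 \<le> C" "\<And>r. 0 \<le> r \<Longrightarrow> r < 1 \<Longrightarrow> tail \<omega> r \<le> C * tail \<omega> ((1 + r) / 2)"
    using D_hat_half[OF w] by blast
  have B0: "0 < B"
    using B[of 0] tail_pos[OF n, of 0] tail_pos[OF s, of 0] tail_pos[OF w', of 0]
    by (smt (verit) mult_pos_pos mult_nonneg_nonneg zero_less_mult_pos2)
  have "tail \<sigma> r \<le> B * C * tail \<sigma> ((1 + r) / 2)" if r: "0 \<le> r" "r < 1" for r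
  proof -
    define h where "h = (1 + r) / 2"
    have h: "r \<le> h" "h < 1" "0 \<le> h" using r by (auto simp: h_def)
    have "tail \<nu> r * tail \<sigma> r \<le> B * tail \<omega> r" by (rule B[OF r])
    also have "\<dots> \<le> B * (C * tail \<omega> h)" unfolding h_def using B0 C r by (intro mult_left_mono) auto
    also have "\<dots> \<le> B * (C * (tail \<nu> h * tail \<sigma> h))"
      using B0 C h by (intro mult_left_mono weight_product_tail_bounds(3)[OF n w' s eq, of h h]) auto
    also have "\<dots> \<le> B * (C * (tail \<nu> r * tail \<sigma> h))"
      using B0 C h r less_imp_le[OF tail_pos[OF s, of h]]
      by (intro mult_left_mono mult_right_mono tail_antimono n) auto
    finally have "tail \<nu> r * tail \<sigma> r \<le> tail \<nu> r * (B * C * tail \<sigma> h)" by (simp add: mult_ac)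
    then show ?thesis using tail_pos[OF n r] unfolding h_def by simp
  qed
  then have "\<forall>\<^sub>F r in at_left 1. tail \<sigma> r \<le> B * C * tail \<sigma> ((1 + r) / 2)"
    unfolding eventually_at_left_field by (intro exI[of _ 0]) auto
  then show ?thesis using s B0 C unfolding D_hat_def by (auto intro!: exI[of _ "B * C"])
qed

text \<open>If \<open>\<sigma>\<close> kept nearly all of its tail beyond a point \<open>t\<close>
  where \<open>tail \<nu>\<close> has already become small, the tail of \<open>\<omega>\<close> at
  \<open>r\<close> would be too small for the ratio bound. So a definite part of the tail of
  \<open>\<sigma>\<close> lies between \<open>r\<close> and \<open>t\<close>.\<close>

lemma ratio_bound_imp_D_check:
  assumes w: "radial_weight \<omega>" and n: "\<nu> \<in> D_check" and s: "radial_weight \<sigma>"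
    and eq: "\<And>r. 0 \<le> r \<Longrightarrow> r < 1 \<Longrightarrow> \<omega> r = \<sigma> r * tail \<nu> r"
    and B: "\<And>r. 0 \<le> r \<Longrightarrow> r < 1 \<Longrightarrow> tail \<nu> r * tail \<sigma> r \<le> B * tail \<omega> r"
  shows "\<sigma> \<in> D_check"
proof -
  have n': "radial_weight \<nu>" using n by (rule D_check_radial_weight)
  \<comment> \<open>The maximum ensures \<open>c \<le> 1 / 2\<close>, so that \<open>1 - c\<close>
    is positive and the final factor \<open>(1 - c / 2) / (1 - c)\<close> exceeds 1.\<close>
  define c where "c = 1 / max 2 B"
  have c: "0 < c" "c \<le> 1 / 2" by (auto simp: c_def field_simps)
  have cB: "c * (tail \<nu> r * tail \<sigma> r) \<le> tail \<omega> r" if r: "0 \<le> r" "r < 1" for r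
  proof -
    have "tail \<nu> r * tail \<sigma> r \<le> max 2 B * tail \<omega> r"
      using B[OF r] mult_right_mono[of B "max 2 B" "tail \<omega> r"] less_imp_le[OF tail_pos[OF w r]] by auto
    moreover have "0 < max 2 B" by auto
    ultimately show ?thesis unfolding c_def by (simp add: field_simps del: max_less_iff_conj)
  qed
  obtain K r0 where K: "1 < K" "0 \<le> r0" "r0 < 1"
    "\<And>r. r0 < r \<Longrightarrow> r < 1 \<Longrightarrow> tail \<nu> (1 - (1 - r) / K) \<le> c / 2 * tail \<nu> r"
    using D_check_iterate[OF n, of "c / 2"] c by auto
  have "(1 - c / 2) / (1 - c) * tail \<sigma> (1 - (1 - r) / K) \<le> tail \<sigma> r" if r: "r0 < r" "r < 1" for r
  proof -
    define t where "t = 1 - (1 - r) / K"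
    have "(1 - r) / K \<le> (1 - r) / 1" using K r by (intro divide_left_mono) auto
    then have t: "r \<le> t" "t < 1" using r K by (auto simp: t_def)
    have r00: "0 \<le> r" using K r by simp
    have st: "0 < tail \<sigma> t" using t r00 by (intro tail_pos s) auto
    have "c * (tail \<nu> r * tail \<sigma> r) \<le> tail \<omega> r" using r00 r by (intro cB)
    also have "\<dots> \<le> tail \<nu> r * (tail \<sigma> r - tail \<sigma> t) + tail \<nu> t * tail \<sigma> t"
      by (rule weight_product_tail_bounds(2)[OF n' w s eq r00 t])
    also have "\<dots> \<le> tail \<nu> r * (tail \<sigma> r - tail \<sigma> t) + c / 2 * tail \<nu> r * tail \<sigma> t"
      using K(4)[OF r] st unfolding t_def[symmetric] by (intro add_left_mono mult_right_mono) auto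
    finally have "tail \<nu> r * (c * tail \<sigma> r) \<le> tail \<nu> r * (tail \<sigma> r - tail \<sigma> t + c / 2 * tail \<sigma> t)"
      by (simp add: algebra_simps)
    then have "c * tail \<sigma> r \<le> tail \<sigma> r - tail \<sigma> t + c / 2 * tail \<sigma> t"
      using tail_pos[OF n' r00 r(2)] by (metis mult_le_cancel_left_pos)
    then have "(1 - c / 2) * tail \<sigma> t \<le> (1 - c) * tail \<sigma> r" by (simp add: algebra_simps)
    then show ?thesis unfolding t_def[symmetric] using c by (simp add: field_simps)
  qed
  then have "\<forall>\<^sub>F r in at_left 1. tail \<sigma> r \<ge> (1 - c / 2) / (1 - c) * tail \<sigma> (1 - (1 - r) / K)"
    unfolding eventually_at_left_field using K by (intro exI[of _ r0]) auto
  moreover have "1 < (1 - c / 2) / (1 - c)" using c by simp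
  ultimately show ?thesis using s K(1) unfolding D_check_def by blast
qed

text \<open>With \<open>t = 1 - (1 - r) / K\<close> at least half of the tail of
  \<open>\<sigma>\<close> lies between \<open>r\<close> and \<open>t\<close>, and on that range
  \<open>tail \<nu>\<close> is comparable to \<open>tail \<nu> r\<close> because
  \<open>\<nu>\<close> is doubling.\<close>

lemma D_class_imp_ratio_bound:
  assumes w: "radial_weight \<omega>" and n: "\<nu> \<in> D_hat" and s: "\<sigma> \<in> D_check"
    and eq: "\<And>r. 0 \<le> r \<Longrightarrow> r < 1 \<Longrightarrow> \<omega> r = \<sigma> r * tail \<nu> r"
  shows "\<exists>B>0. \<forall>r. 0 \<le> r \<and> r < 1 \<longrightarrow> tail \<nu> r * tail \<sigma> r \<le> B * tail \<omega> r"
proof -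
  have n': "radial_weight \<nu>" using n by (rule D_hat_radial_weight)
  have s': "radial_weight \<sigma>" using s by (rule D_check_radial_weight)
  obtain K r0 where K: "1 < K" "0 \<le> r0" "r0 < 1"
    "\<And>r. r0 < r \<Longrightarrow> r < 1 \<Longrightarrow> tail \<sigma> (1 - (1 - r) / K) \<le> 1 / 2 * tail \<sigma> r"
    using D_check_iterate[OF s, of "1 / 2"] by auto
  obtain C where C: "1 \<le> C" "\<And>u. 0 < u \<Longrightarrow> u \<le> 1 \<Longrightarrow> tail \<nu> (1 - u) \<le> C * tail \<nu> (1 - u / K)"
    using D_hat_scale[OF n, of K] K by auto
  define B where "B = max (2 * C) (tail \<nu> 0 * tail \<sigma> 0 / tail \<omega> ((1 + r0) / 2))"
  have "tail \<nu> r * tail \<sigma> r \<le> B * tail \<omega> r" if r: "0 \<le> r" "r < 1" for r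
  proof (cases "r0 < r")
    case True
    define t where "t = 1 - (1 - r) / K"
    have "(1 - r) / K \<le> (1 - r) / 1" using K r by (intro divide_left_mono) auto
    then have t: "r \<le> t" "t < 1" using r K by (auto simp: t_def)
    have "tail \<nu> r * tail \<sigma> r \<le> (C * tail \<nu> t) * (2 * (tail \<sigma> r - tail \<sigma> t))"
    proof (intro mult_mono)
      show "tail \<nu> r \<le> C * tail \<nu> t" using C(2)[of "1 - r"] r by (simp add: t_def)
      show "tail \<sigma> r \<le> 2 * (tail \<sigma> r - tail \<sigma> t)" using K(4)[OF True r(2)] by (simp add: t_def)
    qed (use C t r in \<open>auto intro!: mult_nonneg_nonneg less_imp_le[OF tail_pos] n' s'\<close>)
    also have "\<dots> = 2 * C * (tail \<nu> t * (tail \<sigma> r - tail \<sigma> t))" by simp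
    also have "\<dots> \<le> 2 * C * tail \<omega> r"
      using C r t by (intro mult_left_mono weight_product_tail_bounds(1)[OF n' w s' eq]) auto
    also have "\<dots> \<le> B * tail \<omega> r"
      using tail_pos[OF w r] by (intro mult_right_mono) (auto simp: B_def)
    finally show ?thesis .
  next
    case False
    have p: "0 < tail \<omega> ((1 + r0) / 2)" using K by (intro tail_pos w) auto
    have "tail \<nu> r * tail \<sigma> r \<le> tail \<nu> 0 * tail \<sigma> 0"
      using r by (intro mult_mono tail_antimono n' s') (auto intro: less_imp_le[OF tail_pos] n' s')
    also have "\<dots> = tail \<nu> 0 * tail \<sigma> 0 / tail \<omega> ((1 + r0) / 2) * tail \<omega> ((1 + r0) / 2)" using p by simp
    also have "\<dots> \<le> B * tail \<omega> ((1 + r0) / 2)"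
      using p by (intro mult_right_mono) (auto simp: B_def)
    also have "\<dots> \<le> B * tail \<omega> r"
      using C r K False by (intro mult_left_mono tail_antimono w) (auto simp: B_def)
    finally show ?thesis .
  qed
  moreover have "0 < B" using C by (auto simp: B_def)
  ultimately show ?thesis by blast
qed

lemma D_hat_product:
  assumes w: "radial_weight \<omega>" and n: "\<nu> \<in> D_hat" and s: "\<sigma> \<in> D_hat"
    and eq: "\<And>r. 0 \<le> r \<Longrightarrow> r < 1 \<Longrightarrow> \<omega> r = \<sigma> r * tail \<nu> r"
    and B: "0 < B" "\<And>r. 0 \<le> r \<Longrightarrow> r < 1 \<Longrightarrow> tail \<nu> r * tail \<sigma> r \<le> B * tail \<omega> r"
  shows "\<omega> \<in> D_hat"
proof -
  have n': "radial_weight \<nu>" using n by (rule D_hat_radial_weight)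
  have s': "radial_weight \<sigma>" using s by (rule D_hat_radial_weight)
  obtain C where C: "1 \<le> C" "\<And>r. 0 \<le> r \<Longrightarrow> r < 1 \<Longrightarrow> tail \<nu> r \<le> C * tail \<nu> ((1 + r) / 2)"
    using D_hat_half[OF n] by blast
  obtain D where D: "1 \<le> D" "\<And>r. 0 \<le> r \<Longrightarrow> r < 1 \<Longrightarrow> tail \<sigma> r \<le> D * tail \<sigma> ((1 + r) / 2)"
    using D_hat_half[OF s] by blast
  have "tail \<omega> r \<le> C * D * B * tail \<omega> ((1 + r) / 2)" if r: "0 \<le> r" "r < 1" for r
  proof -
    define h where "h = (1 + r) / 2"
    have h: "0 \<le> h" "h < 1" using r by (auto simp: h_def)
    have "tail \<omega> r \<le> tail \<nu> r * tail \<sigma> r"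
      using r by (intro weight_product_tail_bounds(3)[OF n' w s' eq, of r r]) auto
    also have "\<dots> \<le> (C * tail \<nu> h) * (D * tail \<sigma> h)"
      using C D r h unfolding h_def[symmetric]
      by (intro mult_mono C(2)[folded h_def] D(2)[folded h_def])
         (auto simp: h_def intro!: less_imp_le[OF tail_pos] n' s' mult_nonneg_nonneg)
    also have "\<dots> = C * D * (tail \<nu> h * tail \<sigma> h)" by simp
    also have "\<dots> \<le> C * D * (B * tail \<omega> h)" using C D h by (intro mult_left_mono B) auto
    finally show ?thesis by (simp add: h_def mult_ac)
  qed
  then have "\<forall>\<^sub>F r in at_left 1. tail \<omega> r \<le> C * D * B * tail \<omega> ((1 + r) / 2)"
    unfolding eventually_at_left_field by (intro exI[of _ 0]) auto
  moreover have "0 < C * D * B" using C D B by simp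
  ultimately show ?thesis using w unfolding D_hat_def by blast
qed

section \<open>Equivalence of the conditions on the weights\<close>

text \<open>The common end of the arguments from (i) and from (ii): each supplies doubling of the
  moments of \<open>\<sigma>\<close> along some ratio \<open>q > 1\<close> and a lower bound for the
  moments of \<open>\<omega>\<close>. Doubling of \<open>\<sigma>\<close> repairs the lost quarter
  in \<open>weight_product_mom_le\<close>, which makes \<open>\<omega>\<close> doubling, and only
  then can its moments be replaced by tails.\<close>

lemma tail_ratio_bound_of_moments:
  assumes n: "\<nu> \<in> D_hat" and w: "radial_weight \<omega>" and s: "radial_weight \<sigma>"
    and eq: "\<And>r. 0 \<le> r \<Longrightarrow> r < 1 \<Longrightarrow> \<omega> r = \<sigma> r * tail \<nu> r"
    and q: "1 < q" "0 \<le> x0" and dbl: "\<And>x. x0 \<le> x \<Longrightarrow> mom \<sigma> x \<le> C * mom \<sigma> (q * x)"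
    and low: "\<And>x. x0 \<le> x \<Longrightarrow> tail \<nu> (1 - 1 / (x + 2)) * mom \<sigma> x \<le> c * mom \<omega> x"
  shows "\<omega> \<in> D_hat" and "\<exists>B>0. \<forall>r. 0 \<le> r \<and> r < 1 \<longrightarrow> tail \<nu> r * tail \<sigma> r \<le> B * tail \<omega> r"
proof -
  have n': "radial_weight \<nu>" using n by (rule D_hat_radial_weight)
  have sh: "\<sigma> \<in> D_hat" by (rule mom_doubling_imp_D_hat[OF s q dbl])
  have c: "0 < c"
  proof -
    have "0 < tail \<nu> (1 - 1 / (x0 + 2)) * mom \<sigma> x0"
      using q by (intro mult_pos_pos tail_pos mom_pos n' s) auto
    also have "\<dots> \<le> c * mom \<omega> x0" by (rule low) simp
    finally show ?thesis using mom_pos[OF w q(2)] by (metis zero_less_mult_pos2)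
  qed
  obtain D where D: "1 \<le> D" "\<And>u. 0 < u \<Longrightarrow> u \<le> 1 \<Longrightarrow> tail \<nu> (1 - u) \<le> D * tail \<nu> (1 - u / 2)"
    using D_hat_scale[OF n, of 2] by auto
  \<comment> \<open>The factor \<open>8 / 3\<close> carries the order \<open>3 * x / 4\<close> to
    \<open>2 * x\<close>.\<close>
  obtain E where E: "0 < E" "\<And>x. 0 \<le> x \<Longrightarrow> mom \<sigma> x \<le> E * mom \<sigma> (8 / 3 * x + 0)"
    using D_hat_mom_doubling[OF sh, of "8/3" 0] by auto
  obtain F where F: "0 < F" "\<And>x. 0 \<le> x \<Longrightarrow> mom \<omega> x \<le> F * tail \<nu> (1 - 1 / (x + 2)) * mom \<sigma> (3 * x / 4)"
    using weight_product_mom_le[OF n w s eq] by blast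
  show wh: "\<omega> \<in> D_hat"
  proof (rule mom_doubling_imp_D_hat[OF w, of 2 x0 "F * D * E * c"])
    fix x assume x: "x0 \<le> x"
    then have x0: "0 \<le> x" using q by simp
    have "tail \<nu> (1 - 1 / (x + 2)) \<le> D * tail \<nu> (1 - 1 / (x + 2) / 2)" using x0 by (intro D) auto
    also have "tail \<nu> (1 - 1 / (x + 2) / 2) \<le> tail \<nu> (1 - 1 / (2 * x + 2))"
      using x0 by (intro tail_antimono n') (auto simp: field_simps)
    finally have nu: "tail \<nu> (1 - 1 / (x + 2)) \<le> D * tail \<nu> (1 - 1 / (2 * x + 2))" using D by simp
    have "mom \<omega> x \<le> F * tail \<nu> (1 - 1 / (x + 2)) * mom \<sigma> (3 * x / 4)" by (rule F(2)[OF x0])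
    also have "\<dots> \<le> F * (D * tail \<nu> (1 - 1 / (2 * x + 2))) * (E * mom \<sigma> (2 * x))"
      using E(2)[of "3 * x / 4"] E(1) F D nu x0 less_imp_le[OF tail_pos[OF n', of "1 - 1 / (2 * x + 2)"]]
         less_imp_le[OF tail_pos[OF n', of "1 - 1 / (x + 2)"]]
         less_imp_le[OF mom_pos[OF s, of "3 * x / 4"]]
      by (intro mult_mono mult_nonneg_nonneg) auto
    also have "\<dots> = F * D * E * (tail \<nu> (1 - 1 / (2 * x + 2)) * mom \<sigma> (2 * x))" by simp
    also have "\<dots> \<le> F * D * E * (c * mom \<omega> (2 * x))"
      using E F D x x0 by (intro mult_left_mono low) auto
    finally show "mom \<omega> x \<le> F * D * E * c * mom \<omega> (2 * x)" by (simp add: mult.assoc)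
  qed (use q in auto)
  obtain G where G: "0 < G" "\<And>x. 0 \<le> x \<Longrightarrow> mom \<omega> x \<le> G * tail \<omega> (1 - 1 / (x + 2))"
    using mom_le_tail[OF wh] by blast
  define r1 where "r1 = 1 - 1 / (x0 + 2)"
  have r1: "0 \<le> r1" "r1 < 1" using q by (auto simp: r1_def)
  define B where "B = max (exp 1 * c * G) (tail \<nu> 0 * tail \<sigma> 0 / tail \<omega> r1)"
  have "tail \<nu> r * tail \<sigma> r \<le> B * tail \<omega> r" if r: "0 \<le> r" "r < 1" for r
  proof (cases "r1 \<le> r")
    case True
    define x where "x = 1 / (1 - r) - 2"
    have rx: "r = 1 - 1 / (x + 2)" using r by (simp add: x_def)
    have "1 - r \<le> 1 / (x0 + 2)" using True by (simp add: r1_def)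
    then have "1 / (1 / (x0 + 2)) \<le> 1 / (1 - r)" using r q by (intro divide_left_mono) auto
    then have x: "x0 \<le> x" by (simp add: x_def)
    then have x0: "0 \<le> x" using q by simp
    have "tail \<nu> r * tail \<sigma> r \<le> tail \<nu> r * (exp 1 * mom \<sigma> x)"
      using tail_le_mom[OF s x0] tail_pos[OF n' r] unfolding rx[symmetric] by (intro mult_left_mono) auto
    also have "\<dots> = exp 1 * (tail \<nu> (1 - 1 / (x + 2)) * mom \<sigma> x)" by (simp add: rx[symmetric])
    also have "\<dots> \<le> exp 1 * (c * (G * tail \<omega> (1 - 1 / (x + 2))))"
      using low[OF x] G(2)[OF x0] c by (intro mult_left_mono) (auto intro: order_trans mult_left_mono)
    also have "\<dots> = exp 1 * c * G * tail \<omega> r" by (simp add: rx[symmetric])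
    also have "\<dots> \<le> B * tail \<omega> r"
      using less_imp_le[OF tail_pos[OF w r]] by (intro mult_right_mono) (auto simp: B_def)
    finally show ?thesis .
  next
    case False
    have p: "0 < tail \<omega> r1" by (intro tail_pos w r1)
    have "tail \<nu> r * tail \<sigma> r \<le> tail \<nu> 0 * tail \<sigma> 0"
      using r by (intro mult_mono tail_antimono n' s) (auto intro: less_imp_le[OF tail_pos] n' s)
    also have "\<dots> = tail \<nu> 0 * tail \<sigma> 0 / tail \<omega> r1 * tail \<omega> r1" using p by simp
    also have "\<dots> \<le> B * tail \<omega> r1"
      using p by (intro mult_right_mono) (auto simp: B_def)
    also have "\<dots> \<le> B * tail \<omega> r"
      using r False c G by (intro mult_left_mono tail_antimono w) (auto simp: B_def le_max_iff_disj)
    finally show ?thesis .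
  qed
  moreover have "0 < B" using c G by (auto simp: B_def less_max_iff_disj)
  ultimately show "\<exists>B>0. \<forall>r. 0 \<le> r \<and> r < 1 \<longrightarrow> tail \<nu> r * tail \<sigma> r \<le> B * tail \<omega> r" by blast
qed

text \<open>The ratio bound at \<open>1 - 1 / (x + 2)\<close> passes to moments because
  \<open>\<sigma>\<close> inherits doubling from \<open>\<omega>\<close>. It serves both condition
  (ii) and the kernel coefficients.\<close>

lemma tail_ratio_bound_imp_mom:
  assumes wh: "\<omega> \<in> D_hat" and n: "\<nu> \<in> D_hat" and s: "radial_weight \<sigma>"
    and eq: "\<And>r. 0 \<le> r \<Longrightarrow> r < 1 \<Longrightarrow> \<omega> r = \<sigma> r * tail \<nu> r"
    and B: "\<And>r. 0 \<le> r \<Longrightarrow> r < 1 \<Longrightarrow> tail \<nu> r * tail \<sigma> r \<le> B * tail \<omega> r"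
  shows "\<exists>c>0. \<forall>x\<ge>0. tail \<nu> (1 - 1 / (x + 2)) * mom \<sigma> x \<le> c * mom \<omega> x"
proof -
  have w: "radial_weight \<omega>" using wh by (rule D_hat_radial_weight)
  have n': "radial_weight \<nu>" using n by (rule D_hat_radial_weight)
  have sh: "\<sigma> \<in> D_hat" by (rule ratio_bound_imp_D_hat[OF wh n' s eq B])
  obtain C where C: "0 < C" "\<And>x. 0 \<le> x \<Longrightarrow> mom \<sigma> x \<le> C * tail \<sigma> (1 - 1 / (x + 2))"
    using mom_le_tail[OF sh] by blast
  have B0: "0 < B"
    using B[of 0] tail_pos[OF n', of 0] tail_pos[OF s, of 0] tail_pos[OF w, of 0]
    by (smt (verit) mult_pos_pos mult_nonneg_nonneg zero_less_mult_pos2)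
  have "tail \<nu> (1 - 1 / (x + 2)) * mom \<sigma> x \<le> C * B * exp 1 * mom \<omega> x" if x: "0 \<le> x" for x
  proof -
    have r: "0 \<le> 1 - 1 / (x + 2)" "1 - 1 / (x + 2) < 1" using x by auto
    have "tail \<nu> (1 - 1 / (x + 2)) * mom \<sigma> x \<le> tail \<nu> (1 - 1 / (x + 2)) * (C * tail \<sigma> (1 - 1 / (x + 2)))"
      using less_imp_le[OF tail_pos[OF n' r]] by (intro mult_left_mono C x)
    also have "\<dots> = C * (tail \<nu> (1 - 1 / (x + 2)) * tail \<sigma> (1 - 1 / (x + 2)))" by simp
    also have "\<dots> \<le> C * (B * tail \<omega> (1 - 1 / (x + 2)))" using C r by (intro mult_left_mono B) auto
    also have "\<dots> \<le> C * (B * (exp 1 * mom \<omega> x))"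
      using C B0 tail_le_mom[OF w x] by (intro mult_left_mono) auto
    finally show ?thesis by (simp add: mult.assoc)
  qed
  then show ?thesis using C B0 by (intro exI[of _ "C * B * exp 1"]) auto
qed

text \<open>The source of doubling is that \<open>\<omega>\<close> enters with order
  \<open>2 * x\<close>: \<open>weight_product_mom_le\<close> at this order leaves
  \<open>\<sigma>\<close> with order \<open>3 / 2 * x\<close>, the tails of \<open>\<nu>\<close>
  cancel, and a comparison of the orders \<open>x\<close> and \<open>3 / 2 * x\<close>
  remains.\<close>

lemma moment_bound_imp_tail_ratio_bound:
  assumes n: "\<nu> \<in> D_hat" and w: "radial_weight \<omega>" and s: "radial_weight \<sigma>"
    and eq: "\<And>r. 0 \<le> r \<Longrightarrow> r < 1 \<Longrightarrow> \<omega> r = \<sigma> r * tail \<nu> r"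
    and B: "\<And>x. 0 \<le> x \<Longrightarrow> mom \<nu> x * mom \<sigma> x \<le> B * mom \<omega> (2 * x)"
  shows "\<omega> \<in> D_hat" and "\<exists>B>0. \<forall>r. 0 \<le> r \<and> r < 1 \<longrightarrow> tail \<nu> r * tail \<sigma> r \<le> B * tail \<omega> r"
proof -
  have n': "radial_weight \<nu>" using n by (rule D_hat_radial_weight)
  have B0: "0 < B"
    using B[of 0] mom_pos[OF n', of 0] mom_pos[OF s, of 0] mom_pos[OF w, of 0]
    by (smt (verit) mult_pos_pos mult_nonneg_nonneg zero_less_mult_pos2 mult_zero_right)
  obtain F where F: "0 < F" "\<And>x. 0 \<le> x \<Longrightarrow> mom \<omega> x \<le> F * tail \<nu> (1 - 1 / (x + 2)) * mom \<sigma> (3 * x / 4)"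
    using weight_product_mom_le[OF n w s eq] by blast
  have 1: "tail \<nu> (1 - 1 / (x + 2)) * mom \<sigma> x \<le> exp 1 * B * mom \<omega> (2 * x)" if x: "0 \<le> x" for x
  proof -
    have "tail \<nu> (1 - 1 / (x + 2)) * mom \<sigma> x \<le> exp 1 * mom \<nu> x * mom \<sigma> x"
      using less_imp_le[OF mom_pos[OF s x]] by (intro mult_right_mono tail_le_mom n' x)
    also have "\<dots> = exp 1 * (mom \<nu> x * mom \<sigma> x)" by simp
    also have "\<dots> \<le> exp 1 * (B * mom \<omega> (2 * x))" by (intro mult_left_mono B x) auto
    finally show ?thesis by (simp add: mult.assoc)
  qed
  have low: "tail \<nu> (1 - 1 / (x + 2)) * mom \<sigma> x \<le> exp 1 * B * mom \<omega> x" if x: "0 \<le> x" for x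
  proof -
    have "exp 1 * B * mom \<omega> (2 * x) \<le> exp 1 * B * mom \<omega> x"
      using B0 x by (intro mult_left_mono mom_antimono w) auto
    then show ?thesis using 1[OF x] by linarith
  qed
  have dbl: "mom \<sigma> x \<le> exp 1 * B * F * mom \<sigma> (3 / 2 * x)" if x: "0 \<le> x" for x
  proof -
    let ?n = "tail \<nu> (1 - 1 / (x + 2))"
    have p: "0 < ?n" using x by (intro tail_pos n') auto
    have "?n * mom \<sigma> x \<le> exp 1 * B * (F * tail \<nu> (1 - 1 / (2 * x + 2)) * mom \<sigma> (3 * (2 * x) / 4))"
      using 1[OF x] F(2)[of "2 * x"] x B0 by (auto intro: order_trans mult_left_mono)
    also have "\<dots> \<le> exp 1 * B * (F * ?n * mom \<sigma> (3 * (2 * x) / 4))"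
      using B0 F x less_imp_le[OF mom_pos[OF s, of "3 * (2 * x) / 4"]]
      by (intro mult_left_mono mult_right_mono tail_antimono n') (auto simp: frac_le)
    finally have "?n * mom \<sigma> x \<le> ?n * (exp 1 * B * F * mom \<sigma> (3 / 2 * x))" by (simp add: mult_ac)
    then show ?thesis using p by simp
  qed
  show "\<omega> \<in> D_hat" and "\<exists>B>0. \<forall>r. 0 \<le> r \<and> r < 1 \<longrightarrow> tail \<nu> r * tail \<sigma> r \<le> B * tail \<omega> r"
    using tail_ratio_bound_of_moments[OF n w s eq, of "3/2" 0 "exp 1 * B * F" "exp 1 * B"] dbl low
    by auto
qed

lemma tail_ratio_bound_imp_moment_bound:
  assumes wh: "\<omega> \<in> D_hat" and n: "\<nu> \<in> D_hat" and s: "radial_weight \<sigma>"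
    and eq: "\<And>r. 0 \<le> r \<Longrightarrow> r < 1 \<Longrightarrow> \<omega> r = \<sigma> r * tail \<nu> r"
    and B: "\<And>r. 0 \<le> r \<Longrightarrow> r < 1 \<Longrightarrow> tail \<nu> r * tail \<sigma> r \<le> B * tail \<omega> r"
  shows "\<exists>B>0. \<forall>x\<ge>0. mom \<nu> x * mom \<sigma> x \<le> B * mom \<omega> (2 * x)"
proof -
  obtain c where c: "0 < c" "\<And>x. 0 \<le> x \<Longrightarrow> tail \<nu> (1 - 1 / (x + 2)) * mom \<sigma> x \<le> c * mom \<omega> x"
    using tail_ratio_bound_imp_mom[OF assms] by blast
  obtain C where C: "0 < C" "\<And>x. 0 \<le> x \<Longrightarrow> mom \<nu> x \<le> C * tail \<nu> (1 - 1 / (x + 2))"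
    using mom_le_tail[OF n] by blast
  obtain E where E: "0 < E" "\<And>x. 0 \<le> x \<Longrightarrow> mom \<omega> x \<le> E * mom \<omega> (2 * x + 0)"
    using D_hat_mom_doubling[OF wh, of 2 0] by auto
  have "mom \<nu> x * mom \<sigma> x \<le> C * c * E * mom \<omega> (2 * x)" if x: "0 \<le> x" for x
  proof -
    have "mom \<nu> x * mom \<sigma> x \<le> C * tail \<nu> (1 - 1 / (x + 2)) * mom \<sigma> x"
      using less_imp_le[OF mom_pos[OF s x]] by (intro mult_right_mono C x)
    also have "\<dots> = C * (tail \<nu> (1 - 1 / (x + 2)) * mom \<sigma> x)" by simp
    also have "\<dots> \<le> C * (c * (E * mom \<omega> (2 * x)))"
      using c(2)[OF x] E(2)[OF x] C c by (auto intro: order_trans mult_left_mono)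
    finally show ?thesis by (simp add: mult.assoc)
  qed
  then show ?thesis using C c E by (intro exI[of _ "C * c * E"]) auto
qed

section \<open>Extended-valued suprema as inequalities between real numbers\<close>

lemma tail_measurable:
  assumes "radial_weight \<nu>"
  shows "tail \<nu> \<in> borel_measurable unit_itv"
proof -
  have "mono_on {0..<1} (\<lambda>r. - tail \<nu> r)"
    using assms by (auto intro!: mono_onI tail_antimono)
  then have "(\<lambda>r. - tail \<nu> r) \<in> borel_measurable (restrict_space borel {0..<1})"
    by (rule borel_measurable_mono_on_fnc)
  then have "(\<lambda>r. - tail \<nu> r) \<in> borel_measurable unit_itv"
    by (rule borel_measurable_subalgebra[rotated 2]) (auto simp: space_restrict_space intro!: mono_restrict_space)
  from borel_measurable_uminus[OF this] show ?thesis by simp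
qed

lemma quotient_measurable:
  assumes "radial_weight \<omega>" "radial_weight \<nu>"
  shows "(\<lambda>r. \<omega> r / tail \<nu> r) \<in> borel_measurable unit_itv"
  using tail_measurable[OF assms(2)] borel_measurable_integrable[OF radial_weight_integrable[OF assms(1)]]
  by (intro borel_measurable_divide)

lemma quotient_nonneg:
  assumes "radial_weight \<omega>" "radial_weight \<nu>" "0 \<le> r" "r < 1"
  shows "0 \<le> \<omega> r / tail \<nu> r"
  using radial_weight_nonneg[OF assms(1,3,4)] tail_pos[OF assms(2,3,4)] by simp

lemma quotient_radial_weight:
  assumes w: "radial_weight \<omega>" and n: "radial_weight \<nu>" and i: "integrable unit_itv (\<lambda>r. \<omega> r / tail \<nu> r)"
  shows "radial_weight (\<lambda>r. \<omega> r / tail \<nu> r)"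
  unfolding radial_weight_def
proof (intro conjI ballI i)
  fix r :: real assume r: "r \<in> {0..<1}"
  then show "0 \<le> \<omega> r / tail \<nu> r" using quotient_nonneg[OF w n] by auto
  have n0: "0 < tail \<nu> 0" by (intro tail_pos n) auto
  have "0 < (1 / tail \<nu> 0) * tail \<omega> r" using r n0 by (intro mult_pos_pos tail_pos w) auto
  also have "\<dots> = (LINT s|unit_itv. (1 / tail \<nu> 0) * (indicator {r..<1} s * \<omega> s))"
    using r by (simp add: tail_eq_indicator)
  also have "\<dots> \<le> (LINT s|unit_itv. indicator {r..<1} s * (\<omega> s / tail \<nu> s))"
  proof (rule integral_unit_itv_mono)
    show "integrable unit_itv (\<lambda>s. 1 / tail \<nu> 0 * (indicator {r..<1} s * \<omega> s))"
      by (intro integrable_mult_right integrable_indicator_tail radial_weight_integrable w)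
    show "integrable unit_itv (\<lambda>s. indicator {r..<1} s * (\<omega> s / tail \<nu> s))"
      by (rule integrable_indicator_tail[OF i])
    fix s :: real assume s: "0 \<le> s" "s < 1"
    have "\<omega> s / tail \<nu> 0 \<le> \<omega> s / tail \<nu> s"
      using s tail_pos[OF n s] radial_weight_nonneg[OF w s] n0
      by (intro divide_left_mono tail_antimono n) auto
    then show "1 / tail \<nu> 0 * (indicator {r..<1} s * \<omega> s) \<le> indicator {r..<1} s * (\<omega> s / tail \<nu> s)"
      by (auto simp: indicator_def)
  qed
  also have "\<dots> = tail (\<lambda>r. \<omega> r / tail \<nu> r) r" using r by (simp add: tail_eq_indicator)
  finally show "0 < tail (\<lambda>r. \<omega> r / tail \<nu> r) r" .
qed

lemma quotient_integrable_of_nn: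
  assumes w: "radial_weight \<omega>" and n: "radial_weight \<nu>"
    and f: "(\<integral>\<^sup>+ r. ennreal (\<omega> r / tail \<nu> r) \<partial>unit_itv) < \<infinity>"
  shows "integrable unit_itv (\<lambda>r. \<omega> r / tail \<nu> r)"
proof -
  have "(\<integral>\<^sup>+ r. ennreal (norm (\<omega> r / tail \<nu> r)) \<partial>unit_itv) = (\<integral>\<^sup>+ r. ennreal (\<omega> r / tail \<nu> r) \<partial>unit_itv)"
    using quotient_nonneg[OF w n]
    by (intro nn_integral_cong arg_cong[where f=ennreal]) (simp del: abs_divide)
  then show ?thesis using f quotient_measurable[OF w n] by (simp add: integrable_iff_bounded)
qed

lemma AE_unit_itv_pos: "AE r in unit_itv. 0 < r"
proof -
  have "AE r in (lebesgue :: real measure). r \<noteq> 0"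
    by (intro AE_completion AE_lborel_singleton)
  then show ?thesis by (subst AE_restrict_space_iff) (auto elim: eventually_mono)
qed

lemma moment_0: "moment \<omega> 0 = (\<integral>\<^sup>+ r. ennreal (\<omega> r) \<partial>unit_itv)"
  unfolding moment_def
  by (intro nn_integral_cong_AE, use AE_unit_itv_pos in eventually_elim) simp

lemma SUP_ennreal_lt_top_iff:
  fixes f :: "real \<Rightarrow> ennreal" and g :: "real \<Rightarrow> real"
  assumes "\<And>x. x \<in> A \<Longrightarrow> f x = ennreal (g x)"
  shows "(SUP x\<in>A. f x) < \<infinity> \<longleftrightarrow> (\<exists>B\<ge>0. \<forall>x\<in>A. g x \<le> B)"
proof
  assume l: "(SUP x\<in>A. f x) < \<infinity>"
  define B where "B = enn2real (SUP x\<in>A. f x)"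
  have B: "(SUP x\<in>A. f x) = ennreal B" "0 \<le> B" using l by (auto simp: B_def)
  have "g x \<le> B" if "x \<in> A" for x
  proof -
    have "ennreal (g x) \<le> ennreal B"
      using SUP_upper[OF that, of f] assms[OF that] B by simp
    then show ?thesis using B by (simp add: ennreal_le_iff)
  qed
  then show "\<exists>B\<ge>0. \<forall>x\<in>A. g x \<le> B" using B by blast
next
  assume "\<exists>B\<ge>0. \<forall>x\<in>A. g x \<le> B"
  then obtain B where "0 \<le> B" "\<And>x. x \<in> A \<Longrightarrow> g x \<le> B" by blast
  then have "(SUP x\<in>A. f x) \<le> ennreal B"
    using assms by (intro SUP_least) (auto intro: ennreal_leI)
  then show "(SUP x\<in>A. f x) < \<infinity>" by (rule le_less_trans) simp
qed

lemma nn_integral_tail: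
  assumes s: "radial_weight \<sigma>" and r: "0 \<le> r" "r < 1"
  shows "(\<integral>\<^sup>+ s. ennreal (\<sigma> s) \<partial>lebesgue_on {r..<1}) = ennreal (tail \<sigma> r)"
  unfolding tail_def
proof (rule nn_integral_eq_integral)
  have "integrable lebesgue (\<lambda>s. indicator {0..<1} s *\<^sub>R (indicator {r..<1} s * \<sigma> s))"
    using integrable_indicator_tail[OF radial_weight_integrable[OF s], of r]
    by (subst (asm) integrable_restrict_space) auto
  also have "(\<lambda>s. indicator {0..<1} s *\<^sub>R (indicator {r..<1} s * \<sigma> s)) = (\<lambda>s. indicator {r..<1} s *\<^sub>R \<sigma> s)"
    using r by (auto simp: indicator_def fun_eq_iff)
  finally show "integrable (lebesgue_on {r..<1}) \<sigma>"
    by (subst integrable_restrict_space) auto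
  show "AE x in lebesgue_on {r..<1}. 0 \<le> \<sigma> x"
    using r s by (auto intro!: AE_I2 simp: radial_weight_nonneg)
qed

text \<open>Finiteness of the supremum carries integrability of the quotient with it: the term at
  \<open>x = 0\<close> is a positive real multiple of its integral. Once the quotient is a radial
  weight, all moments are positive reals.\<close>

lemma moment_condition_iff:
  assumes w: "radial_weight \<omega>" and n: "radial_weight \<nu>"
  defines "\<sigma> \<equiv> \<lambda>r. \<omega> r / tail \<nu> r"
  shows "(SUP x\<in>{0..}. moment \<nu> x / moment \<omega> (2 * x) * moment \<sigma> x) < \<infinity> \<longleftrightarrow>
    radial_weight \<sigma> \<and> (\<exists>B>0. \<forall>x\<ge>0. mom \<nu> x * mom \<sigma> x \<le> B * mom \<omega> (2 * x))"
proof -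
  have eqv: "(SUP x\<in>{0..}. moment \<nu> x / moment \<omega> (2 * x) * moment \<sigma> x) < \<infinity> \<longleftrightarrow>
     (\<exists>B>0. \<forall>x\<ge>0. mom \<nu> x * mom \<sigma> x \<le> B * mom \<omega> (2 * x))" if s: "radial_weight \<sigma>"
  proof -
    have "(SUP x\<in>{0..}. moment \<nu> x / moment \<omega> (2 * x) * moment \<sigma> x) < \<infinity> \<longleftrightarrow>
      (\<exists>B\<ge>0. \<forall>x\<in>{0..}. mom \<nu> x / mom \<omega> (2 * x) * mom \<sigma> x \<le> B)"
    proof (rule SUP_ennreal_lt_top_iff)
      fix x :: real assume "x \<in> {0..}"
      then show "moment \<nu> x / moment \<omega> (2 * x) * moment \<sigma> x = ennreal (mom \<nu> x / mom \<omega> (2 * x) * mom \<sigma> x)"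
        using mom_pos[OF w, of "2 * x"] mom_pos[OF n, of x] mom_pos[OF s, of x] w n s
        by (simp add: moment_eq_mom divide_ennreal less_imp_le flip: ennreal_mult'')
    qed
    also have "\<dots> \<longleftrightarrow> (\<exists>B\<ge>0. \<forall>x\<ge>0. mom \<nu> x * mom \<sigma> x \<le> B * mom \<omega> (2 * x))"
      using mom_pos[OF w] by (intro arg_cong[where f=Ex] ext) (auto simp: field_simps)
    also have "\<dots> \<longleftrightarrow> (\<exists>B>0. \<forall>x\<ge>0. mom \<nu> x * mom \<sigma> x \<le> B * mom \<omega> (2 * x))"
    proof
      assume "\<exists>B\<ge>0. \<forall>x\<ge>0. mom \<nu> x * mom \<sigma> x \<le> B * mom \<omega> (2 * x)"
      then obtain B where B: "0 \<le> B" "\<And>x. 0 \<le> x \<Longrightarrow> mom \<nu> x * mom \<sigma> x \<le> B * mom \<omega> (2 * x)" by blast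
      have "mom \<nu> x * mom \<sigma> x \<le> (B + 1) * mom \<omega> (2 * x)" if "0 \<le> x" for x
        using B(2)[OF that] mom_pos[OF w, of "2 * x"] that by (simp add: distrib_right)
      then show "\<exists>B>0. \<forall>x\<ge>0. mom \<nu> x * mom \<sigma> x \<le> B * mom \<omega> (2 * x)"
        using B(1) by (intro exI[of _ "B + 1"]) auto
    qed (auto intro: less_imp_le)
    finally show ?thesis .
  qed
  moreover have "radial_weight \<sigma>" if f: "(SUP x\<in>{0..}. moment \<nu> x / moment \<omega> (2 * x) * moment \<sigma> x) < \<infinity>"
  proof -
    have "moment \<nu> 0 / moment \<omega> (2 * 0) * moment \<sigma> 0 < \<infinity>"
      by (rule le_less_trans[OF SUP_upper f]) auto
    then have "ennreal (mom \<nu> 0 / mom \<omega> 0) * moment \<sigma> 0 < \<infinity>"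
      using mom_pos[OF w, of 0] mom_pos[OF n, of 0] w n by (simp add: moment_eq_mom divide_ennreal)
    moreover have "0 < mom \<nu> 0 / mom \<omega> 0" using mom_pos[OF w, of 0] mom_pos[OF n, of 0] by simp
    ultimately have "moment \<sigma> 0 < \<infinity>" by (auto simp: ennreal_mult_less_top)
    then show ?thesis
      unfolding moment_0 \<sigma>_def by (intro quotient_radial_weight quotient_integrable_of_nn w n)
  qed
  ultimately show ?thesis by blast
qed

text \<open>As for the moments, integrability of the quotient is read off from one term, here the
  one at \<open>r = 0\<close>.\<close>

lemma tail_condition_iff:
  assumes w: "radial_weight \<omega>" and n: "radial_weight \<nu>"
  defines "\<sigma> \<equiv> \<lambda>r. \<omega> r / tail \<nu> r"
  shows "(SUP r\<in>{0..<1}. ennreal (tail \<nu> r / tail \<omega> r) * (\<integral>\<^sup>+ s. ennreal (\<sigma> s) \<partial>lebesgue_on {r..<1})) < \<infinity> \<longleftrightarrow>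
    radial_weight \<sigma> \<and> (\<exists>B>0. \<forall>r. 0 \<le> r \<and> r < 1 \<longrightarrow> tail \<nu> r * tail \<sigma> r \<le> B * tail \<omega> r)"
proof -
  let ?S = "SUP r\<in>{0..<1}. ennreal (tail \<nu> r / tail \<omega> r) * (\<integral>\<^sup>+ s. ennreal (\<sigma> s) \<partial>lebesgue_on {r..<1})"
  have "?S < \<infinity> \<longleftrightarrow> (\<exists>B>0. \<forall>r. 0 \<le> r \<and> r < 1 \<longrightarrow> tail \<nu> r * tail \<sigma> r \<le> B * tail \<omega> r)" if s: "radial_weight \<sigma>"
  proof -
    have "?S < \<infinity> \<longleftrightarrow> (\<exists>B\<ge>0. \<forall>r\<in>{0..<1}. tail \<nu> r / tail \<omega> r * tail \<sigma> r \<le> B)"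
    proof (rule SUP_ennreal_lt_top_iff)
      fix r :: real assume "r \<in> {0..<1}"
      then have r: "0 \<le> r" "r < 1" by auto
      show "ennreal (tail \<nu> r / tail \<omega> r) * (\<integral>\<^sup>+ s. ennreal (\<sigma> s) \<partial>lebesgue_on {r..<1}) =
          ennreal (tail \<nu> r / tail \<omega> r * tail \<sigma> r)"
        using tail_pos[OF s r] by (simp add: nn_integral_tail[OF s r] less_imp_le flip: ennreal_mult'')
    qed
    also have "\<dots> \<longleftrightarrow> (\<exists>B\<ge>0. \<forall>r. 0 \<le> r \<and> r < 1 \<longrightarrow> tail \<nu> r * tail \<sigma> r \<le> B * tail \<omega> r)"
      using tail_pos[OF w] by (intro arg_cong[where f=Ex] ext) (auto simp: field_simps)
    also have "\<dots> \<longleftrightarrow> (\<exists>B>0. \<forall>r. 0 \<le> r \<and> r < 1 \<longrightarrow> tail \<nu> r * tail \<sigma> r \<le> B * tail \<omega> r)"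
    proof
      assume "\<exists>B\<ge>0. \<forall>r. 0 \<le> r \<and> r < 1 \<longrightarrow> tail \<nu> r * tail \<sigma> r \<le> B * tail \<omega> r"
      then obtain B where B: "0 \<le> B" "\<And>r. 0 \<le> r \<Longrightarrow> r < 1 \<Longrightarrow> tail \<nu> r * tail \<sigma> r \<le> B * tail \<omega> r" by blast
      have "tail \<nu> r * tail \<sigma> r \<le> (B + 1) * tail \<omega> r" if "0 \<le> r" "r < 1" for r
        using B(2)[OF that] tail_pos[OF w that] by (simp add: distrib_right)
      then show "\<exists>B>0. \<forall>r. 0 \<le> r \<and> r < 1 \<longrightarrow> tail \<nu> r * tail \<sigma> r \<le> B * tail \<omega> r"
        using B(1) by (intro exI[of _ "B + 1"]) auto
    qed (auto intro: less_imp_le)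
    finally show ?thesis .
  qed
  moreover have "radial_weight \<sigma>" if f: "?S < \<infinity>"
  proof -
    have "ennreal (tail \<nu> 0 / tail \<omega> 0) * (\<integral>\<^sup>+ s. ennreal (\<sigma> s) \<partial>lebesgue_on {0..<1}) < \<infinity>"
      by (rule le_less_trans[OF SUP_upper f]) auto
    moreover have "0 < tail \<nu> 0 / tail \<omega> 0" using tail_pos[OF w, of 0] tail_pos[OF n, of 0] by simp
    ultimately have "(\<integral>\<^sup>+ s. ennreal (\<sigma> s) \<partial>lebesgue_on {0..<1}) < \<infinity>" by (auto simp: ennreal_mult_less_top)
    then show ?thesis
      unfolding \<sigma>_def by (intro quotient_radial_weight quotient_integrable_of_nn w n)
  qed
  ultimately show ?thesis by blast
qed

lemma conditions_equivalent:
  assumes w: "radial_weight \<omega>" and n: "\<nu> \<in> D_hat" "\<nu> \<in> D_check"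
  defines "\<sigma> \<equiv> \<lambda>r. \<omega> r / tail \<nu> r"
  shows "(SUP x\<in>{0..}. moment \<nu> x / moment \<omega> (2 * x) * moment \<sigma> x) < \<infinity> \<longleftrightarrow>
      \<omega> \<in> D_hat \<and> radial_weight \<sigma> \<and> (\<exists>B>0. \<forall>r. 0 \<le> r \<and> r < 1 \<longrightarrow> tail \<nu> r * tail \<sigma> r \<le> B * tail \<omega> r)"
    and "\<sigma> \<in> D_class \<longleftrightarrow>
      \<omega> \<in> D_hat \<and> radial_weight \<sigma> \<and> (\<exists>B>0. \<forall>r. 0 \<le> r \<and> r < 1 \<longrightarrow> tail \<nu> r * tail \<sigma> r \<le> B * tail \<omega> r)"
proof -
  have n': "radial_weight \<nu>" using n by (auto intro: D_hat_radial_weight)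
  have eq: "\<omega> r = \<sigma> r * tail \<nu> r" if "0 \<le> r" "r < 1" for r
    using tail_pos[OF n' that] by (simp add: \<sigma>_def)
  show "(SUP x\<in>{0..}. moment \<nu> x / moment \<omega> (2 * x) * moment \<sigma> x) < \<infinity> \<longleftrightarrow>
      \<omega> \<in> D_hat \<and> radial_weight \<sigma> \<and> (\<exists>B>0. \<forall>r. 0 \<le> r \<and> r < 1 \<longrightarrow> tail \<nu> r * tail \<sigma> r \<le> B * tail \<omega> r)"
    unfolding moment_condition_iff[OF w n', folded \<sigma>_def]
    using moment_bound_imp_tail_ratio_bound[OF n(1) w _ eq] tail_ratio_bound_imp_moment_bound[OF _ n(1) _ eq]
    by blast
  show "\<sigma> \<in> D_class \<longleftrightarrow>
      \<omega> \<in> D_hat \<and> radial_weight \<sigma> \<and> (\<exists>B>0. \<forall>r. 0 \<le> r \<and> r < 1 \<longrightarrow> tail \<nu> r * tail \<sigma> r \<le> B * tail \<omega> r)"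
    (is "_ \<longleftrightarrow> ?R")
  proof
    assume s: "\<sigma> \<in> D_class"
    then have s': "\<sigma> \<in> D_hat" "\<sigma> \<in> D_check" by (auto simp: D_class_def)
    obtain B where B: "B > 0" "\<And>r. 0 \<le> r \<Longrightarrow> r < 1 \<Longrightarrow> tail \<nu> r * tail \<sigma> r \<le> B * tail \<omega> r"
      using D_class_imp_ratio_bound[OF w n(1) s'(2) eq] by blast
    then show ?R
      using D_hat_product[OF w n(1) s'(1) eq] D_hat_radial_weight[OF s'(1)] by blast
  next
    assume ?R
    then obtain B where R: "\<omega> \<in> D_hat" "radial_weight \<sigma>" "\<And>r. 0 \<le> r \<Longrightarrow> r < 1 \<Longrightarrow> tail \<nu> r * tail \<sigma> r \<le> B * tail \<omega> r"
      by blast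
    show "\<sigma> \<in> D_class"
      using ratio_bound_imp_D_hat[OF R(1) n' R(2) eq R(3)] ratio_bound_imp_D_check[OF w n(2) R(2) eq R(3)]
      by (auto simp: D_class_def)
  qed
qed

section \<open>Power series with regular coefficients\<close>

text \<open>The chord has length \<open>2 * \<bar>sin (t / 2)\<bar>\<close>. The cubic Taylor
  remainder suffices for a linear lower bound, since for \<open>\<bar>x\<bar> \<le> 2\<close> it is
  at most two thirds of \<open>\<bar>x\<bar>\<close>.\<close>

lemma norm_one_minus_cis_ge:
  assumes "\<bar>t\<bar> \<le> pi"
  shows "\<bar>t\<bar> / 3 \<le> cmod (1 - cis t)"
proof -
  have b: "\<bar>x\<bar> / 3 \<le> \<bar>sin x\<bar>" if x: "\<bar>x\<bar> \<le> 2" for x :: real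
  proof -
    have "\<bar>sin x - (\<Sum>m<3. sin_coeff m * x ^ m)\<bar> \<le> inverse (fact 3) * \<bar>x\<bar> ^ 3"
      by (rule Maclaurin_sin_bound)
    also have "(\<Sum>m<3. sin_coeff m * x ^ m) = x"
      by (simp add: numeral_eq_Suc sin_coeff_def)
    finally have "\<bar>sin x - x\<bar> \<le> \<bar>x\<bar> * \<bar>x\<bar>\<^sup>2 / 6"
      by (simp add: fact_numeral power3_eq_cube power2_eq_square)
    also have "\<dots> \<le> \<bar>x\<bar> * 2\<^sup>2 / 6"
      using x by (intro divide_right_mono mult_left_mono power_mono) auto
    also have "\<dots> = 2 / 3 * \<bar>x\<bar>" by simp
    finally show ?thesis by linarith
  qed
  have "\<bar>t / 2\<bar> / 3 \<le> \<bar>sin (t / 2)\<bar>" using assms pi_less_4 by (intro b) auto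
  moreover have "cmod (1 - cis t) = 2 * \<bar>sin (t / 2)\<bar>"
    using dist_exp_i_1[of t] by (simp add: cis_conv_exp norm_minus_commute)
  ultimately show ?thesis by simp
qed

text \<open>Two summations by parts at once: \<open>w\<^sup>2\<close>, \<open>- 2 * w\<close> and 1
  multiply the series started at 0, 1 and 2, and the missing initial terms form the boundary
  part.\<close>

lemma power_series_second_difference:
  fixes c :: "nat \<Rightarrow> real" and w :: complex
  assumes c: "summable (\<lambda>k. \<bar>c k\<bar>)" and w: "cmod w = 1"
  shows "(1 - w)\<^sup>2 * (\<Sum>k. complex_of_real (c k) * w ^ k) =
    (1 - w) * complex_of_real (c 0) - complex_of_real (c 0 - c 1) * w +
    (\<Sum>k. complex_of_real (c k - 2 * c (k + 1) + c (k + 2)) * w ^ (k + 2))"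
proof -
  let ?f = "\<lambda>k. complex_of_real (c k) * w ^ k"
  define S where "S = (\<Sum>k. ?f k)"
  have s0: "summable ?f"
    by (rule summable_norm_cancel) (use c w in \<open>simp add: norm_mult norm_power\<close>)
  then have f0: "?f sums S" by (simp add: S_def summable_sums)
  then have f1: "(\<lambda>k. ?f (k + 1)) sums (S - ?f 0)"
    using sums_split_initial_segment[OF f0, of 1] by simp
  have f2: "(\<lambda>k. ?f (k + 2)) sums (S - (?f 0 + ?f 1))"
    using sums_split_initial_segment[OF f0, of 2] by (simp add: numeral_2_eq_2)
  have "(\<lambda>k. w\<^sup>2 * ?f k - 2 * w * ?f (k + 1) + ?f (k + 2)) sums
     (w\<^sup>2 * S - 2 * w * (S - ?f 0) + (S - (?f 0 + ?f 1)))"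
    by (intro sums_add sums_diff sums_mult f0 f1 f2)
  moreover have "(\<lambda>k. w\<^sup>2 * ?f k - 2 * w * ?f (k + 1) + ?f (k + 2)) =
     (\<lambda>k. complex_of_real (c k - 2 * c (k + 1) + c (k + 2)) * w ^ (k + 2))"
    by (auto simp: fun_eq_iff algebra_simps power2_eq_square)
  ultimately have X: "(\<Sum>k. complex_of_real (c k - 2 * c (k + 1) + c (k + 2)) * w ^ (k + 2)) =
     w\<^sup>2 * S - 2 * w * (S - ?f 0) + (S - (?f 0 + ?f 1))"
    by (simp add: sums_iff)
  show ?thesis unfolding X S_def[symmetric] by (simp add: algebra_simps power2_eq_square)
qed

text \<open>The first difference in the boundary part is itself the telescoped sum of all second
  differences, which accounts for the factor 2.\<close>

lemma norm_power_series_le_second_difference: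
  fixes c :: "nat \<Rightarrow> real" and w :: complex
  assumes c: "summable (\<lambda>k. \<bar>c k\<bar>)" and w: "cmod w = 1"
  defines "g \<equiv> \<lambda>k. \<bar>c k - 2 * c (k + 1) + c (k + 2)\<bar>"
  shows "cmod (1 - w) ^ 2 * cmod (\<Sum>k. complex_of_real (c k) * w ^ k) \<le> cmod (1 - w) * \<bar>c 0\<bar> + 2 * (\<Sum>k. g k)"
proof -
  have c1: "summable (\<lambda>k. \<bar>c (k + 1)\<bar>)" "summable (\<lambda>k. \<bar>c (k + 2)\<bar>)"
    using c by (simp_all only: summable_iff_shift[of "\<lambda>k. \<bar>c k\<bar>"])
  have sg: "summable g"
    unfolding g_def
  proof (rule summable_comparison_test'[where N = 0])
    show "summable (\<lambda>k. \<bar>c k\<bar> + 2 * \<bar>c (k + 1)\<bar> + \<bar>c (k + 2)\<bar>)"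
      using c c1 by (intro summable_add summable_mult)
  qed auto
  have sc: "summable c" using c by (rule summable_rabs_cancel)
  have "(\<lambda>k. (c k - c (k + 1))) \<longlonglongrightarrow> 0 - 0"
    by (intro tendsto_diff summable_LIMSEQ_zero sc LIMSEQ_ignore_initial_segment)
  then have d: "(\<lambda>k. (c k - c (k + 1))) \<longlonglongrightarrow> 0" by simp
  have "(\<lambda>k. (c k - c (k + 1)) - (c (Suc k) - c (Suc k + 1))) sums (c 0 - c (0 + 1) - 0)"
    by (rule telescope_sums'[OF d])
  then have tel: "(\<lambda>k. c k - 2 * c (k + 1) + c (k + 2)) sums (c 0 - c 1)" by (simp add: algebra_simps)
  have "\<bar>c 0 - c 1\<bar> \<le> (\<Sum>k. g k)"
    using summable_rabs[of "\<lambda>k. c k - 2 * c (k + 1) + c (k + 2)"] tel sg unfolding g_def by (simp add: sums_iff)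
  moreover have "cmod (\<Sum>k. complex_of_real (c k - 2 * c (k + 1) + c (k + 2)) * w ^ (k + 2)) \<le> (\<Sum>k. g k)"
  proof -
    have e: "(\<lambda>k. cmod (complex_of_real (c k - 2 * c (k + 1) + c (k + 2)) * w ^ (k + 2))) = g"
      using w by (auto simp: g_def fun_eq_iff norm_mult norm_power simp del: of_real_diff of_real_add of_real_mult)
    show ?thesis using summable_norm[of "\<lambda>k. complex_of_real (c k - 2 * c (k + 1) + c (k + 2)) * w ^ (k + 2)"] sg
      unfolding e by simp
  qed
  moreover have "cmod (1 - w) ^ 2 * cmod (\<Sum>k. complex_of_real (c k) * w ^ k) =
    cmod ((1 - w) * complex_of_real (c 0) - complex_of_real (c 0 - c 1) * w +
    (\<Sum>k. complex_of_real (c k - 2 * c (k + 1) + c (k + 2)) * w ^ (k + 2)))"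
    unfolding power_series_second_difference[OF c w, symmetric] by (simp add: norm_mult norm_power)
  moreover have "\<dots> \<le> cmod ((1 - w) * complex_of_real (c 0)) + cmod (complex_of_real (c 0 - c 1) * w) +
    cmod (\<Sum>k. complex_of_real (c k - 2 * c (k + 1) + c (k + 2)) * w ^ (k + 2))"
    by (rule order_trans[OF norm_triangle_ineq add_right_mono[OF norm_triangle_ineq4]])
  moreover have "cmod ((1 - w) * complex_of_real (c 0)) = cmod (1 - w) * \<bar>c 0\<bar>" by (simp add: norm_mult)
  moreover have "cmod (complex_of_real (c 0 - c 1) * w) = \<bar>c 0 - c 1\<bar>"
    using w by (simp add: norm_mult del: of_real_diff)
  ultimately show ?thesis by linarith
qed

text \<open>\<open>(n + 1) * t ^ n\<close> is at most the geometric sum up to \<open>n\<close>,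
  since no term of that sum is below \<open>t ^ n\<close>.\<close>

lemma Suc_mult_power_le_one:
  fixes t :: real
  assumes "0 \<le> t" "t \<le> 1"
  shows "(real n + 1) * (1 - t) * t ^ n \<le> 1"
proof -
  have "(real n + 1) * t ^ n = (\<Sum>k\<le>n. t ^ n)" by simp
  also have "\<dots> \<le> (\<Sum>k\<le>n. t ^ k)" using assms by (intro sum_mono power_decreasing) auto
  finally have "(1 - t) * ((real n + 1) * t ^ n) \<le> (1 - t) * (\<Sum>k\<le>n. t ^ k)"
    using assms by (intro mult_left_mono) auto
  also have "\<dots> = 1 - t ^ Suc n" using sum_gp_basic[of t n] by simp
  also have "\<dots> \<le> 1" using assms by simp
  finally show ?thesis by (simp add: mult_ac)
qed

text \<open>Of the three factors \<open>t ^ n\<close> of \<open>t ^ (3 * n)\<close>, two absorb the powers of \<open>n * (1 - t ^ 3)\<close> produced by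
  differencing.\<close>

lemma weighted_power_second_difference_le:
  fixes a :: "nat \<Rightarrow> real"
  assumes t: "0 \<le> t" "t \<le> 1" and A: "0 \<le> A" "0 \<le> a n"
    and d: "0 \<le> a (n + 1) - a n" "a (n + 1) - a n \<le> A * a n / (real n + 1)"
    and dd: "\<bar>a n - 2 * a (n + 1) + a (n + 2)\<bar> \<le> A * a n / (real n + 1)\<^sup>2"
  shows "\<bar>a n * t ^ (3 * n) - 2 * (a (n + 1) * t ^ (3 * (n + 1))) + a (n + 2) * t ^ (3 * (n + 2))\<bar>
    \<le> (9 + 7 * A) * (a n * t ^ n) / (real n + 1)\<^sup>2"
proof -
  define s where "s = t ^ 3"
  define m where "m = real n + 1"
  have m: "1 \<le> m" by (simp add: m_def)
  have s: "0 \<le> s" "s \<le> 1" using t by (auto simp: s_def power_le_one)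
  have p: "0 \<le> t ^ n" "t ^ n \<le> 1" using t by (auto simp: power_le_one)
  have s3: "1 - s = (1 - t) * (1 + t + t\<^sup>2)" by (simp add: s_def algebra_simps power2_eq_square power3_eq_cube)
  have "1 + t + t\<^sup>2 \<le> 3" using t power_le_one[of t 2] by linarith
  then have s4: "1 - s \<le> 3 * (1 - t)" unfolding s3 using t mult_left_mono[of "1 + t + t\<^sup>2" 3 "1 - t"] by simp
  have k1: "m * (1 - s) * t ^ n \<le> 3"
  proof -
    have "m * (1 - s) * t ^ n \<le> m * (3 * (1 - t)) * t ^ n"
      using s4 m p by (intro mult_right_mono mult_left_mono) auto
    also have "\<dots> = 3 * ((real n + 1) * (1 - t) * t ^ n)" by (simp add: m_def)
    also have "\<dots> \<le> 3 * 1" by (intro mult_left_mono Suc_mult_power_le_one t) auto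
    finally show ?thesis by simp
  qed
  have k0: "0 \<le> m * (1 - s) * t ^ n" using m s p by auto
  have sn: "t ^ (3 * n) = t ^ n * t ^ n * t ^ n"
    by (simp add: power_mult power3_eq_cube power_mult_distrib mult.commute flip: power_mult)
       (metis (no_types) mult.commute power3_eq_cube power_mult)
  have K2: "m\<^sup>2 * (1 - s)\<^sup>2 * (t ^ n * t ^ n * t ^ n) \<le> 9 * t ^ n"
  proof -
    have "(m * (1 - s) * t ^ n)\<^sup>2 \<le> 3\<^sup>2" using k0 k1 by (rule power_mono[rotated])
    then have "(m * (1 - s) * t ^ n)\<^sup>2 * t ^ n \<le> 9 * t ^ n" using p by (intro mult_right_mono) auto
    then show ?thesis by (simp add: power2_eq_square mult_ac)
  qed
  have K1: "m * (1 - s) * (t ^ n * t ^ n * t ^ n) \<le> 3 * t ^ n"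
  proof -
    have "m * (1 - s) * t ^ n * (t ^ n * t ^ n) \<le> 3 * (t ^ n * t ^ n)"
      using p k1 by (intro mult_right_mono) auto
    also have "\<dots> \<le> 3 * (t ^ n * 1)" using p by (intro mult_left_mono) auto
    finally show ?thesis by (simp add: mult_ac)
  qed
  have K0: "t ^ n * t ^ n * t ^ n \<le> t ^ n"
  proof -
    have "t ^ n * (t ^ n * t ^ n) \<le> t ^ n * (1 * 1)" using p by (intro mult_left_mono mult_mono) auto
    then show ?thesis by (simp add: mult_ac)
  qed
  define \<alpha> \<gamma> where "\<alpha> = a (n + 1) - a n" and "\<gamma> = a n - 2 * a (n + 1) + a (n + 2)"
  have al: "0 \<le> \<alpha>" "\<alpha> * m \<le> A * a n" using d m by (auto simp: \<alpha>_def m_def field_simps)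
  have ga: "\<bar>\<gamma>\<bar> * m\<^sup>2 \<le> A * a n" using dd m by (simp add: \<gamma>_def m_def field_simps)
  let ?T = "t ^ n * t ^ n * t ^ n"
  have T: "0 \<le> ?T" using p by auto
  \<comment> \<open>Product rule for second differences: both differences on the power, one on each
    factor, or both on \<open>a\<close>. The three terms contribute 9, \<open>6 * A\<close> and
    \<open>A\<close> to the constant.\<close>
  have "a n * t ^ (3 * n) - 2 * (a (n + 1) * t ^ (3 * (n + 1))) + a (n + 2) * t ^ (3 * (n + 2)) =
    ?T * (a n * (1 - s)\<^sup>2 - 2 * \<alpha> * s * (1 - s) + \<gamma> * s\<^sup>2)"
  proof -
    have e: "t ^ (3 * (n + 1)) = ?T * s" "t ^ (3 * (n + 2)) = ?T * s\<^sup>2"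
      by (simp_all add: sn[symmetric] s_def power_add distrib_left flip: power_mult)
    show ?thesis unfolding e sn by (simp add: \<alpha>_def \<gamma>_def algebra_simps power2_eq_square)
  qed
  then have "\<bar>a n * t ^ (3 * n) - 2 * (a (n + 1) * t ^ (3 * (n + 1))) + a (n + 2) * t ^ (3 * (n + 2))\<bar> =
    ?T * \<bar>a n * (1 - s)\<^sup>2 - 2 * \<alpha> * s * (1 - s) + \<gamma> * s\<^sup>2\<bar>"
    by (simp only: abs_mult[of ?T "a n * (1 - s)\<^sup>2 - 2 * \<alpha> * s * (1 - s) + \<gamma> * s\<^sup>2"] abs_of_nonneg[OF T])
  then have "m\<^sup>2 * \<bar>a n * t ^ (3 * n) - 2 * (a (n + 1) * t ^ (3 * (n + 1))) + a (n + 2) * t ^ (3 * (n + 2))\<bar> =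
    m\<^sup>2 * ?T * \<bar>a n * (1 - s)\<^sup>2 - 2 * \<alpha> * s * (1 - s) + \<gamma> * s\<^sup>2\<bar>"
    by (simp only: mult.assoc)
  also have "\<dots> \<le> m\<^sup>2 * ?T * (a n * (1 - s)\<^sup>2 + 2 * \<alpha> * (1 - s) + \<bar>\<gamma>\<bar>)"
  proof (intro mult_left_mono)
    have "2 * \<alpha> * s * (1 - s) \<le> 2 * \<alpha> * 1 * (1 - s)" "0 \<le> 2 * \<alpha> * s * (1 - s)"
      using al s by (intro mult_right_mono mult_left_mono mult_nonneg_nonneg; simp)+
    moreover have "\<bar>\<gamma> * s\<^sup>2\<bar> \<le> \<bar>\<gamma>\<bar>" using s by (simp add: abs_mult mult_left_le power_le_one)
    moreover have "0 \<le> a n * (1 - s)\<^sup>2" using A by simp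
    ultimately show "\<bar>a n * (1 - s)\<^sup>2 - 2 * \<alpha> * s * (1 - s) + \<gamma> * s\<^sup>2\<bar> \<le> a n * (1 - s)\<^sup>2 + 2 * \<alpha> * (1 - s) + \<bar>\<gamma>\<bar>"
      by linarith
  qed (use T in auto)
  also have "\<dots> = a n * (m\<^sup>2 * (1 - s)\<^sup>2 * ?T) + 2 * (\<alpha> * m) * (m * (1 - s) * ?T) + (\<bar>\<gamma>\<bar> * m\<^sup>2) * ?T"
    by (simp add: algebra_simps power2_eq_square)
  also have "\<dots> \<le> a n * (9 * t ^ n) + 2 * (A * a n) * (3 * t ^ n) + (A * a n) * t ^ n"
  proof (intro add_mono)
    show "a n * (m\<^sup>2 * (1 - s)\<^sup>2 * ?T) \<le> a n * (9 * t ^ n)"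
      using K2 A(2) by (rule mult_left_mono)
    show "2 * (\<alpha> * m) * (m * (1 - s) * ?T) \<le> 2 * (A * a n) * (3 * t ^ n)"
      by (rule mult_mono) (use al K1 A T m s in simp_all)
    show "\<bar>\<gamma>\<bar> * m\<^sup>2 * ?T \<le> A * a n * t ^ n"
      by (rule mult_mono) (use ga K0 A T in simp_all)
  qed
  also have "\<dots> = (9 + 7 * A) * (a n * t ^ n)" by (simp add: algebra_simps)
  finally show ?thesis using m unfolding m_def[symmetric] by (simp add: field_simps)
qed

text \<open>The boundary term at the cut \<open>N\<close> is spread over \<open>N / 2 \<le> n \<le> N\<close> by the doubling of \<open>a\<close>; bounding it
  by second differences alone would lose a logarithm.\<close>

lemma regular_power_series_le:
  fixes a :: "nat \<Rightarrow> real"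
  assumes t: "0 \<le> t" "t \<le> 1" and A: "0 \<le> A" and a: "\<And>n. 0 \<le> a n"
    and d: "\<And>n. a n \<le> a (n + 1)" "\<And>n. a (n + 1) - a n \<le> A * a n / (real n + 1)"
    and dd: "\<And>n. \<bar>a n - 2 * a (n + 1) + a (n + 2)\<bar> \<le> A * a n / (real n + 1)\<^sup>2"
    and dbl: "\<And>n. a (2 * n + 1) \<le> A * a n"
    and sm: "summable (\<lambda>n. a n * t ^ n)" and th: "\<bar>\<theta>\<bar> \<le> pi"
  shows "cmod (\<Sum>n. complex_of_real (a n) * (complex_of_real (t ^ 3) * cis \<theta>) ^ n) \<le>
    (326 + 408 * A) * (\<Sum>n. a n * t ^ n / (1 + ((real n + 1) * \<theta>)\<^sup>2))"
proof -
  define q where "q n = a n * t ^ n" for n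
  define Q where "Q n = q n / (1 + ((real n + 1) * \<theta>)\<^sup>2)" for n
  define b where "b n = a n * t ^ (3 * n)" for n
  define w where "w = cis \<theta>"
  have q0: "0 \<le> q n" for n using a t by (simp add: q_def)
  have Q0: "0 \<le> Q n" for n using q0 by (simp add: Q_def add_nonneg_nonneg)
  have Qq: "Q n \<le> q n" for n
  proof -
    have "q n / (1 + ((real n + 1) * \<theta>)\<^sup>2) \<le> q n / 1" using q0 by (intro divide_left_mono) (auto simp: add_pos_nonneg)
    then show ?thesis by (simp add: Q_def)
  qed
  have sq: "summable q" using sm by (simp add: q_def[abs_def])
  have sQ: "summable Q" by (rule summable_comparison_test'[OF sq, of 0]) (use Qq Q0 in simp)
  have bq: "b n \<le> q n" "0 \<le> b n" for n
  proof -
    have "t ^ (3 * n) \<le> t ^ n" using t by (intro power_decreasing) auto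
    then show "b n \<le> q n" "0 \<le> b n" using a[of n] t by (auto simp: b_def q_def mult_left_mono)
  qed
  have sb: "summable b" by (rule summable_comparison_test'[OF sq, of 0]) (use bq in simp)
  have w1: "cmod w = 1" by (simp add: w_def)
  have ser: "(\<Sum>n. complex_of_real (a n) * (complex_of_real (t ^ 3) * cis \<theta>) ^ n) = (\<Sum>n. complex_of_real (b n) * w ^ n)"
    by (simp add: b_def w_def power_mult_distrib power_mult mult.assoc)
  have ssb: "summable (\<lambda>n. complex_of_real (b n) * w ^ n)"
    by (rule summable_norm_cancel) (use sb bq w1 in \<open>simp add: norm_mult norm_power\<close>)
  have sumQ: "sum Q F \<le> suminf Q" if "finite F" for F using sQ that Q0 by (intro sum_le_suminf) auto
  have "cmod (\<Sum>n. complex_of_real (b n) * w ^ n) \<le> (326 + 408 * A) * suminf Q"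
  proof (cases "\<theta> = 0")
    case True
    have "cmod (\<Sum>n. complex_of_real (b n) * w ^ n) \<le> (\<Sum>n. cmod (complex_of_real (b n) * w ^ n))"
      by (rule summable_norm) (use sb bq w1 in \<open>simp add: norm_mult norm_power\<close>)
    also have "\<dots> = suminf b" using bq w1 by (simp add: norm_mult norm_power)
    also have "\<dots> \<le> suminf Q" using bq True by (intro suminf_le sb sQ) (simp add: Q_def)
    also have "\<dots> \<le> (326 + 408 * A) * suminf Q"
      using A suminf_nonneg[OF sQ Q0] by (simp add: mult_le_cancel_right1 not_less)
    finally show ?thesis .
  next
    case False
    define x where "x = \<bar>\<theta>\<bar>"
    have x: "0 < x" "x \<le> 4" using False th pi_less_4 by (auto simp: x_def)
    have Qx: "Q n = q n / (1 + ((real n + 1) * x)\<^sup>2)" for n by (simp add: Q_def x_def power_mult_distrib)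
    \<comment> \<open>Below \<open>N\<close> there is \<open>(n + 1) * x \<le> 1\<close>, and
      absolute values suffice; from \<open>N\<close> on \<open>(n + 1) * x > 1\<close>, and the
      cancellation is used.\<close>
    define N where "N = nat \<lfloor>1 / x\<rfloor>"
    have N: "real N \<le> 1 / x" "1 / x < real N + 1"
      using x by (auto simp: N_def of_nat_nat intro: floor_correct)
    then have N': "real N * x \<le> 1" "1 < (real N + 1) * x" using x by (auto simp: field_simps)
    have sml: "(\<Sum>n<N. b n) \<le> 2 * suminf Q"
    proof -
      have "(\<Sum>n<N. b n) \<le> (\<Sum>n<N. 2 * Q n)"
      proof (rule sum_mono)
        fix n assume "n \<in> {..<N}"
        then have "(real n + 1) * x \<le> real N * x" using x by (intro mult_right_mono) auto
        then have "(real n + 1) * x \<le> 1" using N'(1) by linarith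
        then have "((real n + 1) * x)\<^sup>2 \<le> 1\<^sup>2" using x by (intro power_mono) simp_all
        then have "1 + ((real n + 1) * x)\<^sup>2 \<le> 2" by simp
        then have "q n / 2 \<le> Q n" unfolding Qx using q0 by (intro divide_left_mono) (auto simp: add_pos_nonneg)
        then show "b n \<le> 2 * Q n" using bq(1)[of n] by simp
      qed
      also have "\<dots> \<le> 2 * suminf Q" using sumQ[of "{..<N}"] by (simp flip: sum_distrib_left)
      finally show ?thesis .
    qed
    have bN: "(real N + 1) * b N \<le> 52 * A * suminf Q"
    proof -
      have "N + 1 \<le> 2 * card {N div 2..N}" by simp
      then have "real (N + 1) \<le> real (2 * card {N div 2..N})" by (rule of_nat_mono)
      then have "(real N + 1) / 2 \<le> real (card {N div 2..N})" by simp
      then have "(real N + 1) / 2 * b N \<le> real (card {N div 2..N}) * b N"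
        using bq(2) by (rule mult_right_mono)
      also have "\<dots> = (\<Sum>n\<in>{N div 2..N}. b N)" by simp
      also have "\<dots> \<le> (\<Sum>n\<in>{N div 2..N}. 26 * A * Q n)"
      proof (rule sum_mono)
        fix n assume n: "n \<in> {N div 2..N}"
        have inc: "incseq a" using d(1) by (intro incseq_SucI) simp
        have "N div 2 \<le> n" using n by simp
        then have "N \<le> 2 * n + 1" by presburger
        then have "a N \<le> a (2 * n + 1)" by (rule incseqD[OF inc])
        also have "\<dots> \<le> A * a n" by (rule dbl)
        finally have aN: "a N \<le> A * a n" .
        have "b N \<le> a N * t ^ N" using bq(1)[of N] by (simp add: q_def)
        also have "\<dots> \<le> (A * a n) * t ^ n"
          by (rule mult_mono) (use aN a t n A in \<open>auto intro: power_decreasing\<close>)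
        finally have 1: "b N \<le> A * q n" by (simp add: q_def)
        \<comment> \<open>\<open>N * x \<le> 1\<close> and \<open>x \<le> 4\<close> give
          \<open>(n + 1) * x \<le> 5\<close>, hence \<open>26 = 1 + 5\<^sup>2\<close>; the factor 52
          above also counts that the range from \<open>N div 2\<close> to \<open>N\<close> holds at
          least half of \<open>N + 1\<close> indices.\<close>
        have "(real n + 1) * x \<le> real N * x + x" using n x by (simp add: distrib_right)
        then have "((real n + 1) * x)\<^sup>2 \<le> 5\<^sup>2" using N' x by (intro power_mono) auto
        then have "q n / 26 \<le> Q n" unfolding Qx using q0 by (intro divide_left_mono) (auto simp: add_pos_nonneg)
        then have "A * q n \<le> A * (26 * Q n)" using A by (intro mult_left_mono) auto
        then show "b N \<le> 26 * A * Q n" using 1 by simp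
      qed
      also have "\<dots> \<le> 26 * A * suminf Q"
        using sumQ[of "{N div 2..N}"] A by (simp add: mult_left_mono flip: sum_distrib_left)
      finally show ?thesis by simp
    qed
    define c where "c k = b (k + N)" for k
    have sc: "summable (\<lambda>k. \<bar>c k\<bar>)" using sb bq by (simp add: c_def summable_iff_shift)
    define g where "g k = \<bar>c k - 2 * c (k + 1) + c (k + 2)\<bar>" for k
    \<comment> \<open>Since \<open>m * x > 1\<close>, the decay \<open>1 / m\<^sup>2\<close> of the
      second differences is at most \<open>2 * x\<^sup>2 / (1 + (m * x)\<^sup>2)\<close>; the factor
      \<open>x\<^sup>2\<close> is later removed by dividing by the square of
      \<open>y = cmod (1 - w)\<close>.\<close>
    have gle: "g k \<le> x\<^sup>2 * (18 + 14 * A) * Q (k + N)" for k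
    proof -
      define m where "m = real (k + N) + 1"
      have "(real N + 1) * x \<le> m * x" using x by (intro mult_right_mono) (auto simp: m_def)
      then have mx: "1 < m * x" using N' by simp
      have m0: "0 < m" by (simp add: m_def)
      have "g k \<le> (9 + 7 * A) * (a (k + N) * t ^ (k + N)) / (real (k + N) + 1)\<^sup>2"
      proof -
        have e: "k + 1 + N = k + N + 1" "k + 2 + N = k + N + 2" by simp_all
        show ?thesis unfolding g_def c_def b_def e
          using d(1)[of "k + N"] by (intro weighted_power_second_difference_le[OF t A a _ d(2) dd]) linarith
      qed
      also have "\<dots> = (9 + 7 * A) * (q (k + N) / m\<^sup>2)" by (simp add: q_def m_def)
      also have "\<dots> \<le> (9 + 7 * A) * (x\<^sup>2 * (2 * Q (k + N)))"
      proof (intro mult_left_mono)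
        have "1\<^sup>2 \<le> (m * x)\<^sup>2" using mx by (intro power_mono) auto
        then have "1 + (m * x)\<^sup>2 \<le> 2 * (m * x)\<^sup>2" "0 < 1 + (m * x)\<^sup>2" "0 < 2 * (m * x)\<^sup>2" using m0 x by simp_all
        then have "q (k + N) / (2 * (m * x)\<^sup>2) \<le> q (k + N) / (1 + (m * x)\<^sup>2)"
          using q0 by (intro divide_left_mono mult_pos_pos) simp_all
        then have "q (k + N) / (2 * (m * x)\<^sup>2) * (2 * x\<^sup>2) \<le> Q (k + N) * (2 * x\<^sup>2)"
          unfolding Qx m_def by (intro mult_right_mono) auto
        then show "q (k + N) / m\<^sup>2 \<le> x\<^sup>2 * (2 * Q (k + N))"
          using x m0 by (simp add: power_mult_distrib field_simps)
      qed (use A in auto)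
      finally show ?thesis by (simp add: algebra_simps)
    qed
    have sQN: "summable (\<lambda>k. Q (k + N))" using sQ by (simp add: summable_iff_shift)
    have sg: "summable g"
      by (rule summable_comparison_test'[OF summable_mult[OF sQN, of "x\<^sup>2 * (18 + 14 * A)"], of 0])
         (use gle in \<open>simp add: g_def\<close>)
    have gsum: "suminf g \<le> x\<^sup>2 * ((18 + 14 * A) * suminf Q)"
    proof -
      have "suminf g \<le> (\<Sum>k. x\<^sup>2 * (18 + 14 * A) * Q (k + N))"
        by (intro suminf_le sg summable_mult sQN gle)
      also have "\<dots> = x\<^sup>2 * (18 + 14 * A) * (\<Sum>k. Q (k + N))" by (rule suminf_mult[OF sQN])
      also have "\<dots> \<le> x\<^sup>2 * (18 + 14 * A) * suminf Q"
        using suminf_split_initial_segment[OF sQ, of N] A Q0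
        by (intro mult_left_mono) (auto intro: sum_nonneg)
      finally show ?thesis by (simp add: mult.assoc)
    qed
    define S where "S = (\<Sum>k. complex_of_real (c k) * w ^ k)"
    define y where "y = cmod (1 - w)"
    have y: "x / 3 \<le> y" unfolding x_def y_def w_def by (rule norm_one_minus_cis_ge[OF th])
    have y0: "0 < y" using y x by linarith
    have "y\<^sup>2 * cmod S \<le> y * \<bar>c 0\<bar> + 2 * suminf g"
      unfolding y_def S_def g_def[abs_def] by (rule norm_power_series_le_second_difference[OF sc w1])
    also have "\<dots> \<le> y\<^sup>2 * (156 * A * suminf Q) + 2 * (9 * y\<^sup>2 * ((18 + 14 * A) * suminf Q))"
    proof (intro add_mono mult_left_mono)
      have "b N \<le> x * ((real N + 1) * b N)"
        using mult_right_mono[of 1 "(real N + 1) * x" "b N"] N' bq(2)[of N] by (simp add: mult_ac)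
      also have "\<dots> \<le> (3 * y) * (52 * A * suminf Q)"
        by (rule mult_mono) (use bN bq(2)[of N] y x y0 in simp_all)
      finally have "y * b N \<le> y * ((3 * y) * (52 * A * suminf Q))" using y0 by (intro mult_left_mono) auto
      then show "y * \<bar>c 0\<bar> \<le> y\<^sup>2 * (156 * A * suminf Q)"
        using bq(2)[of N] by (simp add: c_def power2_eq_square mult_ac)
      have "x\<^sup>2 \<le> (3 * y)\<^sup>2" using x y by (intro power_mono) auto
      then have "x\<^sup>2 * ((18 + 14 * A) * suminf Q) \<le> 9 * y\<^sup>2 * ((18 + 14 * A) * suminf Q)"
        using A suminf_nonneg[OF sQ Q0] by (intro mult_right_mono) (auto simp: power_mult_distrib)
      then show "suminf g \<le> 9 * y\<^sup>2 * ((18 + 14 * A) * suminf Q)" using gsum by linarith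
    qed auto
    \<comment> \<open>With \<open>x \<le> 3 * y\<close> the boundary term gives
      \<open>3 * 52 * A = 156 * A\<close> and the second differences give
      \<open>2 * 9 * (18 + 14 * A)\<close>. The terms below \<open>N\<close> raise 324 to the 326 of
      the statement.\<close>
    also have "\<dots> = y\<^sup>2 * ((324 + 408 * A) * suminf Q)" by (simp add: algebra_simps)
    finally have S: "cmod S \<le> (324 + 408 * A) * suminf Q" using y0 by simp
    have "(\<Sum>n. complex_of_real (b n) * w ^ n) = (\<Sum>k. complex_of_real (b (k + N)) * w ^ (k + N)) + (\<Sum>n<N. complex_of_real (b n) * w ^ n)"
      by (rule suminf_split_initial_segment[OF ssb])
    also have "(\<Sum>k. complex_of_real (b (k + N)) * w ^ (k + N)) = w ^ N * S"
    proof -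
      have "summable (\<lambda>k. complex_of_real (c k) * w ^ k)"
        by (rule summable_norm_cancel) (use sc w1 in \<open>simp add: norm_mult norm_power\<close>)
      then show ?thesis unfolding S_def by (subst suminf_mult[symmetric]) (auto simp: c_def power_add mult_ac)
    qed
    finally have "cmod (\<Sum>n. complex_of_real (b n) * w ^ n) \<le> cmod (w ^ N * S) + cmod (\<Sum>n<N. complex_of_real (b n) * w ^ n)"
      by (simp add: norm_triangle_ineq)
    also have "cmod (w ^ N * S) = cmod S" using w1 by (simp add: norm_mult norm_power)
    also have "cmod (\<Sum>n<N. complex_of_real (b n) * w ^ n) \<le> (\<Sum>n<N. b n)"
      using w1 bq by (intro sum_norm_le) (simp add: norm_mult norm_power)
    finally have "cmod (\<Sum>n. complex_of_real (b n) * w ^ n) \<le> cmod S + (\<Sum>n<N. b n)" by simp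
    then show ?thesis using S sml by (simp add: algebra_simps)
  qed
  then show ?thesis unfolding ser Q_def q_def .
qed

section \<open>Polar coordinates\<close>

abbreviation angle_measure :: "real measure" where
  "angle_measure \<equiv> restrict_space lborel {-pi..pi}"

lemma nn_integral_angle:
  assumes "f \<in> borel_measurable borel"
  shows "(\<integral>\<^sup>+\<theta>. f \<theta> \<partial>angle_measure) = (\<integral>\<^sup>+\<theta>. f \<theta> * indicator {-pi..<pi} \<theta> \<partial>lborel)"
proof -
  have "(\<integral>\<^sup>+\<theta>. f \<theta> \<partial>angle_measure) = (\<integral>\<^sup>+\<theta>. f \<theta> * indicator {-pi..pi} \<theta> \<partial>lborel)"
    by (subst nn_integral_restrict_space) auto
  also have "\<dots> = (\<integral>\<^sup>+\<theta>. f \<theta> * indicator {-pi..<pi} \<theta> \<partial>lborel)"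
    by (intro nn_integral_cong_AE, use AE_lborel_singleton[of pi] in eventually_elim)
       (auto simp: indicator_def)
  finally show ?thesis .
qed

text \<open>The shifted window of length \<open>2 * pi\<close> is cut at \<open>pi\<close>, and the
  overhang is moved back by one period.\<close>

lemma nn_integral_angle_shift:
  fixes u :: "real \<Rightarrow> ennreal"
  assumes [measurable]: "u \<in> borel_measurable borel" and per: "\<And>x. u (x + 2 * pi) = u x" and c: "0 \<le> c" "c \<le> 2 * pi"
  shows "(\<integral>\<^sup>+\<theta>. u (\<theta> + c) \<partial>angle_measure) = (\<integral>\<^sup>+\<theta>. u \<theta> \<partial>angle_measure)"
proof -
  have "(\<integral>\<^sup>+\<theta>. u (\<theta> + c) \<partial>angle_measure) = (\<integral>\<^sup>+\<theta>. u (\<theta> + c) * indicator {-pi..<pi} \<theta> \<partial>lborel)"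
    by (rule nn_integral_angle) simp
  also have "\<dots> = (\<integral>\<^sup>+\<theta>. u (\<theta> + c) * indicator {c-pi..<c+pi} (\<theta> + c) \<partial>lborel)"
    by (intro nn_integral_cong) (auto simp: indicator_def)
  also have "\<dots> = (\<integral>\<^sup>+y. u y * indicator {c-pi..<c+pi} y \<partial>lborel)"
    by (rule nn_integral_lborel_translate) simp
  also have "\<dots> = (\<integral>\<^sup>+y. u y * indicator {c-pi..<pi} y + u y * indicator {pi..<c+pi} y \<partial>lborel)"
    using c by (intro nn_integral_cong) (auto simp: indicator_def)
  also have "\<dots> = (\<integral>\<^sup>+y. u y * indicator {c-pi..<pi} y \<partial>lborel) + (\<integral>\<^sup>+y. u y * indicator {pi..<c+pi} y \<partial>lborel)"
    by (rule nn_integral_add) auto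
  also have "(\<integral>\<^sup>+y. u y * indicator {pi..<c+pi} y \<partial>lborel) =
      (\<integral>\<^sup>+y. u (y + 2 * pi) * indicator {pi..<c+pi} (y + 2 * pi) \<partial>lborel)"
    by (rule nn_integral_lborel_translate[symmetric]) simp
  also have "\<dots> = (\<integral>\<^sup>+y. u y * indicator {-pi..<c-pi} y \<partial>lborel)"
    by (intro nn_integral_cong) (auto simp: indicator_def per)
  also have "(\<integral>\<^sup>+y. u y * indicator {c-pi..<pi} y \<partial>lborel) + (\<integral>\<^sup>+y. u y * indicator {-pi..<c-pi} y \<partial>lborel) =
     (\<integral>\<^sup>+y. u y * indicator {c-pi..<pi} y + u y * indicator {-pi..<c-pi} y \<partial>lborel)"
    by (rule nn_integral_add[symmetric]) auto
  also have "\<dots> = (\<integral>\<^sup>+y. u y * indicator {-pi..<pi} y \<partial>lborel)"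
    using c by (intro nn_integral_cong) (auto simp: indicator_def)
  also have "\<dots> = (\<integral>\<^sup>+\<theta>. u \<theta> \<partial>angle_measure)"
    by (rule nn_integral_angle[symmetric]) simp
  finally show ?thesis .
qed

lemma nn_integral_angle_rotate:
  fixes G :: "complex \<Rightarrow> ennreal"
  assumes [measurable]: "G \<in> borel_measurable borel"
  shows "(\<integral>\<^sup>+\<theta>. G (cis \<theta> * z) \<partial>angle_measure) = (\<integral>\<^sup>+\<theta>. G (cis \<theta> * complex_of_real (cmod z)) \<partial>angle_measure)"
proof -
  define c where "c = Arg2pi z"
  have c: "0 \<le> c" "c \<le> 2 * pi" using Arg2pi[of z] by (auto simp: c_def)
  have z: "z = complex_of_real (cmod z) * cis c"
    using Arg2pi_eq[of z] by (simp add: c_def cis_conv_exp)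
  have cm[measurable]: "cis \<in> borel_measurable borel"
    by (intro borel_measurable_continuous_onI continuous_intros)
  have "(\<integral>\<^sup>+\<theta>. G (cis \<theta> * z) \<partial>angle_measure) = (\<integral>\<^sup>+\<theta>. G (cis (\<theta> + c) * complex_of_real (cmod z)) \<partial>angle_measure)"
    by (subst (1) z) (simp add: cis_mult[symmetric] mult_ac)
  also have "\<dots> = (\<integral>\<^sup>+\<theta>. G (cis \<theta> * complex_of_real (cmod z)) \<partial>angle_measure)"
    by (rule nn_integral_angle_shift[OF _ _ c]) (auto simp: cis_mult[symmetric])
  finally show ?thesis .
qed

lemma emeasure_angle: "emeasure angle_measure (space angle_measure) = ennreal (2 * pi)"
  by (simp add: emeasure_restrict_space space_restrict_space)

text \<open>Obtained by averaging: the disc integral is invariant under rotations, so its mean over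
  all angles may be exchanged with it. The inner angular mean depends only on the modulus, and the
  radial formula finishes. The angular factor \<open>G\<close> is Borel, which gives joint
  measurability for the exchange.\<close>

lemma nn_integral_disc_polar:
  fixes G :: "complex \<Rightarrow> ennreal" and g :: "real \<Rightarrow> ennreal"
  assumes G[measurable]: "G \<in> borel_measurable borel" and g[measurable]: "g \<in> borel_measurable (lebesgue_on {0..<1})"
  shows "(\<integral>\<^sup>+\<zeta>. G \<zeta> * g (cmod \<zeta>) \<partial>lebesgue_on unit_disc) =
    (\<integral>\<^sup>+r. ennreal r * g r * (\<integral>\<^sup>+\<theta>. G (cis \<theta> * complex_of_real r) \<partial>angle_measure) \<partial>lebesgue_on {0..<1})"
proof -
  have cm[measurable]: "cis \<in> borel_measurable borel"
    by (intro borel_measurable_continuous_onI continuous_intros)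
  have idm[measurable]: "(\<lambda>\<zeta>. \<zeta>) \<in> borel_measurable (lebesgue_on unit_disc)"
    by (simp add: measurable_completion measurable_restrict_space1)
  interpret A: finite_measure angle_measure
    by (rule finite_measureI) (simp add: emeasure_restrict_space space_restrict_space)
  interpret D: finite_measure "lebesgue_on unit_disc"
    by (rule finite_measure_lebesgue_on) simp
  interpret P: pair_sigma_finite angle_measure "lebesgue_on unit_disc" ..
  have thetam[measurable]: "(\<lambda>\<theta>. \<theta>) \<in> borel_measurable angle_measure"
    by (simp add: measurable_restrict_space1)
  have cisA[measurable]: "cis \<in> borel_measurable angle_measure"
    by (rule measurable_restrict_space1) simp
  let ?F = "\<lambda>\<zeta>. G \<zeta> * g (cmod \<zeta>)"
  have gm[measurable]: "(\<lambda>\<zeta>. g (cmod \<zeta>)) \<in> borel_measurable (lebesgue_on unit_disc)"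
    by (rule measurable_compose[OF cmod_measurable_disc g])
  have Gm: "G \<in> borel_measurable (lebesgue_on unit_disc)"
    using measurable_compose[OF idm G] by simp
  have Fm: "?F \<in> borel_measurable (lebesgue_on unit_disc)"
    using Gm gm by (rule borel_measurable_times_ennreal)
  have "ennreal (2 * pi) * (\<integral>\<^sup>+\<zeta>. ?F \<zeta> \<partial>lebesgue_on unit_disc) = (\<integral>\<^sup>+\<theta>. (\<integral>\<^sup>+\<zeta>. ?F \<zeta> \<partial>lebesgue_on unit_disc) \<partial>angle_measure)"
    by (simp only: nn_integral_const emeasure_angle mult.commute)
  also have "\<dots> = (\<integral>\<^sup>+\<theta>. (\<integral>\<^sup>+\<zeta>. ?F (cis \<theta> * \<zeta>) \<partial>lebesgue_on unit_disc) \<partial>angle_measure)"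
    by (intro nn_integral_cong nn_integral_disc_rotate[OF _ Fm, symmetric]) simp
  also have "\<dots> = (\<integral>\<^sup>+\<theta>. (\<integral>\<^sup>+\<zeta>. G (cis \<theta> * \<zeta>) * g (cmod \<zeta>) \<partial>lebesgue_on unit_disc) \<partial>angle_measure)"
    by (simp add: norm_mult)
  also have "\<dots> = (\<integral>\<^sup>+\<zeta>. (\<integral>\<^sup>+\<theta>. G (cis \<theta> * \<zeta>) * g (cmod \<zeta>) \<partial>angle_measure) \<partial>lebesgue_on unit_disc)"
    by (rule P.Fubini'[symmetric]) measurable
  also have "\<dots> = (\<integral>\<^sup>+\<zeta>. (\<integral>\<^sup>+\<theta>. G (cis \<theta> * \<zeta>) \<partial>angle_measure) * g (cmod \<zeta>) \<partial>lebesgue_on unit_disc)"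
    by (intro nn_integral_cong nn_integral_multc) measurable
  also have "\<dots> = (\<integral>\<^sup>+\<zeta>. (\<integral>\<^sup>+\<theta>. G (cis \<theta> * complex_of_real (cmod \<zeta>)) \<partial>angle_measure) * g (cmod \<zeta>) \<partial>lebesgue_on unit_disc)"
    by (intro nn_integral_cong arg_cong2[where f="(*)"] nn_integral_angle_rotate refl) simp
  also have "\<dots> = (\<integral>\<^sup>+r. ennreal (2 * pi * r) * ((\<integral>\<^sup>+\<theta>. G (cis \<theta> * complex_of_real r) \<partial>angle_measure) * g r) \<partial>lebesgue_on {0..<1})"
  proof (rule nn_integral_disc_radial[of "\<lambda>r. (\<integral>\<^sup>+\<theta>. G (cis \<theta> * complex_of_real r) \<partial>angle_measure) * g r"])
    have "(\<lambda>r. \<integral>\<^sup>+\<theta>. G (cis \<theta> * complex_of_real r) \<partial>angle_measure) \<in> borel_measurable (lborel :: real measure)"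
      by measurable
    then have "(\<lambda>r. \<integral>\<^sup>+\<theta>. G (cis \<theta> * complex_of_real r) \<partial>angle_measure) \<in> borel_measurable (lebesgue_on {0..<1})"
      by (simp add: measurable_completion measurable_restrict_space1)
    then show "(\<lambda>r. (\<integral>\<^sup>+\<theta>. G (cis \<theta> * complex_of_real r) \<partial>angle_measure) * g r) \<in> borel_measurable (lebesgue_on {0..<1})"
      using g by (rule borel_measurable_times_ennreal)
  qed
  also have "\<dots> = (\<integral>\<^sup>+r. ennreal (2 * pi) * (ennreal r * g r * (\<integral>\<^sup>+\<theta>. G (cis \<theta> * complex_of_real r) \<partial>angle_measure)) \<partial>lebesgue_on {0..<1})"
    by (intro nn_integral_cong) (simp add: ennreal_mult mult_ac)
  also have "\<dots> = ennreal (2 * pi) * (\<integral>\<^sup>+r. ennreal r * g r * (\<integral>\<^sup>+\<theta>. G (cis \<theta> * complex_of_real r) \<partial>angle_measure) \<partial>lebesgue_on {0..<1})"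
  proof (rule nn_integral_cmult)
    have "(\<lambda>r. \<integral>\<^sup>+\<theta>. G (cis \<theta> * complex_of_real r) \<partial>angle_measure) \<in> borel_measurable (lborel :: real measure)"
      by measurable
    then have "(\<lambda>r. \<integral>\<^sup>+\<theta>. G (cis \<theta> * complex_of_real r) \<partial>angle_measure) \<in> borel_measurable (lebesgue_on {0..<1})"
      by (simp add: measurable_completion measurable_restrict_space1)
    moreover have "(\<lambda>r. ennreal r) \<in> borel_measurable (lebesgue_on {0..<1})"
      by (simp add: measurable_completion measurable_restrict_space1)
    ultimately show "(\<lambda>r. ennreal r * g r * (\<integral>\<^sup>+\<theta>. G (cis \<theta> * complex_of_real r) \<partial>angle_measure)) \<in> borel_measurable (lebesgue_on {0..<1})"
      using g by (intro borel_measurable_times_ennreal)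
  qed
  finally show ?thesis
    by (subst (asm) ennreal_mult_cancel_left) auto
qed

lemma nn_integral_angle_inverse_quadratic_le:
  fixes k :: real
  assumes k: "0 < k"
  shows "(\<integral>\<^sup>+\<theta>. ennreal (1 / (1 + (k * \<theta>)\<^sup>2)) \<partial>angle_measure) \<le> ennreal (pi / k)"
proof -
  have "(\<integral>\<^sup>+\<theta>. ennreal (1 / (1 + (k * \<theta>)\<^sup>2)) \<partial>angle_measure) =
    (\<integral>\<^sup>+\<theta>. ennreal (1 / (1 + (k * \<theta>)\<^sup>2)) * indicator {-pi..pi} \<theta> \<partial>lborel)"
    by (subst nn_integral_restrict_space) auto
  also have "\<dots> = ennreal (arctan (k * pi) / k - arctan (k * - pi) / k)"
  proof (rule nn_integral_FTC_Icc)
    fix x :: real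
    have "((\<lambda>x. arctan (k * x) / k) has_real_derivative inverse (1 + (k * x)\<^sup>2) * k / k) (at x)"
      by (auto intro!: derivative_eq_intros simp: k less_imp_neq[symmetric])
    then show "((\<lambda>x. arctan (k * x) / k) has_real_derivative 1 / (1 + (k * x)\<^sup>2)) (at x)"
      using k by (simp add: inverse_eq_divide)
  qed auto
  also have "\<dots> \<le> ennreal (pi / k)"
  proof (rule ennreal_leI)
    have "arctan (k * pi) / k - arctan (k * - pi) / k = 2 * arctan (k * pi) / k"
      by (simp add: arctan_minus add_divide_distrib[symmetric])
    also have "\<dots> \<le> pi / k" using arctan_ubound[of "k * pi"] k by (intro divide_right_mono) auto
    finally show "arctan (k * pi) / k - arctan (k * - pi) / k \<le> pi / k" .
  qed
  finally show ?thesis .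
qed

section \<open>Coefficients of the Bergman kernel\<close>

definition kernel_coeff :: "(real \<Rightarrow> real) \<Rightarrow> nat \<Rightarrow> real" where
  "kernel_coeff \<omega> n = 1 / (2 * mom \<omega> (2 * real n + 1))"

lemma kernel_coeff_pos: "radial_weight \<omega> \<Longrightarrow> 0 < kernel_coeff \<omega> n"
  by (simp add: kernel_coeff_def mom_pos)

lemma bergman_kernel_eq:
  assumes "radial_weight \<omega>"
  shows "bergman_kernel \<omega> z \<zeta> = (\<Sum>n. complex_of_real (kernel_coeff \<omega> n) * (cnj z * \<zeta>) ^ n)"
  unfolding bergman_kernel_def kernel_coeff_def
  using assms by (intro suminf_cong) (simp add: moment_eq_mom less_imp_le[OF mom_pos])

text \<open>A moment is at least \<open>t powr (2 * n + 1)\<close> times the positive tail at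
  \<open>t\<close>, for any \<open>t < 1\<close>, so the coefficients grow more slowly than every
  geometric sequence of ratio above 1. Here \<open>t\<^sup>2\<close> is taken halfway between
  \<open>s\<close> and 1.\<close>

lemma kernel_coeff_summable:
  assumes w: "radial_weight \<omega>" and s: "0 \<le> s" "s < 1"
  shows "summable (\<lambda>n. kernel_coeff \<omega> n * s ^ n)"
proof -
  define t where "t = sqrt ((1 + s) / 2)"
  have t2: "t\<^sup>2 = (1 + s) / 2" using s by (simp add: t_def)
  have t: "0 < t" "t < 1" using s by (auto simp: t_def)
  have T: "0 < tail \<omega> t" using t by (intro tail_pos w) auto
  have q: "0 \<le> s / t\<^sup>2" "s / t\<^sup>2 < 1" using s t by (auto simp: t2)
  have le: "kernel_coeff \<omega> n * s ^ n \<le> 1 / (2 * t * tail \<omega> t) * (s / t\<^sup>2) ^ n" for n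
  proof -
    have "t powr (2 * real n + 1) * tail \<omega> t \<le> mom \<omega> (2 * real n + 1)"
      using t by (intro mom_ge_tail w) auto
    also have "t powr (2 * real n + 1) = t powr real (2 * n + 1)" by (simp add: add.commute)
    also have "\<dots> = t * (t\<^sup>2) ^ n" using t by (subst powr_realpow) (auto simp: power_mult)
    finally have m: "t * (t\<^sup>2) ^ n * tail \<omega> t \<le> mom \<omega> (2 * real n + 1)" .
    have p: "0 < t * (t\<^sup>2) ^ n * tail \<omega> t" using t T by simp
    have "kernel_coeff \<omega> n \<le> 1 / (2 * (t * (t\<^sup>2) ^ n * tail \<omega> t))"
      unfolding kernel_coeff_def using m p by (intro divide_left_mono) auto
    then have "kernel_coeff \<omega> n * s ^ n \<le> 1 / (2 * (t * (t\<^sup>2) ^ n * tail \<omega> t)) * s ^ n"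
      using s by (intro mult_right_mono) auto
    then show ?thesis by (simp add: power_divide field_simps)
  qed
  have "summable (\<lambda>n. 1 / (2 * t * tail \<omega> t) * (s / t\<^sup>2) ^ n)"
    using q by (intro summable_mult summable_geometric) auto
  then show ?thesis
    by (rule summable_comparison_test'[of _ 0]) (use le s less_imp_le[OF kernel_coeff_pos[OF w]] in auto)
qed

lemma power_two_le_exp: "0 \<le> (u::real) \<Longrightarrow> u\<^sup>2 \<le> 2 * exp u"
  using exp_lower_Taylor_quadratic[of u] by simp

text \<open>Of the exponent \<open>2 * n + 1\<close> the part \<open>m = n + 1\<close> pays for the
  factors \<open>1 - r\<^sup>2\<close>: with \<open>u = m * (1 - r)\<close> it is at most
  \<open>exp (- u)\<close>, and \<open>u * exp (- u)\<close> and
  \<open>u\<^sup>2 * exp (- u)\<close> are bounded.\<close>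

lemma power_mult_defect_le:
  fixes r :: real
  assumes r: "0 \<le> r" "r < 1"
  shows "r powr (2 * real n + 1) - r powr (2 * real (n + 1) + 1) \<le> 2 / (real n + 1) * r powr real n"
    and "r powr (2 * real n + 1) - 2 * r powr (2 * real (n + 1) + 1) + r powr (2 * real (n + 2) + 1) \<le> 8 / (real n + 1)\<^sup>2 * r powr real n"
proof -
  define m where "m = real n + 1"
  have m: "1 \<le> m" by (simp add: m_def)
  define u where "u = m * (1 - r)"
  have u: "0 \<le> u" using m r by (simp add: u_def)
  have e: "r powr (2 * real n + 1) = r powr real n * r powr m"
    "r powr (2 * real (n + 1) + 1) = r powr real n * r powr m * r\<^sup>2"
    "r powr (2 * real (n + 2) + 1) = r powr real n * r powr m * (r\<^sup>2)\<^sup>2"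
  proof -
    show "r powr (2 * real n + 1) = r powr real n * r powr m" by (simp add: m_def flip: powr_add)
    have "r powr (2 * real (n + 1) + 1) = r powr (real n + m + real 2)" by (simp add: m_def algebra_simps)
    then show "r powr (2 * real (n + 1) + 1) = r powr real n * r powr m * r\<^sup>2"
      using r by (cases "r = 0") (simp_all only: powr_add powr_realpow order.strict_iff_order, simp_all)
    have "r powr (2 * real (n + 2) + 1) = r powr (real n + m + real 4)" by (simp add: m_def algebra_simps)
    then show "r powr (2 * real (n + 2) + 1) = r powr real n * r powr m * (r\<^sup>2)\<^sup>2"
      using r by (cases "r = 0") (simp_all only: powr_add powr_realpow order.strict_iff_order, simp_all)
  qed
  have r2: "1 - r\<^sup>2 \<le> 2 * (1 - r)" "0 \<le> 1 - r\<^sup>2"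
  proof -
    have "0 \<le> (1 - r)\<^sup>2" by simp
    then show "1 - r\<^sup>2 \<le> 2 * (1 - r)" by (simp add: power2_eq_square algebra_simps)
    show "0 \<le> 1 - r\<^sup>2" using r by (simp add: power_le_one)
  qed
  have pm: "r powr m \<le> exp (- u)" using powr_le_exp[of r m] r m by (simp add: u_def)
  have "u \<le> exp u" using exp_ge_add_one_self[of u] by linarith
  then have "u * exp (- u) \<le> 1" by (simp add: exp_minus field_simps)
  then have k1: "r powr m * u \<le> 1" using mult_right_mono[OF pm u] by (simp add: mult.commute)
  have "u\<^sup>2 * exp (- u) \<le> 2" using power_two_le_exp[OF u] by (simp add: exp_minus field_simps)
  then have k2: "r powr m * u\<^sup>2 \<le> 2" using mult_right_mono[OF pm, of "u\<^sup>2"] by (simp add: mult.commute)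
  have "r powr m * (1 - r\<^sup>2) \<le> r powr m * (2 * (1 - r))" using r2 by (intro mult_left_mono) auto
  also have "\<dots> = 2 / m * (r powr m * u)" using m by (simp add: u_def)
  also have "\<dots> \<le> 2 / m * 1" using k1 m by (intro mult_left_mono) auto
  finally have "r powr real n * (r powr m * (1 - r\<^sup>2)) \<le> r powr real n * (2 / m)" by (intro mult_left_mono) auto
  then show "r powr (2 * real n + 1) - r powr (2 * real (n + 1) + 1) \<le> 2 / (real n + 1) * r powr real n"
    unfolding e m_def[symmetric] by (simp add: algebra_simps)
  have "r powr m * (1 - r\<^sup>2)\<^sup>2 \<le> r powr m * (2 * (1 - r))\<^sup>2" using r2 by (intro mult_left_mono power_mono) auto
  also have "\<dots> = 4 / m\<^sup>2 * (r powr m * u\<^sup>2)" using m by (simp add: u_def power2_eq_square field_simps)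
  also have "\<dots> \<le> 4 / m\<^sup>2 * 2" using k2 m by (intro mult_left_mono) auto
  finally have "r powr real n * (r powr m * (1 - r\<^sup>2)\<^sup>2) \<le> r powr real n * (8 / m\<^sup>2)" by (intro mult_left_mono) auto
  then show "r powr (2 * real n + 1) - 2 * r powr (2 * real (n + 1) + 1) + r powr (2 * real (n + 2) + 1) \<le> 8 / (real n + 1)\<^sup>2 * r powr real n"
    unfolding e m_def[symmetric] by (simp add: algebra_simps power2_eq_square)
qed

text \<open>The bounds involve the moment of order \<open>n\<close>, roughly half of the original
  order; doubling of \<open>\<omega>\<close> makes up for this in
  \<open>kernel_coeff_regular\<close>.\<close>

lemma mom_differences:
  assumes w: "radial_weight \<omega>"
  shows "mom \<omega> (2 * real n + 1) - mom \<omega> (2 * real (n + 1) + 1) \<le> 2 / (real n + 1) * mom \<omega> (real n)"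
    and "mom \<omega> (2 * real n + 1) - 2 * mom \<omega> (2 * real (n + 1) + 1) + mom \<omega> (2 * real (n + 2) + 1) \<le> 8 / (real n + 1)\<^sup>2 * mom \<omega> (real n)"
    and "0 \<le> mom \<omega> (2 * real n + 1) - 2 * mom \<omega> (2 * real (n + 1) + 1) + mom \<omega> (2 * real (n + 2) + 1)"
proof -
  have i: "integrable unit_itv (\<lambda>r. r powr x * \<omega> r)" if "0 \<le> x" for x using that by (rule mom_integrable[OF w])
  have i3: "integrable unit_itv (\<lambda>r. r powr (2 * real n + 1) * \<omega> r)"
    "integrable unit_itv (\<lambda>r. r powr (2 * real (n + 1) + 1) * \<omega> r)"
    "integrable unit_itv (\<lambda>r. r powr (2 * real (n + 2) + 1) * \<omega> r)"
    "integrable unit_itv (\<lambda>r. r powr real n * \<omega> r)"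
    by (rule i; simp)+
  have w0: "0 \<le> \<omega> r" if "0 \<le> r" "r < 1" for r using w that by (rule radial_weight_nonneg)
  have "mom \<omega> (2 * real n + 1) - mom \<omega> (2 * real (n + 1) + 1) =
    (LINT r|unit_itv. r powr (2 * real n + 1) * \<omega> r - r powr (2 * real (n + 1) + 1) * \<omega> r)"
    unfolding mom_def by (rule Bochner_Integration.integral_diff[symmetric]) (fact i3)+
  also have "\<dots> \<le> (LINT r|unit_itv. 2 / (real n + 1) * (r powr real n * \<omega> r))"
  proof (rule integral_unit_itv_mono)
    fix r :: real assume r: "0 \<le> r" "r < 1"
    show "r powr (2 * real n + 1) * \<omega> r - r powr (2 * real (n + 1) + 1) * \<omega> r \<le> 2 / (real n + 1) * (r powr real n * \<omega> r)"
      using mult_right_mono[OF power_mult_defect_le(1)[OF r, of n] w0[OF r]] by (simp only: left_diff_distrib mult.assoc)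
  qed (intro Bochner_Integration.integrable_diff integrable_mult_right i3)+
  also have "\<dots> = 2 / (real n + 1) * mom \<omega> (real n)" unfolding mom_def by (rule integral_mult_right_zero)
  finally show "mom \<omega> (2 * real n + 1) - mom \<omega> (2 * real (n + 1) + 1) \<le> 2 / (real n + 1) * mom \<omega> (real n)" .
  have id: "integrable unit_itv (\<lambda>r. r powr (2 * real n + 1) * \<omega> r - 2 * (r powr (2 * real (n + 1) + 1) * \<omega> r) + r powr (2 * real (n + 2) + 1) * \<omega> r)"
    by (intro Bochner_Integration.integrable_add Bochner_Integration.integrable_diff integrable_mult_right i3)
  have eq: "mom \<omega> (2 * real n + 1) - 2 * mom \<omega> (2 * real (n + 1) + 1) + mom \<omega> (2 * real (n + 2) + 1) =
    (LINT r|unit_itv. r powr (2 * real n + 1) * \<omega> r - 2 * (r powr (2 * real (n + 1) + 1) * \<omega> r) + r powr (2 * real (n + 2) + 1) * \<omega> r)"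
    unfolding mom_def
    by (subst Bochner_Integration.integral_add, (intro Bochner_Integration.integrable_diff integrable_mult_right i3)+,
        subst Bochner_Integration.integral_diff, (intro integrable_mult_right i3)+, simp)
  show "mom \<omega> (2 * real n + 1) - 2 * mom \<omega> (2 * real (n + 1) + 1) + mom \<omega> (2 * real (n + 2) + 1) \<le> 8 / (real n + 1)\<^sup>2 * mom \<omega> (real n)"
  proof -
    have "(LINT r|unit_itv. r powr (2 * real n + 1) * \<omega> r - 2 * (r powr (2 * real (n + 1) + 1) * \<omega> r) + r powr (2 * real (n + 2) + 1) * \<omega> r)
      \<le> (LINT r|unit_itv. 8 / (real n + 1)\<^sup>2 * (r powr real n * \<omega> r))"
    proof (rule integral_unit_itv_mono[OF id])
      fix r :: real assume r: "0 \<le> r" "r < 1"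
      show "r powr (2 * real n + 1) * \<omega> r - 2 * (r powr (2 * real (n + 1) + 1) * \<omega> r) + r powr (2 * real (n + 2) + 1) * \<omega> r
         \<le> 8 / (real n + 1)\<^sup>2 * (r powr real n * \<omega> r)"
        using mult_right_mono[OF power_mult_defect_le(2)[OF r, of n] w0[OF r]]
        by (simp only: left_diff_distrib distrib_right mult.assoc)
    qed (intro integrable_mult_right i3)
    also have "\<dots> = 8 / (real n + 1)\<^sup>2 * mom \<omega> (real n)" unfolding mom_def by (rule integral_mult_right_zero)
    finally show ?thesis unfolding eq .
  qed
  show "0 \<le> mom \<omega> (2 * real n + 1) - 2 * mom \<omega> (2 * real (n + 1) + 1) + mom \<omega> (2 * real (n + 2) + 1)"
    unfolding eq
  proof (rule integral_nonneg_AE, rule AE_I2)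
    fix r assume "r \<in> space unit_itv"
    then have r: "0 \<le> r" "r < 1" by auto
    have "r powr (2 * real (n + 1) + 1) = r powr (2 * real n + 1) * r\<^sup>2"
      "r powr (2 * real (n + 2) + 1) = r powr (2 * real n + 1) * (r\<^sup>2)\<^sup>2"
    proof -
      have "r powr (2 * real (n + 1) + 1) = r powr (2 * real n + 1 + real 2)" by (simp add: algebra_simps)
      then show "r powr (2 * real (n + 1) + 1) = r powr (2 * real n + 1) * r\<^sup>2"
        using r by (cases "r = 0") (simp_all only: powr_add powr_realpow order.strict_iff_order, simp_all)
      have "r powr (2 * real (n + 2) + 1) = r powr (2 * real n + 1 + real 4)" by (simp add: algebra_simps)
      then show "r powr (2 * real (n + 2) + 1) = r powr (2 * real n + 1) * (r\<^sup>2)\<^sup>2"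
        using r by (cases "r = 0") (simp_all only: powr_add powr_realpow order.strict_iff_order, simp_all)
    qed
    then have "r powr (2 * real n + 1) * \<omega> r - 2 * (r powr (2 * real (n + 1) + 1) * \<omega> r) + r powr (2 * real (n + 2) + 1) * \<omega> r
      = r powr (2 * real n + 1) * (1 - r\<^sup>2)\<^sup>2 * \<omega> r"
      by (simp add: algebra_simps power2_eq_square)
    then show "0 \<le> r powr (2 * real n + 1) * \<omega> r - 2 * (r powr (2 * real (n + 1) + 1) * \<omega> r) + r powr (2 * real (n + 2) + 1) * \<omega> r"
      using w0[OF r] by simp
  qed
qed

lemma kernel_coeff_mono: "radial_weight \<omega> \<Longrightarrow> kernel_coeff \<omega> n \<le> kernel_coeff \<omega> (n + 1)"
  unfolding kernel_coeff_def by (intro divide_left_mono mult_left_mono mom_antimono mult_pos_pos mom_pos) auto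

text \<open>Differences of reciprocals are differences of moments over products of moments. The
  numerators are controlled by \<open>mom_differences\<close>, and doubling makes all moments
  involved comparable.\<close>

lemma kernel_coeff_regular:
  assumes wh: "\<omega> \<in> D_hat"
  shows "\<exists>A\<ge>0. \<forall>n. kernel_coeff \<omega> (n + 1) - kernel_coeff \<omega> n \<le> A * kernel_coeff \<omega> n / (real n + 1) \<and>
     \<bar>kernel_coeff \<omega> n - 2 * kernel_coeff \<omega> (n + 1) + kernel_coeff \<omega> (n + 2)\<bar> \<le> A * kernel_coeff \<omega> n / (real n + 1)\<^sup>2 \<and>
     kernel_coeff \<omega> (2 * n + 1) \<le> A * kernel_coeff \<omega> n"
proof -
  have w: "radial_weight \<omega>" using wh by (rule D_hat_radial_weight)
  \<comment> \<open>From order \<open>n\<close> this reaches \<open>4 * n + 5\<close>, at least as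
    large as all orders that occur, in particular \<open>2 * n + 5\<close> and
    \<open>4 * n + 3\<close>.\<close>
  obtain D where D: "0 < D" "\<And>x. 0 \<le> x \<Longrightarrow> mom \<omega> x \<le> D * mom \<omega> (4 * x + 5)"
    using D_hat_mom_doubling[OF wh, of 4 5] by auto
  have D1: "1 \<le> D"
  proof -
    have "mom \<omega> 0 \<le> D * mom \<omega> 5" using D(2)[of 0] by simp
    also have "\<dots> \<le> D * mom \<omega> 0" using D by (intro mult_left_mono mom_antimono w) auto
    finally show ?thesis using mom_pos[OF w, of 0] by simp
  qed
  define A where "A = 16 * D\<^sup>2"
  have "D * 1 \<le> D * D" using D1 by (intro mult_left_mono) auto
  then have AD: "2 * D \<le> A" "D \<le> A" using D1 by (auto simp: A_def power2_eq_square)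
  have main: "kernel_coeff \<omega> (n + 1) - kernel_coeff \<omega> n \<le> A * kernel_coeff \<omega> n / (real n + 1) \<and>
     \<bar>kernel_coeff \<omega> n - 2 * kernel_coeff \<omega> (n + 1) + kernel_coeff \<omega> (n + 2)\<bar> \<le> A * kernel_coeff \<omega> n / (real n + 1)\<^sup>2 \<and>
     kernel_coeff \<omega> (2 * n + 1) \<le> A * kernel_coeff \<omega> n" for n
  proof -
    define k where "k = real n + 1"
    have k: "1 \<le> k" by (simp add: k_def)
    define m0 m1 m2 M m3 where "m0 = mom \<omega> (2 * real n + 1)" and "m1 = mom \<omega> (2 * real (n + 1) + 1)"
      and "m2 = mom \<omega> (2 * real (n + 2) + 1)" and "M = mom \<omega> (real n)" and "m3 = mom \<omega> (2 * real (2 * n + 1) + 1)"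
    note mdefs = m0_def m1_def m2_def M_def m3_def
    have pos: "0 < m0" "0 < m1" "0 < m2" "0 < M" "0 < m3" unfolding mdefs by (intro mom_pos w; simp)+
    have m5: "M \<le> D * mom \<omega> (4 * real n + 5)" unfolding M_def by (rule D) simp
    have ord: "m1 \<le> m0" "m2 \<le> m1" "m0 \<le> M" "mom \<omega> (4 * real n + 5) \<le> m1" "mom \<omega> (4 * real n + 5) \<le> m2" "mom \<omega> (4 * real n + 5) \<le> m3"
      unfolding mdefs by (intro mom_antimono w; simp)+
    have MD: "M \<le> D * m1" "M \<le> D * m2" "M \<le> D * m3"
      using m5 mult_left_mono[OF ord(4), of D] mult_left_mono[OF ord(5), of D] mult_left_mono[OF ord(6), of D] D by linarith+
    define d e where "d = m0 - m1" and "e = m0 - 2 * m1 + m2"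
    have d: "0 \<le> d" "d * k \<le> 2 * M" using ord mom_differences(1)[OF w, of n] k by (auto simp: d_def mdefs k_def field_simps)
    have e: "0 \<le> e" "e * k\<^sup>2 \<le> 8 * M" using mom_differences(2,3)[OF w, of n] k by (auto simp: e_def mdefs k_def field_simps)
    have a: "kernel_coeff \<omega> n = 1 / (2 * m0)" "kernel_coeff \<omega> (n + 1) = 1 / (2 * m1)" "kernel_coeff \<omega> (n + 2) = 1 / (2 * m2)" "kernel_coeff \<omega> (2 * n + 1) = 1 / (2 * m3)"
      unfolding kernel_coeff_def mdefs by simp_all
    have "1 / (2 * m1) - 1 / (2 * m0) = d / (2 * m0 * m1)" using pos by (simp add: d_def field_simps)
    also have "\<dots> \<le> A * (1 / (2 * m0)) / k"
    proof -
      have "d * k \<le> 2 * (D * m1)" using d MD by linarith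
      also have "\<dots> = (2 * D) * m1" by simp
      also have "\<dots> \<le> A * m1" using AD pos by (intro mult_right_mono) auto
      finally show ?thesis using pos k by (simp add: field_simps)
    qed
    finally have 1: "kernel_coeff \<omega> (n + 1) - kernel_coeff \<omega> n \<le> A * kernel_coeff \<omega> n / k" unfolding a .
    have 2: "kernel_coeff \<omega> (2 * n + 1) \<le> A * kernel_coeff \<omega> n"
    proof -
      have "m0 \<le> D * m3" using ord MD by linarith
      also have "\<dots> \<le> A * m3" using AD pos by (intro mult_right_mono) auto
      finally show ?thesis unfolding a using pos by (simp add: field_simps)
    qed
    have "\<bar>1 / (2 * m0) - 2 * (1 / (2 * m1)) + 1 / (2 * m2)\<bar> \<le> A * (1 / (2 * m0)) / k\<^sup>2"
    proof -
      have id: "(1 / (2 * m0) - 2 * (1 / (2 * m1)) + 1 / (2 * m2)) * (2 * m0 * m1 * m2) = m0 * m1 + m1 * m2 - 2 * m0 * m2"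
        using pos by (simp add: field_simps)
      have d2: "0 \<le> m1 - m2" "m1 - m2 \<le> d" using ord(2) e(1) unfolding d_def e_def by linarith+
      \<comment> \<open>The numerator of the second difference of reciprocals, rearranged into
        products of two first differences and one second difference, each of which gains
        \<open>1 / k\<^sup>2\<close>.\<close>
      have "m0 * m1 + m1 * m2 - 2 * m0 * m2 = d * (d + (m1 - m2)) - e * m0"
        by (simp add: d_def e_def algebra_simps)
      moreover have "0 \<le> d * (d + (m1 - m2))" using d d2 by auto
      moreover have "0 \<le> e * m0" using e pos by auto
      ultimately have "\<bar>m0 * m1 + m1 * m2 - 2 * m0 * m2\<bar> \<le> d * (d + (m1 - m2)) + e * m0" by linarith
      also have "\<dots> \<le> d * (2 * d) + e * m0" using d d2 e pos by (intro add_mono mult_left_mono) auto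
      finally have "\<bar>m0 * m1 + m1 * m2 - 2 * m0 * m2\<bar> * k\<^sup>2 \<le> (d * (2 * d) + e * m0) * k\<^sup>2"
        by (rule mult_right_mono) simp
      also have "\<dots> = 2 * ((d * k) * (d * k)) + (e * k\<^sup>2) * m0" by (simp add: algebra_simps power2_eq_square)
      also have "\<dots> \<le> 2 * ((2 * M) * (2 * M)) + (8 * M) * M"
      proof (intro add_mono)
        have "(d * k) * (d * k) \<le> (2 * M) * (2 * M)" by (rule mult_mono) (use d k pos in simp_all)
        then show "2 * ((d * k) * (d * k)) \<le> 2 * ((2 * M) * (2 * M))" by linarith
        show "(e * k\<^sup>2) * m0 \<le> (8 * M) * M" by (rule mult_mono) (use e ord pos in simp_all)
      qed
      also have "\<dots> = 16 * (M * M)" by simp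
      also have "\<dots> \<le> 16 * ((D * m1) * (D * m2))" using MD pos D by (intro mult_left_mono mult_mono) auto
      also have "\<dots> = A * m1 * m2" by (simp add: A_def power2_eq_square)
      finally have b: "\<bar>m0 * m1 + m1 * m2 - 2 * m0 * m2\<bar> * k\<^sup>2 \<le> A * m1 * m2" .
      have P: "0 < 2 * m0 * m1 * m2" using pos by simp
      have "\<bar>1 / (2 * m0) - 2 * (1 / (2 * m1)) + 1 / (2 * m2)\<bar> * (2 * m0 * m1 * m2) = \<bar>m0 * m1 + m1 * m2 - 2 * m0 * m2\<bar>"
        unfolding id[symmetric] abs_mult using pos by simp
      also have "\<dots> \<le> A * m1 * m2 / k\<^sup>2" using b k by (simp add: field_simps)
      also have "\<dots> = A * (1 / (2 * m0)) / k\<^sup>2 * (2 * m0 * m1 * m2)" using pos by (simp add: field_simps)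
      finally show ?thesis using P by (rule mult_right_le_imp_le)
    qed
    then have 3: "\<bar>kernel_coeff \<omega> n - 2 * kernel_coeff \<omega> (n + 1) + kernel_coeff \<omega> (n + 2)\<bar> \<le> A * kernel_coeff \<omega> n / k\<^sup>2" unfolding a .
    show ?thesis using 1 2 3 unfolding k_def by blast
  qed
  have "0 \<le> A" by (simp add: A_def)
  with main show ?thesis by blast
qed

section \<open>Sums of reciprocal tails\<close>

text \<open>Induction on the scale of \<open>X\<close>: passing from \<open>X / K\<close> to \<open>X\<close> halves the tail, so the earlier terms
  contribute at most half of the bound.\<close>

lemma reciprocal_tail_head_sum:
  assumes n: "\<nu> \<in> D_check"
  shows "\<exists>A>0. \<forall>X\<ge>1. (\<Sum>n | real n + 2 \<le> X. 1 / ((real n + 1) * tail \<nu> (1 - 1 / (real n + 2)))) \<le> A / tail \<nu> (1 - 1 / X)"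
proof -
  have w: "radial_weight \<nu>" using n by (rule D_check_radial_weight)
  define h where "h n = 1 / ((real n + 1) * tail \<nu> (1 - 1 / (real n + 2)))" for n
  define T where "T X = tail \<nu> (1 - 1 / X)" for X
  have Tpos: "0 < T X" if "1 \<le> X" for X using that unfolding T_def by (intro tail_pos w) auto
  have Tmono: "T Y \<le> T X" if "1 \<le> X" "X \<le> Y" for X Y
    using that unfolding T_def by (intro tail_antimono w) (auto simp: frac_le)
  obtain K r0 where K: "1 < K" "0 \<le> r0" "r0 < 1"
    "\<And>r. r0 < r \<Longrightarrow> r < 1 \<Longrightarrow> tail \<nu> (1 - (1 - r) / K) \<le> 1 / 2 * tail \<nu> r"
    using D_check_iterate[OF n, of "1 / 2"] by auto
  define X0 where "X0 = 1 / (1 - r0) + 1"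
  have X0: "1 < X0" using K by (auto simp: X0_def)
  have TK: "T (K * X) \<le> 1 / 2 * T X" if "X0 \<le> X" for X
  proof -
    have x: "1 < X" using that X0 by linarith
    have x2: "1 / (1 - r0) < X" using that unfolding X0_def by linarith
    have "1 < X * (1 - r0)" using x2 K(3) by (simp add: field_simps)
    then have "1 / X < 1 - r0" using x by (simp add: field_simps)
    then have "r0 < 1 - 1 / X" "1 - 1 / X < 1" using x by auto
    then have "tail \<nu> (1 - (1 - (1 - 1 / X)) / K) \<le> 1 / 2 * tail \<nu> (1 - 1 / X)" by (rule K(4))
    then show ?thesis by (simp add: T_def mult.commute)
  qed
  define X1 where "X1 = K * X0"
  have X1: "1 < X1" using K(1) X0 unfolding X1_def by (metis less_1_mult)
  have fin: "finite {n. real n + 2 \<le> X}" for X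
  proof (rule finite_subset)
    show "{n. real n + 2 \<le> X} \<subseteq> {..nat \<lceil>X\<rceil>}" by (auto simp: nat_le_iff) linarith
  qed simp
  have hle: "h n \<le> 1 / ((real n + 1) * T X)" if "real n + 2 \<le> X" for n X
  proof -
    have "T X \<le> T (real n + 2)" using that by (intro Tmono) auto
    then have "(real n + 1) * T X \<le> (real n + 1) * T (real n + 2)" by (intro mult_left_mono) auto
    then show ?thesis unfolding h_def T_def[of "real n + 2", symmetric]
      using Tpos[of X] that Tpos[of "real n + 2"] by (intro divide_left_mono) auto
  qed
  have h0: "0 \<le> h n" for n
    using Tpos[of "real n + 2"] by (simp add: h_def T_def)
  define S where "S X = sum h {n. real n + 2 \<le> X}" for X
  have card: "real (card {n. real n + 2 \<le> X}) \<le> X" if "0 \<le> X" for X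
  proof -
    have "card {n. real n + 2 \<le> X} \<le> card {..<nat \<lfloor>X\<rfloor>}"
    proof (rule card_mono, simp, rule subsetI)
      fix n assume "n \<in> {n. real n + 2 \<le> X}"
      then have "real (n + 1) \<le> X" by simp
      then have "n + 1 \<le> nat \<lfloor>X\<rfloor>" by (rule le_nat_floor)
      then show "n \<in> {..<nat \<lfloor>X\<rfloor>}" by simp
    qed
    also have "\<dots> = nat \<lfloor>X\<rfloor>" by simp
    finally have "real (card {n. real n + 2 \<le> X}) \<le> real (nat \<lfloor>X\<rfloor>)" by simp
    also have "\<dots> \<le> X" using that by (simp add: of_nat_nat)
    finally show ?thesis .
  qed
  \<comment> \<open>\<open>4 * K\<close> makes the last block, which is at most
    \<open>2 * K / T X\<close>, fit into half of the bound; the other half is left for the earlier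
    terms. The second entry settles the base range \<open>X \<le> X1\<close>.\<close>
  define A where "A = max (4 * K) (X1 * T 1 / T X1)"
  have A: "4 * K \<le> A" "X1 * T 1 / T X1 \<le> A" "0 < A" using K(1) by (auto simp: A_def less_max_iff_disj)
  have main: "S X \<le> A / T X" if "1 \<le> X" "X \<le> K ^ k * X1" for X k
    using that
  proof (induction k arbitrary: X)
    case 0
    have "S X \<le> (\<Sum>n | real n + 2 \<le> X. 1 / T X1)"
      unfolding S_def
    proof (rule sum_mono)
      fix n assume "n \<in> {n. real n + 2 \<le> X}"
      then have "h n \<le> 1 / ((real n + 1) * T X1)" using 0 by (intro hle) auto
      also have "\<dots> \<le> 1 / (1 * T X1)" using Tpos[of X1] X1 by (intro divide_left_mono mult_right_mono) auto
      finally show "h n \<le> 1 / T X1" by simp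
    qed
    also have "\<dots> = real (card {n. real n + 2 \<le> X}) * (1 / T X1)" by simp
    also have "\<dots> \<le> X1 * (1 / T X1)" using card[of X] 0 Tpos[of X1] X1 by (intro mult_right_mono) auto
    also have "\<dots> = X1 * T 1 / T X1 / T 1" using Tpos[of 1] by simp
    also have "\<dots> \<le> A / T 1" using A Tpos[of 1] by (intro divide_right_mono) auto
    also have "\<dots> \<le> A / T X" using A Tpos[of X] Tpos[of 1] Tmono[of 1 X] 0 by (intro divide_left_mono) auto
    finally show ?case .
  next
    case (Suc k)
    show ?case
    proof (cases "X \<le> X1")
      case True
      have "1 * X1 \<le> K ^ k * X1" using K(1) X1 by (intro mult_right_mono) auto
      then have "X \<le> K ^ k * X1" using True by linarith
      then show ?thesis using Suc.IH[of X] Suc.prems(1) by blast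
    next
      case False
      define Y where "Y = X / K"
      have Y: "X0 \<le> Y" "X = K * Y" using False K(1) by (auto simp: Y_def X1_def field_simps)
      have Y1: "1 < Y" "Y \<le> X" using Y X0 K(1) by (auto simp: mult_le_cancel_right1)
      have Yk: "Y \<le> K ^ k * X1" using Suc.prems K(1) by (simp add: Y_def field_simps)
      have dis: "{n. real n + 2 \<le> X} = {n. real n + 2 \<le> Y} \<union> {n. Y < real n + 2 \<and> real n + 2 \<le> X}"
        using Y1 by auto
      have fin2: "finite {n. Y < real n + 2 \<and> real n + 2 \<le> X}" by (rule finite_subset[OF _ fin[of X]]) auto
      have "S X = S Y + sum h {n. Y < real n + 2 \<and> real n + 2 \<le> X}"
        unfolding S_def dis by (rule sum.union_disjoint) (use fin fin2 in auto)
      also have "S Y \<le> A / T Y" using Suc.IH[OF _ Yk] Y1 by simp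
      also have "A / T Y \<le> A / 2 / T X"
        using TK[OF Y(1)] Tpos[of Y] Tpos[of X] Y1 A Y(2) by (simp add: field_simps)
      also have "sum h {n. Y < real n + 2 \<and> real n + 2 \<le> X} \<le> (\<Sum>n | Y < real n + 2 \<and> real n + 2 \<le> X. 2 / (Y * T X))"
      proof (rule sum_mono)
        fix n assume nn: "n \<in> {n. Y < real n + 2 \<and> real n + 2 \<le> X}"
        then have "h n \<le> 1 / ((real n + 1) * T X)" by (intro hle) auto
        also have "\<dots> \<le> 1 / ((Y / 2) * T X)"
          using nn Tpos[of X] Y1 by (intro divide_left_mono mult_right_mono mult_pos_pos) auto
        finally show "h n \<le> 2 / (Y * T X)" by simp
      qed
      also have "\<dots> = real (card {n. Y < real n + 2 \<and> real n + 2 \<le> X}) * (2 / (Y * T X))" by simp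
      also have "\<dots> \<le> X * (2 / (Y * T X))"
      proof (rule mult_right_mono)
        have "card {n. Y < real n + 2 \<and> real n + 2 \<le> X} \<le> card {n. real n + 2 \<le> X}"
          by (rule card_mono[OF fin]) auto
        then show "real (card {n. Y < real n + 2 \<and> real n + 2 \<le> X}) \<le> X" using card[of X] Y1 by linarith
      qed (use Tpos[of X] Y1 in auto)
      also have "\<dots> = 2 * K / T X" using Y Y1 by simp
      also have "\<dots> \<le> A / 2 / T X" using A Tpos[of X] Y1 by (intro divide_right_mono) auto
      finally show ?thesis by simp
    qed
  qed
  have ex: "\<exists>k. X \<le> K ^ k * X1" for X
  proof -
    obtain k where "X / X1 < K ^ k" using real_arch_pow[OF K(1)] by blast
    then show ?thesis using X1 by (intro exI[of _ k]) (auto simp: field_simps)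
  qed
  show ?thesis
  proof (intro exI[of _ A] conjI allI impI A)
    fix X :: real assume "1 \<le> X"
    then show "(\<Sum>n | real n + 2 \<le> X. 1 / ((real n + 1) * tail \<nu> (1 - 1 / (real n + 2)))) \<le> A / tail \<nu> (1 - 1 / X)"
      using main ex unfolding S_def h_def T_def by blast
  qed
qed

text \<open>With \<open>u = 1 - t\<close>, the terms up to \<open>1 / u\<close> are dominated by the
  last ones, by \<open>reciprocal_tail_head_sum\<close>. Beyond that, doubling lets the reciprocal
  tail grow only polynomially in \<open>u * n\<close>, and the exponential decay of
  \<open>t ^ n\<close> on the same scale wins.\<close>

lemma reciprocal_tail_sum:
  assumes n: "\<nu> \<in> D_hat" "\<nu> \<in> D_check"
  shows "\<exists>A>0. \<forall>t. 0 \<le> t \<and> t < 1 \<longrightarrow>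
     summable (\<lambda>n. t ^ n / ((real n + 1) * tail \<nu> (1 - 1 / (real n + 2)))) \<and>
     (\<Sum>n. t ^ n / ((real n + 1) * tail \<nu> (1 - 1 / (real n + 2)))) \<le> A / tail \<nu> t"
proof -
  have w: "radial_weight \<nu>" using n by (auto intro: D_hat_radial_weight)
  obtain A where A: "0 < A" "\<And>X. 1 \<le> X \<Longrightarrow> (\<Sum>n | real n + 2 \<le> X. 1 / ((real n + 1) * tail \<nu> (1 - 1 / (real n + 2)))) \<le> A / tail \<nu> (1 - 1 / X)"
    using reciprocal_tail_head_sum[OF n(2)] by blast
  obtain C \<beta> where C: "1 \<le> C" "\<And>u v. 0 < v \<Longrightarrow> v \<le> u \<Longrightarrow> u \<le> 1 \<Longrightarrow> tail \<nu> (1 - u) \<le> C * (u / v) ^ \<beta> * tail \<nu> (1 - v)"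
    using D_hat_poly[OF n(1)] by blast
  obtain D where D: "1 \<le> D" "\<And>u::real. 0 \<le> u \<Longrightarrow> u ^ \<beta> \<le> D * exp (1 / 2 * u)"
    using power_le_exp[of "1/2 :: real" \<beta>] by auto
  define B where "B = A + 8 * C * D * exp 1"
  have "summable (\<lambda>n. t ^ n / ((real n + 1) * tail \<nu> (1 - 1 / (real n + 2)))) \<and>
     (\<Sum>n. t ^ n / ((real n + 1) * tail \<nu> (1 - 1 / (real n + 2)))) \<le> B / tail \<nu> t" if t: "0 \<le> t" "t < 1" for t
  proof -
    define u where "u = 1 - t"
    have u: "0 < u" "u \<le> 1" "t = 1 - u" using t by (auto simp: u_def)
    \<comment> \<open>\<open>t ^ n\<close> decays at least like \<open>exp (- u * n)\<close>; half
      of this rate compensates the polynomial growth, and \<open>q\<close> keeps the other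
      half.\<close>
    define q where "q = exp (- (u / 2))"
    have q: "0 < q" "q < 1" using u by (auto simp: q_def)
    have nt: "0 < tail \<nu> t" by (rule tail_pos[OF w t])
    define h where "h n = 1 / ((real n + 1) * tail \<nu> (1 - 1 / (real n + 2)))" for n
    have ntn: "0 < tail \<nu> (1 - 1 / (real n + 2))" for n by (intro tail_pos w) auto
    have h0: "0 \<le> h n" for n using ntn[of n] by (simp add: h_def)
    define c where "c = 2 * C * D * exp 1 / tail \<nu> t * u"
    have c0: "0 \<le> c" using C D nt u by (simp add: c_def)
    have trm: "t ^ n * h n \<le> (if real n + 2 \<le> 1 / u then h n else 0) + c * q ^ n" for n
    proof (cases "real n + 2 \<le> 1 / u")
      case True
      have "t ^ n * h n \<le> 1 * h n" using t h0 by (intro mult_right_mono power_le_one) auto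
      moreover have "0 \<le> c * q ^ n" using c0 q by simp
      ultimately show ?thesis using True by simp
    next
      case False
      define N where "N = real n + 2"
      have N: "2 \<le> N" "1 / u < N" using False by (auto simp: N_def)
      have Nu: "1 < u * N" using N(2) u by (simp add: field_simps)
      have vu: "1 / N \<le> u" using Nu N(1) by (simp add: field_simps)
      have "tail \<nu> t \<le> C * (u / (1 / N)) ^ \<beta> * tail \<nu> (1 - 1 / N)"
        using C(2)[of "1 / N" u] u vu N by simp
      also have "\<dots> \<le> C * (D * exp (1 / 2 * (u * N))) * tail \<nu> (1 - 1 / N)"
        using D(2)[of "u * N"] Nu C ntn[of n] by (intro mult_right_mono mult_left_mono) (auto simp: N_def)
      finally have T: "tail \<nu> t \<le> C * D * exp (1 / 2 * (u * N)) * tail \<nu> (1 - 1 / N)" by (simp add: mult_ac)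
      have tn: "t ^ n \<le> exp (- (u * real n))"
      proof -
        have "t \<le> exp (- u)" using exp_ge_add_one_self[of "- u"] u by simp
        then have "t ^ n \<le> exp (- u) ^ n" using t by (intro power_mono)
        then show ?thesis by (simp add: mult_ac flip: exp_of_nat_mult)
      qed
      have "1 / (real n + 1) \<le> 2 / N" by (simp add: N_def field_simps)
      also have "\<dots> \<le> 2 * u" using vu by simp
      finally have n1: "1 / (real n + 1) \<le> 2 * u" .
      have "h n = 1 / (real n + 1) * (1 / tail \<nu> (1 - 1 / N))" by (simp add: h_def N_def)
      also have "\<dots> \<le> 2 * u * (C * D * exp (1 / 2 * (u * N)) / tail \<nu> t)"
      proof (rule mult_mono[OF n1])
        show "1 / tail \<nu> (1 - 1 / N) \<le> C * D * exp (1 / 2 * (u * N)) / tail \<nu> t"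
          using T ntn[of n] nt by (simp add: N_def field_simps)
      qed (use u ntn[of n] in \<open>auto simp: N_def less_imp_le\<close>)
      finally have hn: "h n \<le> 2 * u * (C * D * exp (1 / 2 * (u * N)) / tail \<nu> t)" .
      have "t ^ n * h n \<le> exp (- (u * real n)) * (2 * u * (C * D * exp (1 / 2 * (u * N)) / tail \<nu> t))"
        using tn hn h0 by (intro mult_mono) auto
      also have "\<dots> = 2 * C * D / tail \<nu> t * u * (exp (- (u * real n)) * exp (1 / 2 * (u * N)))" by simp
      also have "exp (- (u * real n)) * exp (1 / 2 * (u * N)) = exp u * q ^ n"
      proof -
        have "- (u * real n) + 1 / 2 * (u * N) = u + real n * (- (u / 2))" by (simp add: N_def algebra_simps)
        then show ?thesis unfolding q_def by (simp only: exp_add[symmetric] exp_of_nat_mult[symmetric])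
      qed
      also have "2 * C * D / tail \<nu> t * u * (exp u * q ^ n) \<le> 2 * C * D / tail \<nu> t * u * (exp 1 * q ^ n)"
        using u C D nt q by (intro mult_left_mono mult_right_mono) auto
      also have "\<dots> = c * q ^ n" by (simp add: c_def)
      finally show ?thesis using False by simp
    qed
    have fin: "finite {n. real n + 2 \<le> 1 / u}"
    proof (rule finite_subset)
      show "{n. real n + 2 \<le> 1 / u} \<subseteq> {..nat \<lceil>1 / u\<rceil>}" by (auto simp: nat_le_iff) linarith
    qed simp
    have geo: "(\<Sum>n<m. q ^ n) \<le> 4 / u" for m
    proof -
      have "(\<Sum>n<m. q ^ n) = (1 - q ^ m) / (1 - q)" using q by (simp add: sum_gp_strict)
      also have "\<dots> \<le> 1 / (1 - q)" using q by (intro divide_right_mono) auto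
      also have "\<dots> \<le> 4 / u"
      proof -
        have "1 + u / 2 \<le> exp (u / 2)" by (rule exp_ge_add_one_self)
        then have "q \<le> 1 / (1 + u / 2)" using u by (simp add: q_def exp_minus field_simps)
        also have "\<dots> \<le> 1 - u / 4"
        proof -
          have "u * u \<le> u * 1" using u by (intro mult_left_mono) auto
          then show ?thesis using u by (simp add: field_simps)
        qed
        finally show ?thesis using u q by (simp add: field_simps)
      qed
      finally show ?thesis .
    qed
    have part: "(\<Sum>n<m. t ^ n * h n) \<le> B / tail \<nu> t" for m
    proof -
      have "(\<Sum>n<m. t ^ n * h n) \<le> (\<Sum>n<m. (if real n + 2 \<le> 1 / u then h n else 0) + c * q ^ n)"
        by (intro sum_mono trm)
      also have "\<dots> = (\<Sum>n<m. (if real n + 2 \<le> 1 / u then h n else 0)) + c * (\<Sum>n<m. q ^ n)"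
        by (simp add: sum.distrib sum_distrib_left)
      also have "(\<Sum>n<m. (if real n + 2 \<le> 1 / u then h n else 0)) = sum h {n\<in>{..<m}. real n + 2 \<le> 1 / u}"
        by (rule sum.inter_filter[symmetric]) simp
      also have "\<dots> \<le> sum h {n. real n + 2 \<le> 1 / u}"
        by (rule sum_mono2[OF fin]) (use h0 in auto)
      also have "\<dots> \<le> A / tail \<nu> (1 - 1 / (1 / u))" unfolding h_def using u by (intro A) auto
      also have "1 - 1 / (1 / u) = t" by (simp add: u)
      also have "c * (\<Sum>n<m. q ^ n) \<le> c * (4 / u)" by (intro mult_left_mono geo c0)
      also have "c * (4 / u) = 8 * C * D * exp 1 / tail \<nu> t" using u by (simp add: c_def)
      finally show ?thesis by (simp add: B_def add_divide_distrib)
    qed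
    have sm: "summable (\<lambda>n. t ^ n * h n)"
      by (rule summableI_nonneg_bounded[OF _ part]) (use t h0 in simp)
    moreover have "(\<Sum>n. t ^ n * h n) \<le> B / tail \<nu> t" using sm part by (rule suminf_le_const)
    moreover have "(\<lambda>n. t ^ n * h n) = (\<lambda>n. t ^ n / ((real n + 1) * tail \<nu> (1 - 1 / (real n + 2))))"
      by (simp add: h_def)
    ultimately show ?thesis by simp
  qed
  moreover have "0 < B" using A C D by (simp add: B_def add_pos_nonneg)
  ultimately show ?thesis by blast
qed

section \<open>The projection as a power series\<close>

lemma bergman_kernel_borel [measurable]: "bergman_kernel \<omega> z \<in> borel_measurable borel"
  unfolding bergman_kernel_def[abs_def] by measurable

lemma borel_measurable_disc:
  fixes f :: "complex \<Rightarrow> 'a :: topological_space"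
  assumes "f \<in> borel_measurable borel"
  shows "f \<in> borel_measurable (lebesgue_on unit_disc)"
  using assms by (simp add: measurable_completion measurable_restrict_space1)

lemma disc_radial_measurable:
  assumes "g \<in> borel_measurable unit_itv"
  shows "(\<lambda>\<zeta>. g (cmod \<zeta>)) \<in> borel_measurable (lebesgue_on unit_disc)"
  by (rule measurable_compose[OF cmod_measurable_disc assms])

lemma radial_weight_measurable: "radial_weight \<omega> \<Longrightarrow> \<omega> \<in> borel_measurable unit_itv"
  by (intro borel_measurable_integrable radial_weight_integrable)

lemma mom_disc_integral:
  assumes s: "radial_weight \<sigma>" and x: "0 \<le> x"
  shows "has_bochner_integral (lebesgue_on unit_disc) (\<lambda>\<zeta>. cmod \<zeta> powr x * \<sigma> (cmod \<zeta>)) (2 * pi * mom \<sigma> (x + 1))"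
proof (rule has_bochner_integral_nn_integral)
  have m: "(\<lambda>r. r powr x * \<sigma> r) \<in> borel_measurable unit_itv"
    by (rule borel_measurable_integrable[OF mom_integrable[OF s x]])
  show "(\<lambda>\<zeta>. cmod \<zeta> powr x * \<sigma> (cmod \<zeta>)) \<in> borel_measurable (lebesgue_on unit_disc)"
    by (rule disc_radial_measurable[OF m])
  show "AE \<zeta> in lebesgue_on unit_disc. 0 \<le> cmod \<zeta> powr x * \<sigma> (cmod \<zeta>)"
    using s by (intro AE_I2 mult_nonneg_nonneg) (auto intro: radial_weight_nonneg)
  show "0 \<le> 2 * pi * mom \<sigma> (x + 1)" using mom_pos[OF s, of "x + 1"] x by simp
  have "(\<integral>\<^sup>+\<zeta>. ennreal (cmod \<zeta> powr x * \<sigma> (cmod \<zeta>)) \<partial>lebesgue_on unit_disc) =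
    (\<integral>\<^sup>+r. ennreal (2 * pi * r) * ennreal (r powr x * \<sigma> r) \<partial>unit_itv)"
    using m by (intro nn_integral_disc_radial) simp
  also have "\<dots> = (\<integral>\<^sup>+r. ennreal (2 * pi) * ennreal (r powr (x + 1) * \<sigma> r) \<partial>unit_itv)"
  proof (rule nn_integral_cong)
    fix r assume "r \<in> space unit_itv"
    then have r: "0 \<le> r" "r < 1" by auto
    then have "2 * pi * r * (r powr x * \<sigma> r) = 2 * pi * (r powr (x + 1) * \<sigma> r)"
      by (simp add: powr_add)
    then show "ennreal (2 * pi * r) * ennreal (r powr x * \<sigma> r) = ennreal (2 * pi) * ennreal (r powr (x + 1) * \<sigma> r)"
      using r radial_weight_nonneg[OF s r] by (simp flip: ennreal_mult)
  qed
  also have "\<dots> = ennreal (2 * pi) * moment \<sigma> (x + 1)"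
    unfolding moment_def using borel_measurable_integrable[OF mom_integrable[OF s, of "x + 1"]] x
    by (intro nn_integral_cmult) simp
  also have "\<dots> = ennreal (2 * pi * mom \<sigma> (x + 1))"
    using x mom_pos[OF s, of "x + 1"] by (simp add: moment_eq_mom[OF s] flip: ennreal_mult)
  finally show "(\<integral>\<^sup>+\<zeta>. ennreal (cmod \<zeta> powr x * \<sigma> (cmod \<zeta>)) \<partial>lebesgue_on unit_disc) = ennreal (2 * pi * mom \<sigma> (x + 1))" .
qed

lemma radial_disc_integrable:
  assumes s: "radial_weight \<sigma>"
  shows "integrable (lebesgue_on unit_disc) (\<lambda>\<zeta>. \<sigma> (cmod \<zeta>))"
proof (rule integrableI_nonneg)
  have m: "\<sigma> \<in> borel_measurable unit_itv" by (rule radial_weight_measurable[OF s])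
  show "(\<lambda>\<zeta>. \<sigma> (cmod \<zeta>)) \<in> borel_measurable (lebesgue_on unit_disc)"
    by (rule disc_radial_measurable[OF m])
  show "AE \<zeta> in lebesgue_on unit_disc. 0 \<le> \<sigma> (cmod \<zeta>)"
    using s by (intro AE_I2) (auto intro: radial_weight_nonneg)
  have "(\<integral>\<^sup>+\<zeta>. ennreal (\<sigma> (cmod \<zeta>)) \<partial>lebesgue_on unit_disc) = (\<integral>\<^sup>+r. ennreal (2 * pi * r) * ennreal (\<sigma> r) \<partial>unit_itv)"
    using m by (intro nn_integral_disc_radial) simp
  also have "\<dots> \<le> (\<integral>\<^sup>+r. ennreal (2 * pi) * ennreal (\<sigma> r) \<partial>unit_itv)"
    by (intro nn_integral_mono mult_right_mono ennreal_leI) auto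
  also have "\<dots> = ennreal (2 * pi) * (\<integral>\<^sup>+r. ennreal (\<sigma> r) \<partial>unit_itv)"
    using m by (intro nn_integral_cmult) simp
  also have "\<dots> = ennreal (2 * pi) * ennreal (mom \<sigma> 0)"
    using moment_eq_mom[OF s, of 0] by (simp add: moment_0)
  also have "\<dots> < \<infinity>" by (simp add: ennreal_mult_less_top)
  finally show "(\<integral>\<^sup>+\<zeta>. ennreal (\<sigma> (cmod \<zeta>)) \<partial>lebesgue_on unit_disc) < \<infinity>" .
qed

lemma bergman_integrand_sums:
  assumes w: "radial_weight \<omega>" and z: "z \<in> unit_disc" "\<zeta> \<in> unit_disc"
  shows "(\<lambda>n. complex_of_real (kernel_coeff \<omega> n) * z ^ n * (f \<zeta> * cnj \<zeta> ^ n * complex_of_real (\<omega> (cmod \<zeta>)))) sums bergman_integrand \<omega> f z \<zeta>"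
    and "summable (\<lambda>n. kernel_coeff \<omega> n * (cmod z * cmod \<zeta>) ^ n)"
proof -
  have "cmod z * cmod \<zeta> \<le> cmod z * 1" using z by (intro mult_left_mono) auto
  then have zz: "cmod z * cmod \<zeta> < 1" using z by simp
  show sm: "summable (\<lambda>n. kernel_coeff \<omega> n * (cmod z * cmod \<zeta>) ^ n)"
    by (rule kernel_coeff_summable[OF w _ zz]) simp
  have "summable (\<lambda>n. complex_of_real (kernel_coeff \<omega> n) * (cnj z * \<zeta>) ^ n)"
    by (rule summable_norm_cancel)
       (use sm less_imp_le[OF kernel_coeff_pos[OF w]] in \<open>simp add: norm_mult norm_power\<close>)
  then have "(\<lambda>n. complex_of_real (kernel_coeff \<omega> n) * (cnj z * \<zeta>) ^ n) sums bergman_kernel \<omega> z \<zeta>"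
    unfolding bergman_kernel_eq[OF w] by (rule summable_sums)
  then have "(\<lambda>n. cnj (complex_of_real (kernel_coeff \<omega> n) * (cnj z * \<zeta>) ^ n)) sums cnj (bergman_kernel \<omega> z \<zeta>)"
    by (simp only: sums_cnj)
  then have "(\<lambda>n. (f \<zeta> * complex_of_real (\<omega> (cmod \<zeta>))) * cnj (complex_of_real (kernel_coeff \<omega> n) * (cnj z * \<zeta>) ^ n)) sums
    ((f \<zeta> * complex_of_real (\<omega> (cmod \<zeta>))) * cnj (bergman_kernel \<omega> z \<zeta>))"
    by (rule sums_mult)
  then show "(\<lambda>n. complex_of_real (kernel_coeff \<omega> n) * z ^ n * (f \<zeta> * cnj \<zeta> ^ n * complex_of_real (\<omega> (cmod \<zeta>)))) sums bergman_integrand \<omega> f z \<zeta>"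
    by (simp add: bergman_integrand_def power_mult_distrib mult_ac)
qed

text \<open>Termwise integration is justified by the integrable majorant \<open>K * \<sigma>\<close>
  of all \<open>f \<zeta> * cnj \<zeta> ^ n * \<omega>\<close>, together with the summability of the
  coefficients against \<open>cmod z ^ n\<close>. The expansion gives holomorphy in the sufficiency
  part and the exact value at a point in the necessity part.\<close>

lemma bergman_projection_sums:
  fixes f :: "complex \<Rightarrow> complex"
  assumes w: "radial_weight \<omega>" and n: "radial_weight \<nu>" and s: "radial_weight (\<lambda>r. \<omega> r / tail \<nu> r)"
    and f: "f \<in> borel_measurable (lebesgue_on unit_disc)"
    and K: "AE \<zeta> in lebesgue_on unit_disc. cmod (f \<zeta>) * tail \<nu> (cmod \<zeta>) \<le> K" and z: "z \<in> unit_disc"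
  shows "integrable (lebesgue_on unit_disc) (bergman_integrand \<omega> f z)"
    and "(\<lambda>n. complex_of_real (kernel_coeff \<omega> n / pi) * (LINT \<zeta>|lebesgue_on unit_disc. f \<zeta> * cnj \<zeta> ^ n * complex_of_real (\<omega> (cmod \<zeta>))) * z ^ n)
      sums bergman_projection \<omega> f z"
proof -
  let ?D = "lebesgue_on unit_disc"
  let ?\<sigma> = "\<lambda>r. \<omega> r / tail \<nu> r"
  let ?g = "\<lambda>n \<zeta>. f \<zeta> * cnj \<zeta> ^ n * complex_of_real (\<omega> (cmod \<zeta>))"
  let ?F = "\<lambda>n \<zeta>. complex_of_real (kernel_coeff \<omega> n) * z ^ n * ?g n \<zeta>"
  have a0: "0 \<le> kernel_coeff \<omega> n" for n using kernel_coeff_pos[OF w, of n] by simp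
  have z1: "0 \<le> cmod z" "cmod z < 1" using z by auto
  have iS: "integrable ?D (\<lambda>\<zeta>. K * ?\<sigma> (cmod \<zeta>))"
    by (intro integrable_mult_right radial_disc_integrable s)
  have gm: "?g n \<in> borel_measurable ?D" for n
  proof (intro borel_measurable_times f)
    show "(\<lambda>\<zeta>. cnj \<zeta> ^ n) \<in> borel_measurable ?D"
      by (rule borel_measurable_disc) (intro borel_measurable_continuous_onI continuous_intros)
    show "(\<lambda>\<zeta>. complex_of_real (\<omega> (cmod \<zeta>))) \<in> borel_measurable ?D"
      using disc_radial_measurable[OF radial_weight_measurable[OF w]] by simp
  qed
  have gb: "AE \<zeta> in ?D. norm (?g n \<zeta>) \<le> K * ?\<sigma> (cmod \<zeta>)" for n
    using K
  proof (rule AE_mp, intro AE_I2 impI)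
    fix \<zeta> assume "\<zeta> \<in> space ?D" and K: "cmod (f \<zeta>) * tail \<nu> (cmod \<zeta>) \<le> K"
    then have r: "0 \<le> cmod \<zeta>" "cmod \<zeta> < 1" by auto
    have t: "0 < tail \<nu> (cmod \<zeta>)" by (rule tail_pos[OF n r])
    have o: "0 \<le> \<omega> (cmod \<zeta>)" by (rule radial_weight_nonneg[OF w r])
    have "norm (?g n \<zeta>) = cmod (f \<zeta>) * cmod \<zeta> ^ n * \<omega> (cmod \<zeta>)"
      using o by (simp add: norm_mult norm_power)
    also have "\<dots> \<le> cmod (f \<zeta>) * 1 * \<omega> (cmod \<zeta>)"
      using o r by (intro mult_right_mono mult_left_mono power_le_one) auto
    also have "\<dots> = (cmod (f \<zeta>) * tail \<nu> (cmod \<zeta>)) * ?\<sigma> (cmod \<zeta>)" using t by simp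
    also have "\<dots> \<le> K * ?\<sigma> (cmod \<zeta>)" using K o t by (intro mult_right_mono) auto
    finally show "norm (?g n \<zeta>) \<le> K * ?\<sigma> (cmod \<zeta>)" .
  qed
  have ig: "integrable ?D (?g n)" for n
  proof (rule Bochner_Integration.integrable_bound[OF iS gm])
    show "AE \<zeta> in ?D. norm (?g n \<zeta>) \<le> norm (K * ?\<sigma> (cmod \<zeta>))"
      using gb[of n] by eventually_elim (erule order_trans, simp only: real_norm_def abs_ge_self)
  qed
  have iF: "integrable ?D (?F n)" for n by (intro integrable_mult_right ig)
  have nF: "(\<integral>\<zeta>. norm (?F n \<zeta>) \<partial>?D) \<le> kernel_coeff \<omega> n * cmod z ^ n * (\<integral>\<zeta>. K * ?\<sigma> (cmod \<zeta>) \<partial>?D)" for n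
  proof -
    have "(\<integral>\<zeta>. norm (?F n \<zeta>) \<partial>?D) = (\<integral>\<zeta>. kernel_coeff \<omega> n * cmod z ^ n * norm (?g n \<zeta>) \<partial>?D)"
      using a0[of n] by (intro Bochner_Integration.integral_cong) (simp_all add: norm_mult norm_power)
    also have "\<dots> = kernel_coeff \<omega> n * cmod z ^ n * (\<integral>\<zeta>. norm (?g n \<zeta>) \<partial>?D)"
      by (rule integral_mult_right_zero)
    also have "\<dots> \<le> kernel_coeff \<omega> n * cmod z ^ n * (\<integral>\<zeta>. K * ?\<sigma> (cmod \<zeta>) \<partial>?D)"
      using a0[of n] by (intro mult_left_mono integral_mono_AE integrable_norm ig iS gb) auto
    finally show ?thesis .
  qed
  have "summable (\<lambda>n. kernel_coeff \<omega> n * cmod z ^ n * (\<integral>\<zeta>. K * ?\<sigma> (cmod \<zeta>) \<partial>?D))"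
    by (intro summable_mult2 kernel_coeff_summable w z1)
  then have s2: "summable (\<lambda>n. \<integral>\<zeta>. norm (?F n \<zeta>) \<partial>?D)"
    by (rule summable_comparison_test'[of _ 0]) (use nF in \<open>simp add: integral_nonneg_AE\<close>)
  have s1: "AE \<zeta> in ?D. summable (\<lambda>n. norm (?F n \<zeta>))"
  proof (rule AE_I2)
    fix \<zeta> assume "\<zeta> \<in> space ?D"
    then have zeta: "\<zeta> \<in> unit_disc" by simp
    have "(\<lambda>n. norm (?F n \<zeta>)) = (\<lambda>n. (kernel_coeff \<omega> n * (cmod z * cmod \<zeta>) ^ n) * (cmod (f \<zeta>) * \<bar>\<omega> (cmod \<zeta>)\<bar>))"
      using a0 by (auto simp: fun_eq_iff norm_mult norm_power power_mult_distrib)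
    then show "summable (\<lambda>n. norm (?F n \<zeta>))"
      using summable_mult2[OF bergman_integrand_sums(2)[OF w z zeta]] by simp
  qed
  have eq: "(\<Sum>n. ?F n \<zeta>) = bergman_integrand \<omega> f z \<zeta>" if "\<zeta> \<in> space ?D" for \<zeta>
    using bergman_integrand_sums(1)[OF w z, of \<zeta> f] that by (simp add: sums_iff)
  have "integrable ?D (\<lambda>\<zeta>. \<Sum>n. ?F n \<zeta>)" by (rule integrable_suminf[OF iF s1 s2])
  then show "integrable ?D (bergman_integrand \<omega> f z)"
    by (subst Bochner_Integration.integrable_cong[OF refl eq[symmetric]])
  have "(\<lambda>n. integral\<^sup>L ?D (?F n)) sums (\<integral>\<zeta>. (\<Sum>n. ?F n \<zeta>) \<partial>?D)" by (rule sums_integral[OF iF s1 s2])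
  also have "(\<integral>\<zeta>. (\<Sum>n. ?F n \<zeta>) \<partial>?D) = (\<integral>\<zeta>. bergman_integrand \<omega> f z \<zeta> \<partial>?D)"
    by (rule Bochner_Integration.integral_cong[OF refl eq])
  finally have "(\<lambda>n. complex_of_real (1 / pi) * integral\<^sup>L ?D (?F n)) sums bergman_projection \<omega> f z"
    unfolding bergman_projection_def by (rule sums_mult)
  also have "(\<lambda>n. complex_of_real (1 / pi) * integral\<^sup>L ?D (?F n)) = (\<lambda>n. complex_of_real (kernel_coeff \<omega> n / pi) * integral\<^sup>L ?D (?g n) * z ^ n)"
    by (intro ext, subst integral_mult_right_zero) simp
  finally show "(\<lambda>n. complex_of_real (kernel_coeff \<omega> n / pi) * integral\<^sup>L ?D (?g n) * z ^ n) sums bergman_projection \<omega> f z" .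
qed

lemma norm_Linf_measurable:
  assumes n: "radial_weight \<nu>" and f: "f \<in> borel_measurable (lebesgue_on unit_disc)"
  shows "(\<lambda>z. ennreal (cmod (f z) * tail \<nu> (cmod z))) \<in> borel_measurable (lebesgue_on unit_disc)"
  using f disc_radial_measurable[OF tail_measurable[OF n]] by measurable

lemma Linf_AE_bound:
  assumes n: "radial_weight \<nu>" and f: "f \<in> Linf \<nu>"
  defines "K \<equiv> enn2real (norm_Linf \<nu> f)"
  shows "norm_Linf \<nu> f = ennreal K" "0 \<le> K" "AE \<zeta> in lebesgue_on unit_disc. cmod (f \<zeta>) * tail \<nu> (cmod \<zeta>) \<le> K"
proof -
  show K: "norm_Linf \<nu> f = ennreal K" "0 \<le> K" using f by (auto simp: K_def Linf_def)
  have "AE z in lebesgue_on unit_disc. ennreal (cmod (f z) * tail \<nu> (cmod z)) \<le> ennreal K"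
    unfolding K(1)[symmetric] norm_Linf_def by (rule esssup_AE)
  then show "AE \<zeta> in lebesgue_on unit_disc. cmod (f \<zeta>) * tail \<nu> (cmod \<zeta>) \<le> K"
    by (rule AE_mp) (use K(2) in \<open>auto intro!: AE_I2 simp: ennreal_le_iff\<close>)
qed

section \<open>Integral means of the kernel\<close>

text \<open>The integral over the angle of \<open>1 / (1 + ((n + 1) * \<theta>)\<^sup>2)\<close> is
  at most \<open>pi / (n + 1)\<close>, so each term of the pointwise bound gains exactly the factor
  \<open>1 / (n + 1)\<close>. The cube is the one from
  \<open>regular_power_series_le\<close>.\<close>

lemma kernel_angle_integral_le:
  assumes wh: "\<omega> \<in> D_hat"
  shows "\<exists>C>0. \<forall>t. 0 \<le> t \<and> t < 1 \<longrightarrow>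
    (\<integral>\<^sup>+\<theta>. ennreal (cmod (\<Sum>n. complex_of_real (kernel_coeff \<omega> n) * (cis \<theta> * complex_of_real (t ^ 3)) ^ n)) \<partial>angle_measure)
      \<le> ennreal C * (\<Sum>n. ennreal (kernel_coeff \<omega> n * t ^ n / (real n + 1)))"
proof -
  have w: "radial_weight \<omega>" using wh by (rule D_hat_radial_weight)
  let ?a = "kernel_coeff \<omega>"
  obtain A where A: "0 \<le> A" "\<And>n. ?a (n + 1) - ?a n \<le> A * ?a n / (real n + 1)"
     "\<And>n. \<bar>?a n - 2 * ?a (n + 1) + ?a (n + 2)\<bar> \<le> A * ?a n / (real n + 1)\<^sup>2"
     "\<And>n. ?a (2 * n + 1) \<le> A * ?a n"
    using kernel_coeff_regular[OF wh] by blast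
  have a0: "0 \<le> ?a n" for n using kernel_coeff_pos[OF w, of n] by simp
  define C where "C = 326 + 408 * A"
  have C: "0 < C" using A by (simp add: C_def)
  have main: "(\<integral>\<^sup>+\<theta>. ennreal (cmod (\<Sum>n. complex_of_real (?a n) * (cis \<theta> * complex_of_real (t ^ 3)) ^ n)) \<partial>angle_measure)
      \<le> ennreal (C * pi) * (\<Sum>n. ennreal (?a n * t ^ n / (real n + 1)))" if t: "0 \<le> t" "t < 1" for t
  proof -
    have sm: "summable (\<lambda>n. ?a n * t ^ n)" by (rule kernel_coeff_summable[OF w t])
    let ?q = "\<lambda>n \<theta>. ?a n * t ^ n / (1 + ((real n + 1) * \<theta>)\<^sup>2)"
    have q0: "0 \<le> ?q n \<theta>" for n \<theta> using a0[of n] t by (simp add: add_nonneg_nonneg)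
    have "(\<integral>\<^sup>+\<theta>. ennreal (cmod (\<Sum>n. complex_of_real (?a n) * (cis \<theta> * complex_of_real (t ^ 3)) ^ n)) \<partial>angle_measure)
      \<le> (\<integral>\<^sup>+\<theta>. ennreal C * (\<Sum>n. ennreal (?a n * t ^ n) * ennreal (1 / (1 + ((real n + 1) * \<theta>)\<^sup>2))) \<partial>angle_measure)"
    proof (rule nn_integral_mono)
      fix \<theta> assume "\<theta> \<in> space angle_measure"
      then have th: "\<bar>\<theta>\<bar> \<le> pi" by (auto simp: space_restrict_space)
      have sq: "summable (\<lambda>n. ?q n \<theta>)"
      proof (rule summable_comparison_test'[OF sm, of 0])
        fix n :: nat
        have "?q n \<theta> \<le> ?a n * t ^ n / 1" using a0[of n] t by (intro divide_left_mono) (auto simp: add_pos_nonneg)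
        then show "norm (?q n \<theta>) \<le> ?a n * t ^ n" using q0[of n \<theta>] by simp
      qed
      have "cmod (\<Sum>n. complex_of_real (?a n) * (cis \<theta> * complex_of_real (t ^ 3)) ^ n) \<le> C * (\<Sum>n. ?q n \<theta>)"
        using regular_power_series_le[OF t(1) less_imp_le[OF t(2)] A(1) a0 kernel_coeff_mono[OF w] A(2,3,4) sm th]
        by (simp add: C_def mult.commute)
      then have "ennreal (cmod (\<Sum>n. complex_of_real (?a n) * (cis \<theta> * complex_of_real (t ^ 3)) ^ n)) \<le> ennreal (C * (\<Sum>n. ?q n \<theta>))"
        by (rule ennreal_leI)
      also have "\<dots> = ennreal C * (\<Sum>n. ennreal (?q n \<theta>))"
        using C suminf_ennreal2[OF q0 sq] suminf_nonneg[OF sq q0] by (simp add: ennreal_mult)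
      also have "(\<lambda>n. ennreal (?q n \<theta>)) = (\<lambda>n. ennreal (?a n * t ^ n) * ennreal (1 / (1 + ((real n + 1) * \<theta>)\<^sup>2)))"
        using a0 t by (intro ext, subst ennreal_mult[symmetric]) (auto simp: add_nonneg_nonneg)
      finally show "ennreal (cmod (\<Sum>n. complex_of_real (?a n) * (cis \<theta> * complex_of_real (t ^ 3)) ^ n))
        \<le> ennreal C * (\<Sum>n. ennreal (?a n * t ^ n) * ennreal (1 / (1 + ((real n + 1) * \<theta>)\<^sup>2)))" .
    qed
    also have "\<dots> = ennreal C * (\<Sum>n. ennreal (?a n * t ^ n) * (\<integral>\<^sup>+\<theta>. ennreal (1 / (1 + ((real n + 1) * \<theta>)\<^sup>2)) \<partial>angle_measure))"
    proof -
      have m: "(\<lambda>\<theta>. ennreal (1 / (1 + ((real n + 1) * \<theta>)\<^sup>2))) \<in> borel_measurable angle_measure" for n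
        by (rule measurable_restrict_space1) simp
      show ?thesis
        by (subst nn_integral_cmult, intro borel_measurable_suminf_order borel_measurable_times_ennreal borel_measurable_const m,
            subst nn_integral_suminf, intro borel_measurable_times_ennreal borel_measurable_const m,
            subst nn_integral_cmult, rule m, rule refl)
    qed
    also have "\<dots> \<le> ennreal C * (\<Sum>n. ennreal (?a n * t ^ n) * ennreal (pi / (real n + 1)))"
      by (intro mult_left_mono suminf_le nn_integral_angle_inverse_quadratic_le) auto
    also have "\<dots> = ennreal C * (\<Sum>n. ennreal pi * ennreal (?a n * t ^ n / (real n + 1)))"
    proof -
      have "ennreal (?a n * t ^ n) * ennreal (pi / (real n + 1)) = ennreal pi * ennreal (?a n * t ^ n / (real n + 1))" for n
        using a0[of n] t by (simp add: mult.commute flip: ennreal_mult)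
      then show ?thesis by simp
    qed
    also have "\<dots> = ennreal (C * pi) * (\<Sum>n. ennreal (?a n * t ^ n / (real n + 1)))"
      using C by (simp add: ennreal_mult mult.assoc)
    finally show ?thesis .
  qed
  show ?thesis by (rule exI[of _ "C * pi"]) (use main C in auto)
qed

text \<open>At modulus \<open>cmod z * r\<close> the angular bound is used with
  \<open>t = root 3 (cmod z) * root 3 r\<close>. The power of \<open>root 3 r\<close> and the area
  factor \<open>r\<close> combine to the order \<open>n / 3 + 1\<close> of the moment of
  \<open>\<sigma>\<close>.\<close>

lemma kernel_disc_integral_le:
  assumes wh: "\<omega> \<in> D_hat" and s: "radial_weight \<sigma>"
  shows "\<exists>C>0. \<forall>z\<in>unit_disc.
    (\<integral>\<^sup>+\<zeta>. ennreal (cmod (bergman_kernel \<omega> z \<zeta>)) * ennreal (\<sigma> (cmod \<zeta>)) \<partial>lebesgue_on unit_disc)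
      \<le> ennreal C * (\<Sum>n. ennreal (kernel_coeff \<omega> n * root 3 (cmod z) ^ n / (real n + 1) * mom \<sigma> (real n / 3 + 1)))"
proof -
  have w: "radial_weight \<omega>" using wh by (rule D_hat_radial_weight)
  let ?a = "kernel_coeff \<omega>"
  have a0: "0 \<le> ?a n" for n using kernel_coeff_pos[OF w, of n] by simp
  obtain C where C: "0 < C" "\<And>t. 0 \<le> t \<Longrightarrow> t < 1 \<Longrightarrow>
    (\<integral>\<^sup>+\<theta>. ennreal (cmod (\<Sum>n. complex_of_real (?a n) * (cis \<theta> * complex_of_real (t ^ 3)) ^ n)) \<partial>angle_measure)
      \<le> ennreal C * (\<Sum>n. ennreal (?a n * t ^ n / (real n + 1)))"
    using kernel_angle_integral_le[OF wh] by blast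
  have sm: "(\<lambda>r. ennreal (\<sigma> r)) \<in> borel_measurable unit_itv"
    using radial_weight_measurable[OF s] by simp
  have "(\<integral>\<^sup>+\<zeta>. ennreal (cmod (bergman_kernel \<omega> z \<zeta>)) * ennreal (\<sigma> (cmod \<zeta>)) \<partial>lebesgue_on unit_disc)
      \<le> ennreal C * (\<Sum>n. ennreal (?a n * root 3 (cmod z) ^ n / (real n + 1) * mom \<sigma> (real n / 3 + 1)))"
    if z: "z \<in> unit_disc" for z
  proof -
    define \<rho> where "\<rho> = cmod z"
    have rho: "0 \<le> \<rho>" "\<rho> < 1" using z by (auto simp: \<rho>_def)
    let ?H = "\<lambda>w. ennreal (cmod (\<Sum>n. complex_of_real (?a n) * w ^ n))"
    have Hm: "?H \<in> borel_measurable borel" by measurable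
    have inner: "(\<integral>\<^sup>+\<theta>. ennreal (cmod (bergman_kernel \<omega> z (cis \<theta> * complex_of_real r))) \<partial>angle_measure)
      \<le> ennreal C * (\<Sum>n. ennreal (?a n * (root 3 \<rho> * root 3 r) ^ n / (real n + 1)))" if r: "0 \<le> r" "r < 1" for r
    proof -
      have "(\<integral>\<^sup>+\<theta>. ennreal (cmod (bergman_kernel \<omega> z (cis \<theta> * complex_of_real r))) \<partial>angle_measure) =
        (\<integral>\<^sup>+\<theta>. ?H (cis \<theta> * (cnj z * complex_of_real r)) \<partial>angle_measure)"
        by (simp add: bergman_kernel_eq[OF w] mult_ac)
      also have "\<dots> = (\<integral>\<^sup>+\<theta>. ?H (cis \<theta> * complex_of_real (cmod (cnj z * complex_of_real r))) \<partial>angle_measure)"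
        by (rule nn_integral_angle_rotate[OF Hm])
      also have "cmod (cnj z * complex_of_real r) = (root 3 \<rho> * root 3 r) ^ 3"
        using r rho by (simp add: norm_mult \<rho>_def power_mult_distrib)
      also have "(\<integral>\<^sup>+\<theta>. ?H (cis \<theta> * complex_of_real ((root 3 \<rho> * root 3 r) ^ 3)) \<partial>angle_measure)
        \<le> ennreal C * (\<Sum>n. ennreal (?a n * (root 3 \<rho> * root 3 r) ^ n / (real n + 1)))"
      proof (rule C(2))
        have "root 3 r < 1" using r by simp
        moreover have "0 \<le> root 3 \<rho>" "root 3 \<rho> < 1" using rho by simp_all
        ultimately show "root 3 \<rho> * root 3 r < 1" "0 \<le> root 3 \<rho> * root 3 r"
          using r by (auto intro: le_less_trans[OF mult_left_le_one_le] mult_nonneg_nonneg)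
      qed
      finally show ?thesis .
    qed
    have "(\<integral>\<^sup>+\<zeta>. ennreal (cmod (bergman_kernel \<omega> z \<zeta>)) * ennreal (\<sigma> (cmod \<zeta>)) \<partial>lebesgue_on unit_disc) =
      (\<integral>\<^sup>+r. ennreal r * ennreal (\<sigma> r) * (\<integral>\<^sup>+\<theta>. ennreal (cmod (bergman_kernel \<omega> z (cis \<theta> * complex_of_real r))) \<partial>angle_measure) \<partial>unit_itv)"
      by (rule nn_integral_disc_polar[OF _ sm]) measurable
    also have "\<dots> \<le> (\<integral>\<^sup>+r. ennreal C * (\<Sum>n. ennreal (?a n * root 3 \<rho> ^ n / (real n + 1)) * ennreal (r powr (real n / 3 + 1) * \<sigma> r)) \<partial>unit_itv)"
    proof (rule nn_integral_mono)
      fix r assume "r \<in> space unit_itv"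
      then have r: "0 \<le> r" "r < 1" by auto
      have s0: "0 \<le> \<sigma> r" using s r by (rule radial_weight_nonneg)
      have "ennreal r * ennreal (\<sigma> r) * (\<integral>\<^sup>+\<theta>. ennreal (cmod (bergman_kernel \<omega> z (cis \<theta> * complex_of_real r))) \<partial>angle_measure)
        \<le> ennreal r * ennreal (\<sigma> r) * (ennreal C * (\<Sum>n. ennreal (?a n * (root 3 \<rho> * root 3 r) ^ n / (real n + 1))))"
        by (intro mult_left_mono inner r) simp
      also have "\<dots> = ennreal C * (\<Sum>n. ennreal (r * \<sigma> r) * ennreal (?a n * (root 3 \<rho> * root 3 r) ^ n / (real n + 1)))"
        using r s0 by (simp add: ennreal_mult mult_ac)
      also have "(\<lambda>n. ennreal (r * \<sigma> r) * ennreal (?a n * (root 3 \<rho> * root 3 r) ^ n / (real n + 1))) =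
        (\<lambda>n. ennreal (?a n * root 3 \<rho> ^ n / (real n + 1)) * ennreal (r powr (real n / 3 + 1) * \<sigma> r))"
      proof
        fix n
        have p: "r * root 3 r ^ n = r powr (real n / 3 + 1)"
        proof (cases "r = 0")
          case False
          then have "root 3 r ^ n = (r powr (1 / 3)) powr real n"
            using r by (simp add: root_powr_inverse powr_realpow)
          also have "\<dots> = r powr (real n / 3)" by (simp add: powr_powr)
          finally show ?thesis using False r by (simp add: powr_add mult.commute)
        qed simp
        have "r * \<sigma> r * (?a n * (root 3 \<rho> * root 3 r) ^ n / (real n + 1)) =
          ?a n * root 3 \<rho> ^ n / (real n + 1) * ((r * root 3 r ^ n) * \<sigma> r)"
          by (simp add: power_mult_distrib)
        then show "ennreal (r * \<sigma> r) * ennreal (?a n * (root 3 \<rho> * root 3 r) ^ n / (real n + 1)) =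
          ennreal (?a n * root 3 \<rho> ^ n / (real n + 1)) * ennreal (r powr (real n / 3 + 1) * \<sigma> r)"
          unfolding p using r s0 a0[of n] rho by (simp flip: ennreal_mult)
      qed
      finally show "ennreal r * ennreal (\<sigma> r) * (\<integral>\<^sup>+\<theta>. ennreal (cmod (bergman_kernel \<omega> z (cis \<theta> * complex_of_real r))) \<partial>angle_measure)
        \<le> ennreal C * (\<Sum>n. ennreal (?a n * root 3 \<rho> ^ n / (real n + 1)) * ennreal (r powr (real n / 3 + 1) * \<sigma> r))" .
    qed
    also have "\<dots> = ennreal C * (\<Sum>n. ennreal (?a n * root 3 \<rho> ^ n / (real n + 1)) * (\<integral>\<^sup>+r. ennreal (r powr (real n / 3 + 1) * \<sigma> r) \<partial>unit_itv))"
    proof -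
      have m: "(\<lambda>r. ennreal (r powr (real n / 3 + 1) * \<sigma> r)) \<in> borel_measurable unit_itv" for n
        using borel_measurable_integrable[OF mom_integrable[OF s, of "real n / 3 + 1"]] by simp
      show ?thesis
        by (subst nn_integral_cmult, intro borel_measurable_suminf_order borel_measurable_times_ennreal borel_measurable_const m,
            subst nn_integral_suminf, intro borel_measurable_times_ennreal borel_measurable_const m,
            subst nn_integral_cmult, rule m, rule refl)
    qed
    also have "\<dots> = ennreal C * (\<Sum>n. ennreal (?a n * root 3 \<rho> ^ n / (real n + 1) * mom \<sigma> (real n / 3 + 1)))"
    proof -
      have "(\<integral>\<^sup>+r. ennreal (r powr (real n / 3 + 1) * \<sigma> r) \<partial>unit_itv) = ennreal (mom \<sigma> (real n / 3 + 1))" for n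
        using moment_eq_mom[OF s, of "real n / 3 + 1"] by (simp add: moment_def)
      then show ?thesis using mom_pos[OF s] by (simp add: less_imp_le flip: ennreal_mult'')
    qed
    finally show ?thesis by (simp add: \<rho>_def)
  qed
  then show ?thesis using C(1) by blast
qed

text \<open>By the ratio bound in moment form, the coefficient
  \<open>1 / (2 * \<omega>_(2n+1))\<close> times the moment of \<open>\<sigma>\<close> is at most a
  constant over the tail of \<open>\<nu>\<close> at \<open>1 - 1 / (n + 2)\<close>; what remains is
  the series of \<open>reciprocal_tail_sum\<close>.\<close>

lemma kernel_disc_integral_bound:
  assumes wh: "\<omega> \<in> D_hat" and n: "\<nu> \<in> D_hat" "\<nu> \<in> D_check" and s: "radial_weight \<sigma>"
    and eq: "\<And>r. 0 \<le> r \<Longrightarrow> r < 1 \<Longrightarrow> \<omega> r = \<sigma> r * tail \<nu> r"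
    and B: "\<And>r. 0 \<le> r \<Longrightarrow> r < 1 \<Longrightarrow> tail \<nu> r * tail \<sigma> r \<le> B * tail \<omega> r"
  shows "\<exists>C>0. \<forall>z\<in>unit_disc.
    (\<integral>\<^sup>+\<zeta>. ennreal (cmod (bergman_kernel \<omega> z \<zeta>)) * ennreal (\<sigma> (cmod \<zeta>)) \<partial>lebesgue_on unit_disc)
      \<le> ennreal (C / tail \<nu> (cmod z))"
proof -
  have w: "radial_weight \<omega>" using wh by (rule D_hat_radial_weight)
  have n': "radial_weight \<nu>" using n by (auto intro: D_hat_radial_weight)
  have sh: "\<sigma> \<in> D_hat" by (rule ratio_bound_imp_D_hat[OF wh n' s eq B])
  let ?T = "\<lambda>n. tail \<nu> (1 - 1 / (real n + 2))"
  have Tp: "0 < ?T n" for n by (intro tail_pos n') auto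
  obtain C where C: "0 < C" "\<And>z. z \<in> unit_disc \<Longrightarrow>
    (\<integral>\<^sup>+\<zeta>. ennreal (cmod (bergman_kernel \<omega> z \<zeta>)) * ennreal (\<sigma> (cmod \<zeta>)) \<partial>lebesgue_on unit_disc)
      \<le> ennreal C * (\<Sum>n. ennreal (kernel_coeff \<omega> n * root 3 (cmod z) ^ n / (real n + 1) * mom \<sigma> (real n / 3 + 1)))"
    using kernel_disc_integral_le[OF wh s] by blast
  obtain c where c: "0 < c" "\<And>x. 0 \<le> x \<Longrightarrow> tail \<nu> (1 - 1 / (x + 2)) * mom \<sigma> x \<le> c * mom \<omega> x"
    using tail_ratio_bound_imp_mom[OF wh n(1) s eq B] by blast
  \<comment> \<open>The factor 6 lifts the order \<open>n / 3 + 1\<close> to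
    \<open>2 * n + 6\<close>, past the order \<open>2 * n + 1\<close> in the kernel
    coefficient.\<close>
  obtain F where F: "0 < F" "\<And>x. 0 \<le> x \<Longrightarrow> mom \<sigma> x \<le> F * mom \<sigma> (6 * x + 0)"
    using D_hat_mom_doubling[OF sh, of 6 0] by auto
  obtain D where D: "1 \<le> D" "\<And>u. 0 < u \<Longrightarrow> u \<le> 1 \<Longrightarrow> tail \<nu> (1 - u) \<le> D * tail \<nu> (1 - u / 2)"
    using D_hat_scale[OF n(1), of 2] by auto
  obtain D3 where D3: "1 \<le> D3" "\<And>u. 0 < u \<Longrightarrow> u \<le> 1 \<Longrightarrow> tail \<nu> (1 - u) \<le> D3 * tail \<nu> (1 - u / 3)"
    using D_hat_scale[OF n(1), of 3] by auto
  obtain A where A0: "0 < A" and A1: "\<forall>t. 0 \<le> t \<and> t < 1 \<longrightarrow> summable (\<lambda>n. t ^ n / ((real n + 1) * ?T n)) \<and>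
      (\<Sum>n. t ^ n / ((real n + 1) * ?T n)) \<le> A / tail \<nu> t"
    using reciprocal_tail_sum[OF n] by (elim exE conjE)
  have A: "0 < A" "summable (\<lambda>n. t ^ n / ((real n + 1) * ?T n))"
    "(\<Sum>n. t ^ n / ((real n + 1) * ?T n)) \<le> A / tail \<nu> t" if "0 \<le> t" "t < 1" for t
    using A0 A1[rule_format, OF conjI[OF that]] by simp_all
  define E where "E = D * F * c"
  have E: "0 < E" using D F c by (simp add: E_def)
  have coef: "kernel_coeff \<omega> n * mom \<sigma> (real n / 3 + 1) \<le> E / ?T n" for n
  proof -
    define x where "x = 2 * real n + 1"
    have "?T n \<le> D * tail \<nu> (1 - 1 / (real n + 2) / 2)" by (intro D) auto
    also have "tail \<nu> (1 - 1 / (real n + 2) / 2) \<le> tail \<nu> (1 - 1 / (x + 2))"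
      by (intro tail_antimono n') (auto simp: x_def field_simps)
    finally have 1: "?T n \<le> D * tail \<nu> (1 - 1 / (x + 2))" using D by simp
    have "mom \<sigma> (real n / 3 + 1) \<le> F * mom \<sigma> (6 * (real n / 3 + 1) + 0)" by (intro F) auto
    also have "\<dots> \<le> F * mom \<sigma> x" using F by (intro mult_left_mono mom_antimono s) (auto simp: x_def)
    finally have 2: "mom \<sigma> (real n / 3 + 1) \<le> F * mom \<sigma> x" .
    have "?T n * mom \<sigma> (real n / 3 + 1) \<le> (D * tail \<nu> (1 - 1 / (x + 2))) * (F * mom \<sigma> x)"
    proof (rule mult_mono[OF 1 2])
      show "0 \<le> D * tail \<nu> (1 - 1 / (x + 2))" using 1 Tp[of n] by linarith
      show "0 \<le> mom \<sigma> (real n / 3 + 1)" by (intro less_imp_le[OF mom_pos] s) simp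
    qed
    also have "\<dots> = D * F * (tail \<nu> (1 - 1 / (x + 2)) * mom \<sigma> x)" by simp
    also have "\<dots> \<le> D * F * (c * mom \<omega> x)" using D F by (intro mult_left_mono c) (auto simp: x_def)
    finally have 3: "?T n * mom \<sigma> (real n / 3 + 1) \<le> E * mom \<omega> x" by (simp add: E_def mult.assoc)
    have px: "0 < mom \<omega> x" by (intro mom_pos w) (simp add: x_def)
    have "kernel_coeff \<omega> n * mom \<sigma> (real n / 3 + 1) = mom \<sigma> (real n / 3 + 1) / (2 * mom \<omega> x)"
      by (simp add: kernel_coeff_def x_def)
    also have "\<dots> \<le> mom \<sigma> (real n / 3 + 1) / mom \<omega> x"
      using px mom_pos[OF s, of "real n / 3 + 1"] by (intro divide_left_mono) auto
    also have "\<dots> \<le> E / ?T n" using 3 px Tp[of n] by (simp add: field_simps)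
    finally show ?thesis .
  qed
  have "(\<integral>\<^sup>+\<zeta>. ennreal (cmod (bergman_kernel \<omega> z \<zeta>)) * ennreal (\<sigma> (cmod \<zeta>)) \<partial>lebesgue_on unit_disc)
      \<le> ennreal (C * E * A * D3 / tail \<nu> (cmod z))" if z: "z \<in> unit_disc" for z
  proof -
    define \<rho> t where "\<rho> = cmod z" and "t = root 3 \<rho>"
    have rho: "0 \<le> \<rho>" "\<rho> < 1" using z by (auto simp: \<rho>_def)
    have t: "0 \<le> t" "t < 1" "t ^ 3 = \<rho>" using rho by (auto simp: t_def)
    have nt: "0 < tail \<nu> t" "0 < tail \<nu> \<rho>" using t rho by (auto intro!: tail_pos n')
    \<comment> \<open>Replacing a radius by its cube root brings it closer to 1 by a factor of at
      most 3, since \<open>1 - t ^ 3 \<le> 3 * (1 - t)\<close>; doubling of \<open>\<nu>\<close>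
      absorbs this.\<close>
    have tr: "tail \<nu> \<rho> \<le> D3 * tail \<nu> t"
    proof -
      have "1 + t + t\<^sup>2 \<le> 3" using t power_le_one[of t 2] by linarith
      then have "(1 - t) * (1 + t + t\<^sup>2) \<le> (1 - t) * 3" using t by (intro mult_left_mono) auto
      then have "1 - \<rho> \<le> 3 * (1 - t)"
        unfolding t(3)[symmetric] by (simp add: algebra_simps power2_eq_square power3_eq_cube)
      then have "t \<le> 1 - (1 - \<rho>) / 3" by (simp add: field_simps)
      then have "tail \<nu> (1 - (1 - \<rho>) / 3) \<le> tail \<nu> t" by (rule tail_antimono[OF n' t(1)])
      then have "D3 * tail \<nu> (1 - (1 - \<rho>) / 3) \<le> D3 * tail \<nu> t" using D3 by (intro mult_left_mono) auto
      moreover have "tail \<nu> \<rho> \<le> D3 * tail \<nu> (1 - (1 - \<rho>) / 3)" using D3(2)[of "1 - \<rho>"] rho by simp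
      ultimately show ?thesis by linarith
    qed
    have "(\<Sum>n. ennreal (kernel_coeff \<omega> n * t ^ n / (real n + 1) * mom \<sigma> (real n / 3 + 1))) \<le>
      (\<Sum>n. ennreal (E * (t ^ n / ((real n + 1) * ?T n))))"
    proof (intro suminf_le ennreal_leI)
      fix n
      have "kernel_coeff \<omega> n * mom \<sigma> (real n / 3 + 1) * (t ^ n / (real n + 1)) \<le> E / ?T n * (t ^ n / (real n + 1))"
        using t by (intro mult_right_mono coef) auto
      then show "kernel_coeff \<omega> n * t ^ n / (real n + 1) * mom \<sigma> (real n / 3 + 1) \<le> E * (t ^ n / ((real n + 1) * ?T n))"
        by (simp add: mult_ac)
    qed auto
    also have "\<dots> = ennreal (\<Sum>n. E * (t ^ n / ((real n + 1) * ?T n)))"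
      using E t Tp by (intro suminf_ennreal2 summable_mult A) (auto simp: less_imp_le)
    also have "\<dots> = ennreal (E * (\<Sum>n. t ^ n / ((real n + 1) * ?T n)))"
      by (simp only: suminf_mult[OF A(2)[OF t(1,2)]])
    also have "\<dots> \<le> ennreal (E * (A * D3 / tail \<nu> \<rho>))"
    proof (intro ennreal_leI mult_left_mono)
      have "(\<Sum>n. t ^ n / ((real n + 1) * ?T n)) \<le> A / tail \<nu> t" by (rule A(3)[OF t(1,2)])
      also have "\<dots> \<le> A * D3 / tail \<nu> \<rho>" using tr nt A0 by (simp add: field_simps)
      finally show "(\<Sum>n. t ^ n / ((real n + 1) * ?T n)) \<le> A * D3 / tail \<nu> \<rho>" .
    qed (use E in auto)
    finally have "ennreal C * (\<Sum>n. ennreal (kernel_coeff \<omega> n * t ^ n / (real n + 1) * mom \<sigma> (real n / 3 + 1))) \<le>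
       ennreal C * ennreal (E * (A * D3 / tail \<nu> \<rho>))" by (intro mult_left_mono) auto
    also have "\<dots> = ennreal (C * E * A * D3 / tail \<nu> \<rho>)"
      using C(1) E A0 D3(1) nt by (simp add: mult.assoc flip: ennreal_mult)
    finally show ?thesis using C(2)[OF z] unfolding t_def \<rho>_def by (rule order_trans[rotated])
  qed
  moreover have "0 < C * E * A * D3" using C(1) E A0 D3(1) by simp
  ultimately show ?thesis by blast
qed

section \<open>Boundedness of the projection\<close>

text \<open>Because \<open>\<omega> = \<sigma> * tail \<nu>\<close>, a bound \<open>K\<close> for
  \<open>\<bar>f\<bar>\<close> times the tail of \<open>\<nu>\<close> dominates the integrand by
  \<open>K\<close> times the modulus of the kernel times \<open>\<sigma>\<close>, and the integral
  of the latter is already estimated.\<close>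

lemma bergman_projection_bounded_sufficient:
  assumes wh: "\<omega> \<in> D_hat" and n: "\<nu> \<in> D_hat" "\<nu> \<in> D_check"
    and s: "radial_weight (\<lambda>r. \<omega> r / tail \<nu> r)"
    and B: "\<And>r. 0 \<le> r \<Longrightarrow> r < 1 \<Longrightarrow> tail \<nu> r * tail (\<lambda>r. \<omega> r / tail \<nu> r) r \<le> B * tail \<omega> r"
  shows "bergman_projection_bounded \<omega> \<nu>"
proof -
  let ?D = "lebesgue_on unit_disc"
  define \<sigma> where "\<sigma> = (\<lambda>r. \<omega> r / tail \<nu> r)"
  have w: "radial_weight \<omega>" using wh by (rule D_hat_radial_weight)
  have n': "radial_weight \<nu>" using n by (auto intro: D_hat_radial_weight)
  have eq: "\<omega> r = \<sigma> r * tail \<nu> r" if "0 \<le> r" "r < 1" for r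
    using tail_pos[OF n' that] by (simp add: \<sigma>_def)
  obtain C where C: "0 < C" "\<And>z. z \<in> unit_disc \<Longrightarrow>
    (\<integral>\<^sup>+\<zeta>. ennreal (cmod (bergman_kernel \<omega> z \<zeta>)) * ennreal (\<sigma> (cmod \<zeta>)) \<partial>?D) \<le> ennreal (C / tail \<nu> (cmod z))"
    using kernel_disc_integral_bound[OF wh n s[folded \<sigma>_def] eq B[folded \<sigma>_def]] by blast
  show ?thesis
    unfolding bergman_projection_bounded_def
  proof (rule exI[of _ "C / pi"], intro ballI conjI)
    fix f assume f: "f \<in> Linf \<nu>"
    then have fm: "f \<in> borel_measurable ?D" by (simp add: Linf_def)
    define K where "K = enn2real (norm_Linf \<nu> f)"
    note K = Linf_AE_bound[OF n' f, folded K_def]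
    note P = bergman_projection_sums[OF w n' s fm K(3)]
    show "integrable ?D (bergman_integrand \<omega> f z)" if "z \<in> unit_disc" for z using P(1)[OF that] .
    have hol: "bergman_projection \<omega> f holomorphic_on unit_disc"
    proof (rule power_series_holomorphic)
      fix z :: complex assume "z \<in> ball 0 1"
      from P(2)[OF this]
      show "(\<lambda>n. (complex_of_real (kernel_coeff \<omega> n / pi) * (LINT \<zeta>|?D. f \<zeta> * cnj \<zeta> ^ n * complex_of_real (\<omega> (cmod \<zeta>)))) * (z - 0) ^ n)
        sums bergman_projection \<omega> f z" by (simp only: diff_zero)
    qed
    have Pm: "bergman_projection \<omega> f \<in> borel_measurable ?D"
      by (rule continuous_imp_measurable_on_sets_lebesgue[OF holomorphic_on_imp_continuous_on[OF hol]]) simp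
    have bound: "cmod (bergman_projection \<omega> f z) * tail \<nu> (cmod z) \<le> C / pi * K" if z: "z \<in> unit_disc" for z
    proof -
      have nz: "0 < tail \<nu> (cmod z)" using z by (intro tail_pos n') auto
      have "ennreal (cmod (integral\<^sup>L ?D (bergman_integrand \<omega> f z))) \<le> (\<integral>\<^sup>+\<zeta>. ennreal (norm (bergman_integrand \<omega> f z \<zeta>)) \<partial>?D)"
        by (rule integral_norm_bound_ennreal[OF P(1)[OF z]])
      also have "\<dots> \<le> (\<integral>\<^sup>+\<zeta>. ennreal K * (ennreal (cmod (bergman_kernel \<omega> z \<zeta>)) * ennreal (\<sigma> (cmod \<zeta>))) \<partial>?D)"
      proof (rule nn_integral_mono_AE, rule AE_mp[OF K(3)], intro AE_I2 impI)
        fix \<zeta> assume "\<zeta> \<in> space ?D" and k: "cmod (f \<zeta>) * tail \<nu> (cmod \<zeta>) \<le> K"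
        then have r: "0 \<le> cmod \<zeta>" "cmod \<zeta> < 1" by auto
        have o: "0 \<le> \<omega> (cmod \<zeta>)" by (rule radial_weight_nonneg[OF w r])
        have s0: "0 \<le> \<sigma> (cmod \<zeta>)" using o tail_pos[OF n' r] by (simp add: \<sigma>_def)
        have "norm (bergman_integrand \<omega> f z \<zeta>) = cmod (f \<zeta>) * cmod (bergman_kernel \<omega> z \<zeta>) * \<omega> (cmod \<zeta>)"
          using o by (simp add: bergman_integrand_def norm_mult)
        also have "\<dots> = (cmod (f \<zeta>) * tail \<nu> (cmod \<zeta>)) * (cmod (bergman_kernel \<omega> z \<zeta>) * \<sigma> (cmod \<zeta>))"
          by (simp add: eq[OF r])
        also have "\<dots> \<le> K * (cmod (bergman_kernel \<omega> z \<zeta>) * \<sigma> (cmod \<zeta>))"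
          using k s0 by (intro mult_right_mono) auto
        finally have "ennreal (norm (bergman_integrand \<omega> f z \<zeta>)) \<le> ennreal (K * (cmod (bergman_kernel \<omega> z \<zeta>) * \<sigma> (cmod \<zeta>)))"
          by (rule ennreal_leI)
        also have "\<dots> = ennreal K * (ennreal (cmod (bergman_kernel \<omega> z \<zeta>)) * ennreal (\<sigma> (cmod \<zeta>)))"
          using K(2) s0 by (simp add: ennreal_mult)
        finally show "ennreal (norm (bergman_integrand \<omega> f z \<zeta>)) \<le> ennreal K * (ennreal (cmod (bergman_kernel \<omega> z \<zeta>)) * ennreal (\<sigma> (cmod \<zeta>)))" .
      qed
      also have "\<dots> = ennreal K * (\<integral>\<^sup>+\<zeta>. ennreal (cmod (bergman_kernel \<omega> z \<zeta>)) * ennreal (\<sigma> (cmod \<zeta>)) \<partial>?D)"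
      proof (rule nn_integral_cmult, rule borel_measurable_times_ennreal)
        show "(\<lambda>\<zeta>. ennreal (cmod (bergman_kernel \<omega> z \<zeta>))) \<in> borel_measurable ?D"
          by (rule borel_measurable_disc) measurable
        show "(\<lambda>\<zeta>. ennreal (\<sigma> (cmod \<zeta>))) \<in> borel_measurable ?D"
          using disc_radial_measurable[OF radial_weight_measurable[OF s]] by (simp add: \<sigma>_def)
      qed
      also have "\<dots> \<le> ennreal K * ennreal (C / tail \<nu> (cmod z))" by (intro mult_left_mono C(2) z) simp
      also have "\<dots> = ennreal (K * (C / tail \<nu> (cmod z)))" using K(2) C(1) nz by (intro ennreal_mult[symmetric]) auto
      finally have "cmod (integral\<^sup>L ?D (bergman_integrand \<omega> f z)) \<le> K * (C / tail \<nu> (cmod z))"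
        using K(2) C(1) nz by (subst (asm) ennreal_le_iff) auto
      then have "cmod (integral\<^sup>L ?D (bergman_integrand \<omega> f z)) * tail \<nu> (cmod z) / pi \<le> K * C / pi"
        using nz by (intro divide_right_mono) (auto simp: field_simps)
      moreover have "cmod (bergman_projection \<omega> f z) = cmod (integral\<^sup>L ?D (bergman_integrand \<omega> f z)) / pi"
        by (simp add: bergman_projection_def norm_mult norm_divide)
      ultimately show ?thesis by (simp add: mult.commute)
    qed
    have le: "norm_Linf \<nu> (bergman_projection \<omega> f) \<le> ennreal (C / pi * K)"
      unfolding norm_Linf_def
      by (rule esssup_I[OF norm_Linf_measurable[OF n' Pm]]) (intro AE_I2 ennreal_leI bound, simp)
    also have "\<dots> = ennreal (C / pi) * norm_Linf \<nu> f"
      unfolding K(1) using K(2) C(1) by (intro ennreal_mult) auto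
    finally show "norm_Linf \<nu> (bergman_projection \<omega> f) \<le> ennreal (C / pi) * norm_Linf \<nu> f" .
    show "bergman_projection \<omega> f \<in> Hinf \<nu>"
      unfolding Hinf_def Linf_def using hol Pm le_less_trans[OF le] by simp
  qed
qed

text \<open>Points of smaller modulus have larger tails, so no continuity of the tail is needed.\<close>

lemma continuous_AE_bound_imp_bound:
  assumes n: "radial_weight \<nu>" and g: "continuous_on unit_disc g"
    and ae: "AE z in lebesgue_on unit_disc. cmod (g z) * tail \<nu> (cmod z) \<le> L"
    and z: "z0 \<in> unit_disc" "z0 \<noteq> 0"
  shows "cmod (g z0) * tail \<nu> (cmod z0) \<le> L"
proof (rule ccontr)
  assume "\<not> ?thesis"
  then have gt: "L < cmod (g z0) * tail \<nu> (cmod z0)" by simp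
  define U where "U = {z \<in> unit_disc. L < cmod (g z) * tail \<nu> (cmod z0)} \<inter> ball 0 (cmod z0)"
  have cont: "continuous_on unit_disc (\<lambda>z. cmod (g z) * tail \<nu> (cmod z0))"
    by (intro continuous_intros g)
  have "open {z \<in> unit_disc. (\<lambda>z. cmod (g z) * tail \<nu> (cmod z0)) z \<in> {L<..}}"
    using continuous_openin_preimage_gen[OF cont, of "{L<..}"] open_ball[of "0::complex" 1]
    by (simp add: openin_open_eq Int_def vimage_def)
  then have opn: "open U" unfolding U_def by (intro open_Int) auto
  have "U \<noteq> {}"
  proof -
    have oV: "open {z \<in> unit_disc. L < cmod (g z) * tail \<nu> (cmod z0)}" (is "open ?V")
      using \<open>open {z \<in> unit_disc. (\<lambda>z. cmod (g z) * tail \<nu> (cmod z0)) z \<in> {L<..}}\<close> by simp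
    have "z0 \<in> ?V" using z gt by simp
    moreover have "z0 \<in> closure (ball 0 (cmod z0))" using z by (subst closure_ball) auto
    ultimately show ?thesis
      using open_Int_closure_eq_empty[OF oV, of "ball 0 (cmod z0)"] unfolding U_def by blast
  qed
  have "AE z in lebesgue. z \<in> unit_disc \<longrightarrow> cmod (g z) * tail \<nu> (cmod z) \<le> L"
    using ae by (subst (asm) AE_restrict_space_iff) auto
  then have "AE z in lebesgue. z \<notin> U"
  proof (rule AE_mp, intro AE_I2 impI)
    fix z assume h: "z \<in> unit_disc \<longrightarrow> cmod (g z) * tail \<nu> (cmod z) \<le> L"
    show "z \<notin> U"
    proof
      assume "z \<in> U"
      then have zz: "z \<in> unit_disc" "L < cmod (g z) * tail \<nu> (cmod z0)" "cmod z \<le> cmod z0" by (auto simp: U_def)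
      have "cmod (g z) * tail \<nu> (cmod z0) \<le> cmod (g z) * tail \<nu> (cmod z)"
        using zz by (intro mult_left_mono tail_antimono n) auto
      then show False using zz h by simp
    qed
  qed
  then have "U \<in> null_sets lebesgue"
    using opn by (subst (asm) AE_iff_null_sets[symmetric]) auto
  then show False using open_not_negligible[OF opn \<open>U \<noteq> {}\<close>] by (simp add: negligible_iff_null_sets)
qed

text \<open>At \<open>z = 0\<close> the kernel is constant. For the test function
  \<open>1 / tail \<nu>\<close> the required existence of the defining integral therefore says that
  the quotient is integrable over the disc.\<close>

lemma bounded_imp_quotient_radial_weight:
  assumes w: "radial_weight \<omega>" and n: "radial_weight \<nu>" and b: "bergman_projection_bounded \<omega> \<nu>"
  shows "radial_weight (\<lambda>r. \<omega> r / tail \<nu> r)"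
proof -
  let ?D = "lebesgue_on unit_disc"
  let ?\<sigma> = "\<lambda>r. \<omega> r / tail \<nu> r"
  define f where "f = (\<lambda>\<zeta>. complex_of_real (1 / tail \<nu> (cmod \<zeta>)))"
  have fm: "f \<in> borel_measurable ?D"
    unfolding f_def using disc_radial_measurable[OF tail_measurable[OF n]] by measurable
  have f1: "cmod (f \<zeta>) * tail \<nu> (cmod \<zeta>) = 1" if "\<zeta> \<in> unit_disc" for \<zeta>
    using tail_pos[OF n, of "cmod \<zeta>"] that by (simp add: f_def norm_divide)
  have "norm_Linf \<nu> f \<le> ennreal 1"
    unfolding norm_Linf_def
    by (rule esssup_I[OF norm_Linf_measurable[OF n fm]]) (intro AE_I2 ennreal_leI, simp add: f1)
  then have "norm_Linf \<nu> f < \<infinity>" by (rule le_less_trans) simp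
  then have fL: "f \<in> Linf \<nu>" using fm by (simp add: Linf_def)
  have i0: "integrable ?D (bergman_integrand \<omega> f 0)"
    using b fL unfolding bergman_projection_bounded_def by force
  have k0: "bergman_kernel \<omega> 0 \<zeta> = complex_of_real (kernel_coeff \<omega> 0)" for \<zeta>
    unfolding bergman_kernel_eq[OF w] using powser_zero[of "\<lambda>n. complex_of_real (kernel_coeff \<omega> n)"] by simp
  have bi: "bergman_integrand \<omega> f 0 \<zeta> = complex_of_real (kernel_coeff \<omega> 0 * ?\<sigma> (cmod \<zeta>))" for \<zeta>
    by (simp add: bergman_integrand_def k0 f_def)
  have "integrable ?D (\<lambda>\<zeta>. Re (bergman_integrand \<omega> f 0 \<zeta>))" using i0 by (rule integrable_Re)
  then have "integrable ?D (\<lambda>\<zeta>. kernel_coeff \<omega> 0 * ?\<sigma> (cmod \<zeta>))" by (simp only: bi Re_complex_of_real)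
  then have "integrable ?D (\<lambda>\<zeta>. (1 / kernel_coeff \<omega> 0) * (kernel_coeff \<omega> 0 * ?\<sigma> (cmod \<zeta>)))" by (rule integrable_mult_right)
  moreover have "(1 / kernel_coeff \<omega> 0) * (kernel_coeff \<omega> 0 * x) = x" for x using kernel_coeff_pos[OF w, of 0] by simp
  ultimately have iS: "integrable ?D (\<lambda>\<zeta>. ?\<sigma> (cmod \<zeta>))" by (simp only:)
  have qm: "?\<sigma> \<in> borel_measurable unit_itv" by (rule quotient_measurable[OF w n])
  have "(\<integral>\<^sup>+r. ennreal (2 * pi * r) * ennreal (?\<sigma> r) \<partial>unit_itv) = (\<integral>\<^sup>+\<zeta>. ennreal (?\<sigma> (cmod \<zeta>)) \<partial>?D)"
    by (rule nn_integral_disc_radial[symmetric]) (use qm in measurable)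
  also have "\<dots> \<le> (\<integral>\<^sup>+\<zeta>. ennreal (norm (?\<sigma> (cmod \<zeta>))) \<partial>?D)"
    by (intro nn_integral_mono ennreal_leI) (simp only: real_norm_def abs_ge_self)
  also have "\<dots> < \<infinity>" using iS by (simp add: integrable_iff_bounded)
  finally have fin: "(\<integral>\<^sup>+r. ennreal (2 * pi * r) * ennreal (?\<sigma> r) \<partial>unit_itv) < \<infinity>" .
  \<comment> \<open>Integrability over the disc carries the factor \<open>r\<close>, which
    degenerates at 0. For \<open>r \<le> 1 / 2\<close> the quotient is controlled by
    \<open>\<omega> / tail \<nu> (1 / 2)\<close> instead.\<close>
  have nh: "0 < tail \<nu> (1 / 2)" by (intro tail_pos n) auto
  have "(\<integral>\<^sup>+r. ennreal (?\<sigma> r) \<partial>unit_itv) \<le>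
    (\<integral>\<^sup>+r. ennreal (2 * pi * r) * ennreal (?\<sigma> r) + ennreal (1 / tail \<nu> (1 / 2)) * ennreal (\<omega> r) \<partial>unit_itv)"
  proof (rule nn_integral_mono)
    fix r assume "r \<in> space unit_itv"
    then have r: "0 \<le> r" "r < 1" by auto
    have s0: "0 \<le> ?\<sigma> r" by (rule quotient_nonneg[OF w n r])
    have o: "0 \<le> \<omega> r" by (rule radial_weight_nonneg[OF w r])
    have "?\<sigma> r \<le> 2 * pi * r * ?\<sigma> r + 1 / tail \<nu> (1 / 2) * \<omega> r"
    proof (cases "r \<le> 1 / 2")
      case True
      have "\<omega> r / tail \<nu> r \<le> \<omega> r / tail \<nu> (1 / 2)"
        using o nh tail_pos[OF n r] True r by (intro divide_left_mono tail_antimono n) auto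
      moreover have "0 \<le> 2 * pi * r * ?\<sigma> r" by (rule mult_nonneg_nonneg[OF _ s0]) (use r in simp)
      ultimately show ?thesis by simp
    next
      case False
      have "1 * 1 \<le> pi * (2 * r)" using False pi_ge_two by (intro mult_mono) auto
      then have "1 * ?\<sigma> r \<le> 2 * pi * r * ?\<sigma> r" using s0 by (intro mult_right_mono) auto
      moreover have "0 \<le> 1 / tail \<nu> (1 / 2) * \<omega> r" using o nh by simp
      ultimately show ?thesis by simp
    qed
    then have "ennreal (?\<sigma> r) \<le> ennreal (2 * pi * r * ?\<sigma> r + 1 / tail \<nu> (1 / 2) * \<omega> r)" by (rule ennreal_leI)
    also have "\<dots> = ennreal (2 * pi * r) * ennreal (?\<sigma> r) + ennreal (1 / tail \<nu> (1 / 2)) * ennreal (\<omega> r)"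
    proof -
      have nn: "0 \<le> 2 * pi * r" "0 \<le> 1 / tail \<nu> (1 / 2)" using r nh by simp_all
      show ?thesis
        unfolding ennreal_plus[OF mult_nonneg_nonneg[OF nn(1) s0] mult_nonneg_nonneg[OF nn(2) o]]
          ennreal_mult[OF nn(1) s0] ennreal_mult[OF nn(2) o] by (rule refl)
    qed
    finally show "ennreal (?\<sigma> r) \<le> ennreal (2 * pi * r) * ennreal (?\<sigma> r) + ennreal (1 / tail \<nu> (1 / 2)) * ennreal (\<omega> r)" .
  qed
  also have "\<dots> = (\<integral>\<^sup>+r. ennreal (2 * pi * r) * ennreal (?\<sigma> r) \<partial>unit_itv) + (\<integral>\<^sup>+r. ennreal (1 / tail \<nu> (1 / 2)) * ennreal (\<omega> r) \<partial>unit_itv)"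
  proof (rule nn_integral_add)
    have "(\<lambda>r. ennreal (2 * pi * r)) \<in> borel_measurable unit_itv"
      by (simp add: measurable_completion measurable_restrict_space1)
    then show "(\<lambda>r. ennreal (2 * pi * r) * ennreal (?\<sigma> r)) \<in> borel_measurable unit_itv"
      using qm by (intro borel_measurable_times_ennreal) simp_all
    show "(\<lambda>r. ennreal (1 / tail \<nu> (1 / 2)) * ennreal (\<omega> r)) \<in> borel_measurable unit_itv"
      using radial_weight_measurable[OF w] by (intro borel_measurable_times_ennreal) simp_all
  qed
  also have "(\<integral>\<^sup>+r. ennreal (1 / tail \<nu> (1 / 2)) * ennreal (\<omega> r) \<partial>unit_itv) = ennreal (1 / tail \<nu> (1 / 2)) * ennreal (mom \<omega> 0)"
    using moment_eq_mom[OF w, of 0] radial_weight_measurable[OF w] by (subst nn_integral_cmult) (simp_all add: moment_0)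
  finally have "(\<integral>\<^sup>+r. ennreal (?\<sigma> r) \<partial>unit_itv) < \<infinity>"
    by (rule le_less_trans) (use fin in \<open>simp add: ennreal_mult_less_top\<close>)
  then show ?thesis by (intro quotient_radial_weight quotient_integrable_of_nn w n)
qed

section \<open>Fourier coefficients of the test function\<close>

lemma integral_disc_antisymmetric:
  fixes h :: "complex \<Rightarrow> complex"
  assumes "h \<in> borel_measurable (lebesgue_on unit_disc)" "cmod c = 1" "\<And>\<zeta>. h (c * \<zeta>) = - h \<zeta>"
  shows "(LINT \<zeta>|lebesgue_on unit_disc. h \<zeta>) = 0"
  using integral_disc_rotate[OF assms(2,1)] assms(3) by simp

lemma sgn_borel_measurable: "(sgn :: complex \<Rightarrow> complex) \<in> borel_measurable borel"
proof -
  have "(sgn :: complex \<Rightarrow> complex) = (\<lambda>z. z / complex_of_real (cmod z))" by (simp add: fun_eq_iff sgn_eq)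
  then show ?thesis by simp
qed

lemma sgn_rotate: "cmod c = 1 \<Longrightarrow> sgn (c * z) = c * sgn z"
  by (simp add: sgn_eq norm_mult)

lemma norm_sgn_le: "cmod (sgn z) \<le> 1"
  by (simp add: norm_sgn)

context
  fixes \<sigma> :: "real \<Rightarrow> real"
  assumes s: "radial_weight \<sigma>"
begin

lemma sgn_term_measurable:
  "(\<lambda>\<zeta>. sgn \<zeta> ^ m * cnj \<zeta> ^ n * complex_of_real (\<sigma> (cmod \<zeta>))) \<in> borel_measurable (lebesgue_on unit_disc)"
  "(\<lambda>\<zeta>. cnj (sgn \<zeta>) ^ m * cnj \<zeta> ^ n * complex_of_real (\<sigma> (cmod \<zeta>))) \<in> borel_measurable (lebesgue_on unit_disc)"
proof -
  have cm: "cnj \<in> borel_measurable borel"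
    by (intro borel_measurable_continuous_onI continuous_intros)
  have 1: "(\<lambda>\<zeta>. sgn \<zeta> ^ m * cnj \<zeta> ^ n) \<in> borel_measurable (lebesgue_on unit_disc)"
    by (intro borel_measurable_disc borel_measurable_times borel_measurable_power sgn_borel_measurable cm)
  have 2: "(\<lambda>\<zeta>. cnj (sgn \<zeta>) ^ m * cnj \<zeta> ^ n) \<in> borel_measurable (lebesgue_on unit_disc)"
    by (intro borel_measurable_disc borel_measurable_times borel_measurable_power measurable_compose[OF sgn_borel_measurable cm] cm)
  have 3: "(\<lambda>\<zeta>. complex_of_real (\<sigma> (cmod \<zeta>))) \<in> borel_measurable (lebesgue_on unit_disc)"
    using disc_radial_measurable[OF radial_weight_measurable[OF s]] by simp
  show "(\<lambda>\<zeta>. sgn \<zeta> ^ m * cnj \<zeta> ^ n * complex_of_real (\<sigma> (cmod \<zeta>))) \<in> borel_measurable (lebesgue_on unit_disc)"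
    "(\<lambda>\<zeta>. cnj (sgn \<zeta>) ^ m * cnj \<zeta> ^ n * complex_of_real (\<sigma> (cmod \<zeta>))) \<in> borel_measurable (lebesgue_on unit_disc)"
    using 1 2 3 by (auto intro: borel_measurable_times)
qed

lemma sgn_term_norm_le:
  assumes "\<zeta> \<in> unit_disc"
  shows "norm (sgn \<zeta> ^ m * cnj \<zeta> ^ n * complex_of_real (\<sigma> (cmod \<zeta>))) \<le> \<sigma> (cmod \<zeta>)"
    "norm (cnj (sgn \<zeta>) ^ m * cnj \<zeta> ^ n * complex_of_real (\<sigma> (cmod \<zeta>))) \<le> \<sigma> (cmod \<zeta>)"
proof -
  have s0: "0 \<le> \<sigma> (cmod \<zeta>)" using assms s by (auto intro: radial_weight_nonneg)
  have "cmod (sgn \<zeta>) ^ m * cmod \<zeta> ^ n \<le> 1 * 1"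
    using assms norm_sgn_le by (intro mult_mono power_le_one) auto
  then have "cmod (sgn \<zeta>) ^ m * cmod \<zeta> ^ n * \<sigma> (cmod \<zeta>) \<le> 1 * \<sigma> (cmod \<zeta>)"
    using s0 by (intro mult_right_mono) auto
  then show "norm (sgn \<zeta> ^ m * cnj \<zeta> ^ n * complex_of_real (\<sigma> (cmod \<zeta>))) \<le> \<sigma> (cmod \<zeta>)"
    "norm (cnj (sgn \<zeta>) ^ m * cnj \<zeta> ^ n * complex_of_real (\<sigma> (cmod \<zeta>))) \<le> \<sigma> (cmod \<zeta>)"
    using s0 by (simp_all add: norm_mult norm_power)
qed

lemma sgn_term_integrable:
  "integrable (lebesgue_on unit_disc) (\<lambda>\<zeta>. sgn \<zeta> ^ m * cnj \<zeta> ^ n * complex_of_real (\<sigma> (cmod \<zeta>)))"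
  "integrable (lebesgue_on unit_disc) (\<lambda>\<zeta>. cnj (sgn \<zeta>) ^ m * cnj \<zeta> ^ n * complex_of_real (\<sigma> (cmod \<zeta>)))"
proof -
  show "integrable (lebesgue_on unit_disc) (\<lambda>\<zeta>. sgn \<zeta> ^ m * cnj \<zeta> ^ n * complex_of_real (\<sigma> (cmod \<zeta>)))"
    by (rule Bochner_Integration.integrable_bound[OF radial_disc_integrable[OF s] sgn_term_measurable(1)], rule AE_I2)
       (rule order_trans[OF sgn_term_norm_le(1)], auto)
  show "integrable (lebesgue_on unit_disc) (\<lambda>\<zeta>. cnj (sgn \<zeta>) ^ m * cnj \<zeta> ^ n * complex_of_real (\<sigma> (cmod \<zeta>)))"
    by (rule Bochner_Integration.integrable_bound[OF radial_disc_integrable[OF s] sgn_term_measurable(2)], rule AE_I2)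
       (rule order_trans[OF sgn_term_norm_le(2)], auto)
qed

text \<open>Orthogonality by a single rotation: rotating by \<open>pi / (m - n)\<close>,
  respectively \<open>pi / (m + n)\<close>, reverses the sign of the integrand but leaves the
  integral unchanged.\<close>

lemma sgn_term_integral_0:
  "m \<noteq> n \<Longrightarrow> (LINT \<zeta>|lebesgue_on unit_disc. sgn \<zeta> ^ m * cnj \<zeta> ^ n * complex_of_real (\<sigma> (cmod \<zeta>))) = 0"
  "m \<noteq> 0 \<Longrightarrow> (LINT \<zeta>|lebesgue_on unit_disc. cnj (sgn \<zeta>) ^ m * cnj \<zeta> ^ n * complex_of_real (\<sigma> (cmod \<zeta>))) = 0"
proof -
  assume mn: "m \<noteq> n"
  define a where "a = pi / (real m - real n)"
  have am: "real m * a = pi + real n * a" using mn by (simp add: a_def field_simps)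
  have e: "cis a ^ m * cnj (cis a) ^ n = -1"
  proof -
    have "cis a ^ m * cnj (cis a) ^ n = cis (real m * a) * cis (- (real n * a))"
      unfolding cis_cnj Complex.DeMoivre by (simp only: mult_minus_right)
    also have "\<dots> = cis pi" unfolding cis_mult am by simp
    finally show ?thesis by simp
  qed
  show "(LINT \<zeta>|lebesgue_on unit_disc. sgn \<zeta> ^ m * cnj \<zeta> ^ n * complex_of_real (\<sigma> (cmod \<zeta>))) = 0"
  proof (rule integral_disc_antisymmetric[OF sgn_term_measurable(1), of "cis a"])
    fix \<zeta>
    have "sgn (cis a * \<zeta>) ^ m * cnj (cis a * \<zeta>) ^ n * complex_of_real (\<sigma> (cmod (cis a * \<zeta>))) =
      (cis a ^ m * cnj (cis a) ^ n) * (sgn \<zeta> ^ m * cnj \<zeta> ^ n * complex_of_real (\<sigma> (cmod \<zeta>)))"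
      unfolding sgn_rotate[OF norm_cis] by (simp add: norm_mult power_mult_distrib mult_ac)
    then show "sgn (cis a * \<zeta>) ^ m * cnj (cis a * \<zeta>) ^ n * complex_of_real (\<sigma> (cmod (cis a * \<zeta>))) =
      - (sgn \<zeta> ^ m * cnj \<zeta> ^ n * complex_of_real (\<sigma> (cmod \<zeta>)))" unfolding e by simp
  qed simp
next
  assume m: "m \<noteq> 0"
  define a where "a = pi / (real m + real n)"
  have am: "real m * a = pi - real n * a" using m by (simp add: a_def field_simps)
  have e: "cnj (cis a) ^ m * cnj (cis a) ^ n = -1"
  proof -
    have "cnj (cis a) ^ m * cnj (cis a) ^ n = cis (- (real m * a)) * cis (- (real n * a))"
      unfolding cis_cnj Complex.DeMoivre by (simp only: mult_minus_right)
    also have "\<dots> = cis (- pi)" unfolding cis_mult am by simp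
    finally show ?thesis by (simp add: complex_eq_iff)
  qed
  show "(LINT \<zeta>|lebesgue_on unit_disc. cnj (sgn \<zeta>) ^ m * cnj \<zeta> ^ n * complex_of_real (\<sigma> (cmod \<zeta>))) = 0"
  proof (rule integral_disc_antisymmetric[OF sgn_term_measurable(2), of "cis a"])
    fix \<zeta>
    have "cnj (sgn (cis a * \<zeta>)) ^ m * cnj (cis a * \<zeta>) ^ n * complex_of_real (\<sigma> (cmod (cis a * \<zeta>))) =
      (cnj (cis a) ^ m * cnj (cis a) ^ n) * (cnj (sgn \<zeta>) ^ m * cnj \<zeta> ^ n * complex_of_real (\<sigma> (cmod \<zeta>)))"
      unfolding sgn_rotate[OF norm_cis] by (simp add: norm_mult power_mult_distrib mult_ac)
    then show "cnj (sgn (cis a * \<zeta>)) ^ m * cnj (cis a * \<zeta>) ^ n * complex_of_real (\<sigma> (cmod (cis a * \<zeta>))) =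
      - (cnj (sgn \<zeta>) ^ m * cnj \<zeta> ^ n * complex_of_real (\<sigma> (cmod \<zeta>)))" unfolding e by simp
  qed simp
qed

lemma sgn_term_integral_diagonal:
  assumes n: "n \<noteq> 0"
  shows "(LINT \<zeta>|lebesgue_on unit_disc. sgn \<zeta> ^ n * cnj \<zeta> ^ n * complex_of_real (\<sigma> (cmod \<zeta>))) = complex_of_real (2 * pi * mom \<sigma> (real n + 1))"
proof -
  have "sgn \<zeta> ^ n * cnj \<zeta> ^ n = complex_of_real (cmod \<zeta> powr real n)" for \<zeta>
  proof (cases "\<zeta> = 0")
    case False
    have "sgn \<zeta> * cnj \<zeta> = complex_of_real (cmod \<zeta>)"
    proof -
      have "complex_of_real (cmod \<zeta>) \<noteq> 0" using False by simp
      moreover have "\<zeta> * cnj \<zeta> = complex_of_real (cmod \<zeta>) * complex_of_real (cmod \<zeta>)"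
        using complex_norm_square[of \<zeta>] by (simp add: power2_eq_square)
      ultimately show ?thesis unfolding sgn_eq by (simp add: divide_eq_eq)
    qed
    then have "sgn \<zeta> ^ n * cnj \<zeta> ^ n = complex_of_real (cmod \<zeta> ^ n)"
      by (simp flip: power_mult_distrib)
    then show ?thesis using False by (simp add: powr_realpow)
  qed (use n in simp)
  then have "(LINT \<zeta>|lebesgue_on unit_disc. sgn \<zeta> ^ n * cnj \<zeta> ^ n * complex_of_real (\<sigma> (cmod \<zeta>))) =
    (LINT \<zeta>|lebesgue_on unit_disc. complex_of_real (cmod \<zeta> powr real n * \<sigma> (cmod \<zeta>)))" by simp
  also have "\<dots> = complex_of_real (LINT \<zeta>|lebesgue_on unit_disc. cmod \<zeta> powr real n * \<sigma> (cmod \<zeta>))"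
    by (rule integral_complex_of_real)
  also have "\<dots> = complex_of_real (2 * pi * mom \<sigma> (real n + 1))"
    using mom_disc_integral[OF s, of "real n"] by (simp add: has_bochner_integral_iff)
  finally show ?thesis .
qed

end

text \<open>The expansion of the imaginary part of \<open>Ln (1 - t * sgn \<zeta>)\<close>; stated as a series to make it visibly measurable.\<close>

definition sawtooth :: "real \<Rightarrow> complex \<Rightarrow> real" where
  "sawtooth t \<zeta> = (\<Sum>m. - (t ^ m / real m) * Im (sgn \<zeta> ^ m))"

text \<open>As the imaginary part of a principal logarithm the sum is bounded by \<open>pi\<close>
  uniformly in \<open>t\<close>, although the sums of \<open>t ^ m / m\<close> are unbounded as
  \<open>t\<close> tends to 1. This gap is what the test function exploits.\<close>

lemma sawtooth_sums:
  assumes t: "0 \<le> t" "t < 1"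
  shows "(\<lambda>m. - (t ^ m / real m) * Im (sgn \<zeta> ^ m)) sums sawtooth t \<zeta>"
    and "\<bar>sawtooth t \<zeta>\<bar> \<le> pi"
proof -
  define z where "z = complex_of_real t * sgn \<zeta>"
  have "cmod z \<le> t * 1" unfolding z_def norm_mult using t norm_sgn_le by (intro mult_mono) auto
  then have z: "cmod (- z) < 1" using t by simp
  \<comment> \<open>The term \<open>m = 0\<close> vanishes on both sides because division by 0
    yields 0.\<close>
  have "(\<lambda>m. - ((- (- z)) ^ m) / of_nat m) sums ln (1 + (- z))" by (rule Ln_series'[OF z])
  then have "(\<lambda>m. Im (- (z ^ m) / of_nat m)) sums Im (ln (1 - z))"
    by (intro sums_Im) simp
  moreover have "(\<lambda>m. Im (- (z ^ m) / of_nat m)) = (\<lambda>m. - (t ^ m / real m) * Im (sgn \<zeta> ^ m))"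
    by (auto simp: fun_eq_iff z_def power_mult_distrib Im_divide_of_nat simp flip: of_real_power)
  ultimately have S: "(\<lambda>m. - (t ^ m / real m) * Im (sgn \<zeta> ^ m)) sums Im (ln (1 - z))" by simp
  then have e: "sawtooth t \<zeta> = Im (ln (1 - z))" by (simp add: sawtooth_def sums_iff)
  show "(\<lambda>m. - (t ^ m / real m) * Im (sgn \<zeta> ^ m)) sums sawtooth t \<zeta>" using S e by simp
  have "1 - z \<noteq> 0" using z by auto
  then show "\<bar>sawtooth t \<zeta>\<bar> \<le> pi" unfolding e using mpi_less_Im_Ln[of "1 - z"] Im_Ln_le_pi[of "1 - z"] by auto
qed

lemma sawtooth_measurable: "sawtooth t \<in> borel_measurable borel"
  unfolding sawtooth_def[abs_def] using sgn_borel_measurable by measurable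

text \<open>Writing each imaginary part as \<open>(v - cnj v) / (2 * \<i>)\<close> splits the term
  into the frequencies \<open>m\<close> and \<open>- m\<close>; against
  \<open>cnj \<zeta> ^ n\<close> only \<open>m = n\<close> survives. For \<open>n = 0\<close> both
  sides are 0, again by division by 0.\<close>

lemma sawtooth_coefficient:
  assumes s: "radial_weight \<sigma>" and t: "0 \<le> t" "t < 1"
  shows "(LINT \<zeta>|lebesgue_on unit_disc. complex_of_real (sawtooth t \<zeta>) * cnj \<zeta> ^ n * complex_of_real (\<sigma> (cmod \<zeta>))) =
    \<i> * complex_of_real (pi * t ^ n / real n * mom \<sigma> (real n + 1))"
proof -
  let ?D = "lebesgue_on unit_disc"
  let ?p = "\<lambda>m \<zeta>. sgn \<zeta> ^ m * cnj \<zeta> ^ n * complex_of_real (\<sigma> (cmod \<zeta>))"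
  let ?q = "\<lambda>m \<zeta>. cnj (sgn \<zeta>) ^ m * cnj \<zeta> ^ n * complex_of_real (\<sigma> (cmod \<zeta>))"
  define c where "c m = complex_of_real (- (t ^ m / real m)) / (2 * \<i>)" for m
  let ?H = "\<lambda>m \<zeta>. c m * (?p m \<zeta> - ?q m \<zeta>)"
  have H: "?H m \<zeta> = complex_of_real (- (t ^ m / real m) * Im (sgn \<zeta> ^ m)) * (cnj \<zeta> ^ n * complex_of_real (\<sigma> (cmod \<zeta>)))" for m \<zeta>
  proof -
    have "complex_of_real (Im v) = (v - cnj v) / (2 * \<i>)" for v :: complex
      unfolding complex_diff_cnj by (simp add: complex_eq_iff)
    from this[of "sgn \<zeta> ^ m"]
    have e: "complex_of_real (Im (sgn \<zeta> ^ m)) = (sgn \<zeta> ^ m - cnj (sgn \<zeta>) ^ m) / (2 * \<i>)"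
      by (simp only: complex_cnj_power)
    show ?thesis unfolding c_def of_real_mult e by (simp add: algebra_simps diff_divide_distrib)
  qed
  have iH: "integrable ?D (?H m)" for m
    by (intro integrable_mult_right Bochner_Integration.integrable_diff sgn_term_integrable s)
  have cn: "cmod (c m) \<le> t ^ m / 2" for m
  proof (cases "m = 0")
    case False
    have "t ^ m / real m \<le> t ^ m / 1" using t False by (intro divide_left_mono) auto
    then show ?thesis using t by (simp add: c_def norm_divide norm_mult norm_power)
  qed (simp add: c_def)
  have Hb: "norm (?H m \<zeta>) \<le> t ^ m * \<sigma> (cmod \<zeta>)" if z: "\<zeta> \<in> unit_disc" for m \<zeta>
  proof -
    have "norm (?H m \<zeta>) = cmod (c m) * norm (?p m \<zeta> - ?q m \<zeta>)" by (rule norm_mult)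
    also have "\<dots> \<le> t ^ m / 2 * (\<sigma> (cmod \<zeta>) + \<sigma> (cmod \<zeta>))"
      using norm_triangle_ineq4[of "?p m \<zeta>" "?q m \<zeta>"] sgn_term_norm_le[OF s z, of m n] t
      by (intro mult_mono cn) auto
    finally show ?thesis by simp
  qed
  have geo: "summable (\<lambda>m. t ^ m)" using t by (intro summable_geometric) auto
  have s1: "AE \<zeta> in ?D. summable (\<lambda>m. norm (?H m \<zeta>))"
  proof (rule AE_I2)
    fix \<zeta> assume "\<zeta> \<in> space ?D"
    then have z: "\<zeta> \<in> unit_disc" by simp
    show "summable (\<lambda>m. norm (?H m \<zeta>))"
      by (rule summable_comparison_test'[OF summable_mult2[OF geo, of "\<sigma> (cmod \<zeta>)"], of 0])
         (use Hb[OF z] in \<open>simp only: real_norm_def abs_norm_cancel\<close>)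
  qed
  have s2: "summable (\<lambda>m. \<integral>\<zeta>. norm (?H m \<zeta>) \<partial>?D)"
  proof (rule summable_comparison_test'[OF summable_mult2[OF geo, of "\<integral>\<zeta>. \<sigma> (cmod \<zeta>) \<partial>?D"], of 0])
    fix m :: nat
    have "(\<integral>\<zeta>. norm (?H m \<zeta>) \<partial>?D) \<le> (\<integral>\<zeta>. t ^ m * \<sigma> (cmod \<zeta>) \<partial>?D)"
      by (intro integral_mono integrable_norm iH integrable_mult_right radial_disc_integrable s Hb) simp
    also have "\<dots> = t ^ m * (\<integral>\<zeta>. \<sigma> (cmod \<zeta>) \<partial>?D)" by (rule integral_mult_right_zero)
    finally show "norm (\<integral>\<zeta>. norm (?H m \<zeta>) \<partial>?D) \<le> t ^ m * (\<integral>\<zeta>. \<sigma> (cmod \<zeta>) \<partial>?D)"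
      by (simp only: real_norm_def abs_of_nonneg[OF integral_nonneg_AE[OF AE_I2[OF norm_ge_zero]]])
  qed
  have sumH: "(\<Sum>m. ?H m \<zeta>) = complex_of_real (sawtooth t \<zeta>) * cnj \<zeta> ^ n * complex_of_real (\<sigma> (cmod \<zeta>))" for \<zeta>
  proof -
    have "(\<lambda>m. complex_of_real (- (t ^ m / real m) * Im (sgn \<zeta> ^ m)) * (cnj \<zeta> ^ n * complex_of_real (\<sigma> (cmod \<zeta>)))) sums
      (complex_of_real (sawtooth t \<zeta>) * (cnj \<zeta> ^ n * complex_of_real (\<sigma> (cmod \<zeta>))))"
      by (intro sums_mult2 sums_of_real sawtooth_sums t)
    then show ?thesis unfolding H[symmetric] by (simp only: sums_iff mult.assoc)
  qed
  have "(\<lambda>m. integral\<^sup>L ?D (?H m)) sums (\<integral>\<zeta>. (\<Sum>m. ?H m \<zeta>) \<partial>?D)" by (rule sums_integral[OF iH s1 s2])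
  moreover have "integral\<^sup>L ?D (?H m) = (if m = n then \<i> * complex_of_real (pi * t ^ n / real n * mom \<sigma> (real n + 1)) else 0)" for m
  proof -
    have e: "integral\<^sup>L ?D (?H m) = c m * (integral\<^sup>L ?D (?p m) - integral\<^sup>L ?D (?q m))"
      by (subst integral_mult_right_zero, subst Bochner_Integration.integral_diff[OF sgn_term_integrable[OF s]]) simp
    show ?thesis
    proof (cases "m = 0")
      case True
      then show ?thesis unfolding e by (auto simp: c_def)
    next
      case False
      have q0: "integral\<^sup>L ?D (?q m) = 0" by (rule sgn_term_integral_0(2)[OF s False])
      show ?thesis
      proof (cases "m = n")
        case True
        then show ?thesis
          unfolding e q0 using sgn_term_integral_diagonal[OF s, of n] False
          by (simp add: c_def field_simps)
      next
        case mn: False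
        then show ?thesis unfolding e q0 using sgn_term_integral_0(1)[OF s mn] by simp
      qed
    qed
  qed
  ultimately have "(\<lambda>m. if m = n then \<i> * complex_of_real (pi * t ^ n / real n * mom \<sigma> (real n + 1)) else 0) sums (\<integral>\<zeta>. (\<Sum>m. ?H m \<zeta>) \<partial>?D)"
    by simp
  then have "(\<integral>\<zeta>. (\<Sum>m. ?H m \<zeta>) \<partial>?D) = \<i> * complex_of_real (pi * t ^ n / real n * mom \<sigma> (real n + 1))"
    using sums_single[of n "\<lambda>_. \<i> * complex_of_real (pi * t ^ n / real n * mom \<sigma> (real n + 1))"] by (rule sums_unique2)
  then show ?thesis unfolding sumH .
qed

text \<open>The test function is \<open>sawtooth t / tail \<nu>\<close>. Its projection at the point
  \<open>t\<close> is \<open>\<i>\<close> times a series of nonnegative terms, one factor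
  \<open>t ^ k\<close> coming from the coefficient and one from the point. Hence every finite
  partial sum is bounded, with a constant independent of \<open>t\<close>.\<close>

lemma bounded_imp_sum_bound:
  assumes w: "radial_weight \<omega>" and n: "radial_weight \<nu>" and b: "bergman_projection_bounded \<omega> \<nu>"
  defines "\<sigma> \<equiv> \<lambda>r. \<omega> r / tail \<nu> r"
  shows "\<exists>C>0. \<forall>t S. 0 < t \<and> t < 1 \<and> finite S \<longrightarrow>
    tail \<nu> t * (\<Sum>k\<in>S. kernel_coeff \<omega> k * t ^ (2 * k) / real k * mom \<sigma> (real k + 1)) \<le> C"
proof -
  let ?D = "lebesgue_on unit_disc"
  have s: "radial_weight \<sigma>" unfolding \<sigma>_def by (rule bounded_imp_quotient_radial_weight[OF w n b])
  obtain C0 where C0: "\<And>f. f \<in> Linf \<nu> \<Longrightarrow> bergman_projection \<omega> f \<in> Hinf \<nu> \<and>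
        norm_Linf \<nu> (bergman_projection \<omega> f) \<le> ennreal C0 * norm_Linf \<nu> f"
    using b unfolding bergman_projection_bounded_def by blast
  define C where "C = max 1 C0"
  have C: "1 \<le> C" "C0 \<le> C" by (auto simp: C_def)
  have main: "tail \<nu> t * (\<Sum>k\<in>S. kernel_coeff \<omega> k * t ^ (2 * k) / real k * mom \<sigma> (real k + 1)) \<le> C * pi"
    if t: "0 < t" "t < 1" and S: "finite S" for t S
  proof -
    define f where "f = (\<lambda>\<zeta>. complex_of_real (sawtooth t \<zeta> / tail \<nu> (cmod \<zeta>)))"
    have t0: "0 \<le> t" using t by simp
    have fm: "f \<in> borel_measurable ?D"
      unfolding f_def using disc_radial_measurable[OF tail_measurable[OF n]] borel_measurable_disc[OF sawtooth_measurable[of t]]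
      by measurable
    have fb: "cmod (f \<zeta>) * tail \<nu> (cmod \<zeta>) \<le> pi" if "\<zeta> \<in> unit_disc" for \<zeta>
    proof -
      have nz: "0 < tail \<nu> (cmod \<zeta>)" using that by (intro tail_pos n) auto
      then have "cmod (f \<zeta>) * tail \<nu> (cmod \<zeta>) = \<bar>sawtooth t \<zeta>\<bar>" by (simp add: f_def norm_divide)
      also have "\<dots> \<le> pi" by (rule sawtooth_sums(2)[OF t0 t(2)])
      finally show ?thesis .
    qed
    have fn: "norm_Linf \<nu> f \<le> ennreal pi"
      unfolding norm_Linf_def
      by (rule esssup_I[OF norm_Linf_measurable[OF n fm]]) (intro AE_I2 ennreal_leI fb, simp)
    have fL: "f \<in> Linf \<nu>" using fm le_less_trans[OF fn] by (simp add: Linf_def)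
    let ?P = "bergman_projection \<omega> f"
    have P: "?P \<in> Linf \<nu>" "?P holomorphic_on unit_disc" using C0[OF fL] by (auto simp: Hinf_def)
    have "norm_Linf \<nu> ?P \<le> ennreal C0 * norm_Linf \<nu> f" using C0[OF fL] by blast
    also have "\<dots> \<le> ennreal C * ennreal pi" using C fn by (intro mult_mono ennreal_leI) auto
    also have "\<dots> = ennreal (C * pi)" using C by (simp add: ennreal_mult)
    finally have Pn: "norm_Linf \<nu> ?P \<le> ennreal (C * pi)" .
    have "enn2real (norm_Linf \<nu> ?P) \<le> C * pi"
      using enn2real_mono[OF Pn] C by simp
    then have "AE z in ?D. cmod (?P z) * tail \<nu> (cmod z) \<le> C * pi"
      using Linf_AE_bound(3)[OF n P(1)] by (auto elim: eventually_mono)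
    then have Pt: "cmod (?P (complex_of_real t)) * tail \<nu> (cmod (complex_of_real t)) \<le> C * pi"
      using t by (intro continuous_AE_bound_imp_bound[OF n holomorphic_on_imp_continuous_on[OF P(2)]]) auto
    have zt: "complex_of_real t \<in> unit_disc" using t by simp
    let ?x = "\<lambda>k. kernel_coeff \<omega> k * t ^ (2 * k) / real k * mom \<sigma> (real k + 1)"
    have x0: "0 \<le> ?x k" for k
      using t kernel_coeff_pos[OF w, of k] mom_pos[OF s, of "real k + 1"] by simp
    have fAE: "AE \<zeta> in ?D. cmod (f \<zeta>) * tail \<nu> (cmod \<zeta>) \<le> pi" using fb by (intro AE_I2) simp
    have "(LINT \<zeta>|?D. f \<zeta> * cnj \<zeta> ^ k * complex_of_real (\<omega> (cmod \<zeta>))) = \<i> * complex_of_real (pi * t ^ k / real k * mom \<sigma> (real k + 1))" for k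
    proof -
      have "(LINT \<zeta>|?D. f \<zeta> * cnj \<zeta> ^ k * complex_of_real (\<omega> (cmod \<zeta>))) =
        (LINT \<zeta>|?D. complex_of_real (sawtooth t \<zeta>) * cnj \<zeta> ^ k * complex_of_real (\<sigma> (cmod \<zeta>)))"
        by (intro Bochner_Integration.integral_cong refl) (simp add: f_def \<sigma>_def)
      then show ?thesis using sawtooth_coefficient[OF s t0 t(2)] by simp
    qed
    then have "(\<lambda>k. complex_of_real (kernel_coeff \<omega> k / pi) * (\<i> * complex_of_real (pi * t ^ k / real k * mom \<sigma> (real k + 1))) * complex_of_real t ^ k)
      sums ?P (complex_of_real t)"
      using bergman_projection_sums(2)[OF w n s[unfolded \<sigma>_def] fm fAE zt] by simp
    moreover have "(\<lambda>k. complex_of_real (kernel_coeff \<omega> k / pi) * (\<i> * complex_of_real (pi * t ^ k / real k * mom \<sigma> (real k + 1))) * complex_of_real t ^ k)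
      = (\<lambda>k. \<i> * complex_of_real (?x k))"
      by (simp add: fun_eq_iff power_mult power2_eq_square power_mult_distrib mult_ac)
    ultimately have "(\<lambda>k. \<i> * complex_of_real (?x k)) sums ?P (complex_of_real t)" by simp
    from sums_Im[OF this] have xs: "?x sums Im (?P (complex_of_real t))" by simp
    have "sum ?x S \<le> suminf ?x"
      using xs S x0 by (intro sum_le_suminf) (auto simp: sums_iff)
    also have "\<dots> = Im (?P (complex_of_real t))" using xs by (simp add: sums_iff)
    also have "\<dots> \<le> cmod (?P (complex_of_real t))" using abs_Im_le_cmod[of "?P (complex_of_real t)"] by linarith
    finally have "tail \<nu> t * sum ?x S \<le> tail \<nu> t * cmod (?P (complex_of_real t))"
      using tail_pos[OF n t0 t(2)] by (intro mult_left_mono) auto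
    then show ?thesis using Pt t by (simp add: mult.commute)
  qed
  have "0 < C * pi" using C by simp
  then show ?thesis using main by blast
qed

section \<open>Conditions on the weights deduced from boundedness\<close>

lemma power_ge_exp:
  fixes u :: real
  assumes "0 \<le> u" "u \<le> 1 / 2"
  shows "exp (- 2 * real k * u) \<le> (1 - u) ^ k"
proof -
  have "u / (1 - u) \<le> 2 * u"
  proof -
    have "u * (2 * u) \<le> u * 1" using assms by (intro mult_left_mono) auto
    then show ?thesis using assms by (simp add: field_simps)
  qed
  then have "real k * (u / (1 - u)) \<le> real k * (2 * u)" by (intro mult_left_mono) auto
  then have "exp (- 2 * real k * u) \<le> exp (- real k * (u / (1 - u)))" by simp
  also have "\<dots> \<le> (1 - u) powr real k" using assms by (intro powr_ge_exp) auto
  also have "\<dots> = (1 - u) ^ k" using assms by (intro powr_realpow) auto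
  finally show ?thesis .
qed

text \<open>Each of the \<open>k\<close> dyadic blocks contributes at least
  \<open>1 / 2\<close>.\<close>

lemma harmonic_block_ge:
  assumes "1 \<le> N"
  shows "real k / 2 \<le> (\<Sum>n\<in>{N..<2 ^ k * N}. 1 / real n)"
proof (induction k)
  case (Suc k)
  have "N \<le> 2 ^ k * N" "2 ^ k * N \<le> 2 ^ Suc k * N" by simp_all
  then have "{N..<2 ^ Suc k * N} = {N..<2 ^ k * N} \<union> {2 ^ k * N..<2 ^ Suc k * N}"
    by (rule ivl_disj_un_two(3)[symmetric])
  then have "(\<Sum>n\<in>{N..<2 ^ Suc k * N}. 1 / real n) = (\<Sum>n\<in>{N..<2 ^ k * N}. 1 / real n) + (\<Sum>n\<in>{2 ^ k * N..<2 ^ Suc k * N}. 1 / real n)"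
    by (simp add: sum.union_disjoint)
  moreover have "1 / 2 \<le> (\<Sum>n\<in>{2 ^ k * N..<2 ^ Suc k * N}. 1 / real n)"
  proof -
    have "1 / 2 = (\<Sum>n\<in>{2 ^ k * N..<2 ^ Suc k * N}. 1 / real (2 ^ Suc k * N))"
      using assms by (simp add: field_simps)
    also have "\<dots> \<le> (\<Sum>n\<in>{2 ^ k * N..<2 ^ Suc k * N}. 1 / real n)"
    proof (rule sum_mono)
      fix n assume n: "n \<in> {2 ^ k * N..<2 ^ Suc k * N}"
      have "0 < 2 ^ k * N" using assms by simp
      then have "0 < n" using n by simp
      moreover have "real n \<le> real (2 ^ Suc k * N)" using n by (intro of_nat_mono) simp
      ultimately show "1 / real (2 ^ Suc k * N) \<le> 1 / real n" by (intro frac_le) auto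
    qed
    finally show ?thesis .
  qed
  ultimately show ?case using Suc.IH by simp
qed simp

lemma bounded_imp_conditions:
  assumes w: "radial_weight \<omega>" and n: "\<nu> \<in> D_hat" and b: "bergman_projection_bounded \<omega> \<nu>"
  defines "\<sigma> \<equiv> \<lambda>r. \<omega> r / tail \<nu> r"
  shows "\<nu> \<in> D_check" and "\<omega> \<in> D_hat" and "radial_weight \<sigma>"
    and "\<exists>B>0. \<forall>r. 0 \<le> r \<and> r < 1 \<longrightarrow> tail \<nu> r * tail \<sigma> r \<le> B * tail \<omega> r"
proof -
  have n': "radial_weight \<nu>" using n by (rule D_hat_radial_weight)
  show s: "radial_weight \<sigma>" unfolding \<sigma>_def by (rule bounded_imp_quotient_radial_weight[OF w n' b])
  have eq: "\<omega> r = \<sigma> r * tail \<nu> r" if "0 \<le> r" "r < 1" for r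
    using tail_pos[OF n' that] by (simp add: \<sigma>_def)
  obtain C where C: "0 < C" "\<And>t S. 0 < t \<Longrightarrow> t < 1 \<Longrightarrow> finite S \<Longrightarrow>
    tail \<nu> t * (\<Sum>k\<in>S. kernel_coeff \<omega> k * t ^ (2 * k) / real k * mom \<sigma> (real k + 1)) \<le> C"
    using bounded_imp_sum_bound[OF w n' b, folded \<sigma>_def] by blast
  obtain F where F: "0 < F" "\<And>x. 0 \<le> x \<Longrightarrow> mom \<omega> x \<le> F * tail \<nu> (1 - 1 / (x + 2)) * mom \<sigma> (3 * x / 4)"
    using weight_product_mom_le[OF n w s eq] by blast
  let ?T = "\<lambda>k. tail \<nu> (1 - 1 / (2 * real k + 3))"
  have Tp: "0 < ?T k" for k by (intro tail_pos n') auto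
  \<comment> \<open>A lower bound for the kernel coefficients that is available before any doubling
    of \<open>\<omega>\<close> or \<open>\<sigma>\<close>; all three conclusions below insert
    suitable blocks of terms, and two of them use this bound.\<close>
  have kc: "1 / (2 * F * ?T k * mom \<sigma> (3 * (2 * real k + 1) / 4)) \<le> kernel_coeff \<omega> k" for k
  proof -
    have "mom \<omega> (2 * real k + 1) \<le> F * ?T k * mom \<sigma> (3 * (2 * real k + 1) / 4)"
      using F(2)[of "2 * real k + 1"] by (simp add: add_ac)
    moreover have "0 < mom \<omega> (2 * real k + 1)" by (intro mom_pos w) simp
    ultimately have "1 / (2 * (F * ?T k * mom \<sigma> (3 * (2 * real k + 1) / 4))) \<le> kernel_coeff \<omega> k"
      unfolding kernel_coeff_def by (intro frac_le) auto
    then show ?thesis by (simp only: mult.assoc)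
  qed
  \<comment> \<open>For \<open>4 * M \<le> k < 5 * M\<close> the test function contributes order
    \<open>k + 1 \<le> 5 * M\<close>, while \<open>kc\<close> involves order at least
    \<open>6 * M\<close>. The tails of \<open>\<nu>\<close> cancel, and the \<open>M\<close> terms
    make up for the factor \<open>1 / k\<close>. Numerical constants here and below are not
    optimized.\<close>
  have dblN: "mom \<sigma> (5 * real M) \<le> 10 * F * exp 10 * C * mom \<sigma> (6 * real M)" if M: "1 \<le> M" for M :: nat
  proof -
    define t where "t = 1 - 1 / (4 * real M)"
    have u: "1 / (4 * real M) \<le> 1 / 4" using M by simp
    have t: "0 < t" "t < 1" using M u by (auto simp: t_def)
    have nt: "0 < tail \<nu> t" using t by (intro tail_pos n') auto
    define a where "a = exp (- 10) / (10 * real M * F) * (mom \<sigma> (5 * real M) / mom \<sigma> (6 * real M))"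
    have trm: "a / tail \<nu> t \<le> kernel_coeff \<omega> k * t ^ (2 * k) / real k * mom \<sigma> (real k + 1)" if k: "k \<in> {4 * M..<5 * M}" for k
    proof -
      have k4: "4 * real M \<le> real k" "real k + 1 \<le> 5 * real M"
      proof -
        have "real (4 * M) \<le> real k" using k by (intro of_nat_mono) simp
        then show "4 * real M \<le> real k" by simp
        have "real (k + 1) \<le> real (5 * M)" using k by (intro of_nat_mono) simp
        then show "real k + 1 \<le> 5 * real M" by simp
      qed
      have k0: "0 < real k" using k4 M by simp
      have p: "exp (- 10) \<le> t ^ (2 * k)"
      proof -
        have "2 * real (2 * k) * (1 / (4 * real M)) \<le> 10" using k4 M by (simp add: field_simps)
        then have "exp (- 10) \<le> exp (- 2 * real (2 * k) * (1 / (4 * real M)))" by simp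
        also have "\<dots> \<le> t ^ (2 * k)" unfolding t_def using u by (intro power_ge_exp) auto
        finally show ?thesis .
      qed
      have ms: "mom \<sigma> (5 * real M) \<le> mom \<sigma> (real k + 1)" "mom \<sigma> (3 * (2 * real k + 1) / 4) \<le> mom \<sigma> (6 * real M)"
        using k4 by (auto intro!: mom_antimono s)
      have mp: "0 < mom \<sigma> (5 * real M)" "0 < mom \<sigma> (6 * real M)" "0 < mom \<sigma> (3 * (2 * real k + 1) / 4)"
        by (auto intro!: mom_pos s)
      have Tt: "?T k \<le> tail \<nu> t"
        unfolding t_def using k4 M u by (intro tail_antimono n') (auto intro!: frac_le)
      have "1 / (2 * F * tail \<nu> t * mom \<sigma> (6 * real M)) \<le> 1 / (2 * F * ?T k * mom \<sigma> (3 * (2 * real k + 1) / 4))"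
        using F(1) Tp[of k] mp Tt ms nt by (intro divide_left_mono mult_mono mult_pos_pos) auto
      also have "\<dots> \<le> kernel_coeff \<omega> k" by (rule kc)
      finally have k1: "1 / (2 * F * tail \<nu> t * mom \<sigma> (6 * real M)) \<le> kernel_coeff \<omega> k" .
      have "a / tail \<nu> t = 1 / (2 * F * tail \<nu> t * mom \<sigma> (6 * real M)) * exp (- 10) / (5 * real M) * mom \<sigma> (5 * real M)"
        by (simp add: a_def)
      also have "\<dots> \<le> kernel_coeff \<omega> k * t ^ (2 * k) / real k * mom \<sigma> (real k + 1)"
        by (rule mult_mono[OF frac_le[OF _ mult_mono[OF k1 p]] ms(1)])
           (use k0 k4 t mp less_imp_le[OF kernel_coeff_pos[OF w, of k]] in auto)
      finally show ?thesis .
    qed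
    have "real M * (a / tail \<nu> t) = (\<Sum>k\<in>{4 * M..<5 * M}. a / tail \<nu> t)" by simp
    also have "\<dots> \<le> (\<Sum>k\<in>{4 * M..<5 * M}. kernel_coeff \<omega> k * t ^ (2 * k) / real k * mom \<sigma> (real k + 1))"
      by (rule sum_mono[OF trm])
    finally have "tail \<nu> t * (real M * (a / tail \<nu> t)) \<le> tail \<nu> t * (\<Sum>k\<in>{4 * M..<5 * M}. kernel_coeff \<omega> k * t ^ (2 * k) / real k * mom \<sigma> (real k + 1))"
      using nt by (intro mult_left_mono) auto
    also have "\<dots> \<le> C" by (rule C(2)[OF t]) simp
    finally have "real M * a \<le> C" using nt by simp
    then have "exp (- 10) / (10 * F) * (mom \<sigma> (5 * real M) / mom \<sigma> (6 * real M)) \<le> C" using M by (simp add: a_def)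
    then show ?thesis using F(1) mom_pos[OF s, of "6 * real M"] by (simp add: exp_minus field_simps)
  qed
  \<comment> \<open>Rounding \<open>x / 5\<close> down loses at most 1, so \<open>6 * M\<close>
    exceeds \<open>6 / 5 * x - 6\<close>, which is at least \<open>11 / 10 * x\<close> from
    \<open>x = 60\<close> on.\<close>
  have dbl: "mom \<sigma> x \<le> 10 * F * exp 10 * C * mom \<sigma> (11 / 10 * x)" if x: "60 \<le> x" for x
  proof -
    define M where "M = nat \<lfloor>x / 5\<rfloor>"
    have M: "real M \<le> x / 5" "x / 5 < real M + 1"
      using x of_nat_floor[of "x / 5"] real_of_int_floor_add_one_gt[of "x / 5"] unfolding M_def by simp_all
    have M1: "1 \<le> M" using M x by linarith
    have "mom \<sigma> x \<le> mom \<sigma> (5 * real M)" using M by (intro mom_antimono s) auto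
    also have "\<dots> \<le> 10 * F * exp 10 * C * mom \<sigma> (6 * real M)" by (rule dblN[OF M1])
    also have "\<dots> \<le> 10 * F * exp 10 * C * mom \<sigma> (11 / 10 * x)"
      using M x F(1) C(1) by (intro mult_left_mono mom_antimono s) auto
    finally show ?thesis .
  qed
  have sh: "\<sigma> \<in> D_hat" by (rule mom_doubling_imp_D_hat[OF s _ _ dbl]) auto
  obtain E where E: "0 < E" "\<And>x. 0 \<le> x \<Longrightarrow> mom \<sigma> x \<le> E * mom \<sigma> (2 * x + 6)"
    using D_hat_mom_doubling[OF sh, of 2 6] by auto
  \<comment> \<open>Now the block \<open>N \<le> k < 2 * N\<close> with \<open>N\<close> about
    \<open>x + 2\<close>: monotonicity brings the moment of \<open>\<omega>\<close> down to order
    \<open>x\<close>, and the doubling of \<open>\<sigma>\<close> just obtained replaces order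
    \<open>k + 1 \<le> 2 * x + 6\<close> by \<open>x\<close>. The tail of \<open>\<nu>\<close> at
    \<open>t\<close> is kept.\<close>
  have low: "tail \<nu> (1 - 1 / (x + 2)) * mom \<sigma> x \<le> 4 * E * exp 24 * C * mom \<omega> x" if x: "60 \<le> x" for x
  proof -
    define t where "t = 1 - 1 / (x + 2)"
    have u: "1 / (x + 2) \<le> 1 / 2" using x by simp
    have t: "0 < t" "t < 1" using x u by (auto simp: t_def) 
    have nt: "0 < tail \<nu> t" using t by (intro tail_pos n') auto
    define N where "N = nat \<lceil>x + 2\<rceil>"
    have N: "x + 2 \<le> real N" "real N \<le> x + 3" using x by (auto simp: N_def of_nat_nat) linarith+
    have N1: "1 \<le> N" using N x by linarith
    define a where "a = exp (- 24) / (4 * real N * E) * (mom \<sigma> x / mom \<omega> x)"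
    have trm: "a \<le> kernel_coeff \<omega> k * t ^ (2 * k) / real k * mom \<sigma> (real k + 1)" if k: "k \<in> {N..<2 * N}" for k
    proof -
      have kN: "real N \<le> real k" "real k + 1 \<le> 2 * real N"
      proof -
        show "real N \<le> real k" using k by (intro of_nat_mono) simp
        have "real (k + 1) \<le> real (2 * N)" using k by (intro of_nat_mono) simp
        then show "real k + 1 \<le> 2 * real N" by simp
      qed
      have k0: "0 < real k" using kN N x by linarith
      have p: "exp (- 24) \<le> t ^ (2 * k)"
      proof -
        have "real k \<le> 2 * x + 6" using kN N by linarith
        also have "\<dots> \<le> 6 * (x + 2)" using x by simp
        finally have "2 * real (2 * k) * (1 / (x + 2)) \<le> 24" using x by (simp add: field_simps)
        then have "exp (- 24) \<le> exp (- 2 * real (2 * k) * (1 / (x + 2)))" by simp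
        also have "\<dots> \<le> t ^ (2 * k)" unfolding t_def using u x by (intro power_ge_exp) auto
        finally show ?thesis .
      qed
      have wp: "0 < mom \<omega> x" "0 < mom \<omega> (2 * real k + 1)" using x by (auto intro!: mom_pos w)
      have sp: "0 < mom \<sigma> x" using x by (intro mom_pos s) auto
      have "mom \<omega> (2 * real k + 1) \<le> mom \<omega> x" using kN N x by (intro mom_antimono w) auto
      then have k1: "1 / (2 * mom \<omega> x) \<le> kernel_coeff \<omega> k" unfolding kernel_coeff_def using wp by (intro divide_left_mono) auto
      have "mom \<sigma> x \<le> E * mom \<sigma> (2 * x + 6)" using x by (intro E) auto
      also have "\<dots> \<le> E * mom \<sigma> (real k + 1)" using E(1) kN N by (intro mult_left_mono mom_antimono s) auto
      finally have ms: "mom \<sigma> x / E \<le> mom \<sigma> (real k + 1)" using E(1) by (simp add: field_simps)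
      have "a = 1 / (2 * mom \<omega> x) * exp (- 24) / (2 * real N) * (mom \<sigma> x / E)" by (simp add: a_def)
      also have "\<dots> \<le> kernel_coeff \<omega> k * t ^ (2 * k) / real k * mom \<sigma> (real k + 1)"
        by (rule mult_mono[OF frac_le[OF _ mult_mono[OF k1 p]] ms])
           (use k0 kN t wp sp E(1) less_imp_le[OF kernel_coeff_pos[OF w, of k]] in auto)
      finally show ?thesis .
    qed
    have "real N * a = (\<Sum>k\<in>{N..<2 * N}. a)" by simp
    also have "\<dots> \<le> (\<Sum>k\<in>{N..<2 * N}. kernel_coeff \<omega> k * t ^ (2 * k) / real k * mom \<sigma> (real k + 1))"
      by (rule sum_mono[OF trm])
    finally have "tail \<nu> t * (real N * a) \<le> tail \<nu> t * (\<Sum>k\<in>{N..<2 * N}. kernel_coeff \<omega> k * t ^ (2 * k) / real k * mom \<sigma> (real k + 1))"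
      using nt by (intro mult_left_mono) auto
    also have "\<dots> \<le> C" by (rule C(2)[OF t]) simp
    finally have "tail \<nu> t * (exp (- 24) / (4 * E) * (mom \<sigma> x / mom \<omega> x)) \<le> C" using N1 by (simp add: a_def)
    then show ?thesis unfolding t_def[symmetric]
      using E(1) mom_pos[OF w, of x] x by (simp add: exp_minus field_simps)
  qed
  show "\<omega> \<in> D_hat" "\<exists>B>0. \<forall>r. 0 \<le> r \<and> r < 1 \<longrightarrow> tail \<nu> r * tail \<sigma> r \<le> B * tail \<omega> r"
    using tail_ratio_bound_of_moments[OF n w s eq, of "11/10" 60 "10 * F * exp 10 * C" "4 * E * exp 24 * C"] dbl low
    by auto
  \<comment> \<open>The number of dyadic blocks. On \<open>N \<le> j < 2 ^ k * N\<close> the moments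
    of \<open>\<sigma>\<close> cancel, and each term is at least a constant times
    \<open>1 / (j * tail \<nu> (1 - 1 / N))\<close>. The harmonic sum contributes
    \<open>k / 2\<close>, and this \<open>k\<close> forces the tail of \<open>\<nu>\<close> to halve
    between the two ends.\<close>
  define k :: nat where "k = nat \<lceil>8 * F * exp 4 * C\<rceil> + 1"
  have k: "8 * F * exp 4 * C \<le> real k" "1 \<le> k" by (auto simp: k_def) linarith
  have dec: "2 * tail \<nu> (1 - 1 / (2 ^ k * real N)) \<le> tail \<nu> (1 - 1 / real N)" if N: "1 \<le> N" for N :: nat
  proof -
    define X where "X = 2 ^ k * real N"
    have "2 ^ 1 \<le> (2::real) ^ k" using k(2) by (intro power_increasing) auto
    then have "2 * 1 \<le> X" unfolding X_def using N by (intro mult_mono) auto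
    then have X: "2 \<le> X" by simp
    define t where "t = 1 - 1 / X"
    have u: "1 / X \<le> 1 / 2" using X by simp
    have t: "0 < t" "t < 1" using X u by (auto simp: t_def)
    have nt: "0 < tail \<nu> t" using t by (intro tail_pos n') auto
    have nN: "0 < tail \<nu> (1 - 1 / real N)" using N by (intro tail_pos n') auto
    have trm: "exp (- 4) / (2 * F * tail \<nu> (1 - 1 / real N)) * (1 / real j) \<le> kernel_coeff \<omega> j * t ^ (2 * j) / real j * mom \<sigma> (real j + 1)"
      if j: "j \<in> {N..<2 ^ k * N}" for j
    proof -
      have jN: "real N \<le> real j" "real j \<le> X"
      proof -
        show "real N \<le> real j" using j by (intro of_nat_mono) simp
        have "real j \<le> real (2 ^ k * N)" using j by (intro of_nat_mono) simp
        then show "real j \<le> X" by (simp add: X_def)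
      qed
      have j0: "1 \<le> real j" using jN N by linarith
      have p: "exp (- 4) \<le> t ^ (2 * j)"
      proof -
        have "2 * real (2 * j) * (1 / X) \<le> 4" using jN X by (simp add: field_simps)
        then have "exp (- 4) \<le> exp (- 2 * real (2 * j) * (1 / X))" by simp
        also have "\<dots> \<le> t ^ (2 * j)" unfolding t_def using u X by (intro power_ge_exp) auto
        finally show ?thesis .
      qed
      let ?a = "mom \<sigma> (3 * (2 * real j + 1) / 4)"
      have mp: "0 < ?a" by (intro mom_pos s) auto
      have "?a \<le> mom \<sigma> (real j + 1)" using j0 by (intro mom_antimono s) auto
      moreover have "?T j \<le> tail \<nu> (1 - 1 / real N)"
        using jN N by (intro tail_antimono n') (auto intro!: frac_le)
      ultimately have "1 / (2 * F * tail \<nu> (1 - 1 / real N)) \<le> 1 / (2 * F * ?T j)"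
        using F(1) Tp[of j] nN by (intro divide_left_mono mult_left_mono) auto
      also have "\<dots> = 1 / (2 * F * ?T j * ?a) * ?a" using mp by simp
      also have "\<dots> \<le> kernel_coeff \<omega> j * mom \<sigma> (real j + 1)"
        using kc[of j] \<open>?a \<le> mom \<sigma> (real j + 1)\<close> mp less_imp_le[OF kernel_coeff_pos[OF w, of j]] by (intro mult_mono) auto
      finally have q: "1 / (2 * F * tail \<nu> (1 - 1 / real N)) \<le> kernel_coeff \<omega> j * mom \<sigma> (real j + 1)" .
      have "1 / (2 * F * tail \<nu> (1 - 1 / real N)) * exp (- 4) \<le> kernel_coeff \<omega> j * mom \<sigma> (real j + 1) * t ^ (2 * j)"
        by (rule mult_mono[OF q p]) (use less_imp_le[OF kernel_coeff_pos[OF w, of j]] mom_pos[OF s, of "real j + 1"] in auto)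
      then have "1 / (2 * F * tail \<nu> (1 - 1 / real N)) * exp (- 4) * (1 / real j) \<le> kernel_coeff \<omega> j * mom \<sigma> (real j + 1) * t ^ (2 * j) * (1 / real j)"
        by (intro mult_right_mono) auto
      then show ?thesis by (simp add: mult_ac)
    qed
    define c where "c = exp (- 4) / (2 * F * tail \<nu> (1 - 1 / real N))"
    have c0: "0 \<le> c" using F(1) nN by (simp add: c_def)
    have "c * (real k / 2) \<le> c * (\<Sum>j\<in>{N..<2 ^ k * N}. 1 / real j)"
      using c0 harmonic_block_ge[OF N, of k] by (rule mult_left_mono[rotated])
    also have "\<dots> = (\<Sum>j\<in>{N..<2 ^ k * N}. c * (1 / real j))" by (rule sum_distrib_left)
    also have "\<dots> \<le> (\<Sum>j\<in>{N..<2 ^ k * N}. kernel_coeff \<omega> j * t ^ (2 * j) / real j * mom \<sigma> (real j + 1))"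
      unfolding c_def by (rule sum_mono[OF trm])
    finally have "tail \<nu> t * (c * (real k / 2)) \<le> tail \<nu> t * (\<Sum>j\<in>{N..<2 ^ k * N}. kernel_coeff \<omega> j * t ^ (2 * j) / real j * mom \<sigma> (real j + 1))"
      using nt by (intro mult_left_mono) auto
    also have "\<dots> \<le> C" by (rule C(2)[OF t]) simp
    finally have "tail \<nu> t * real k \<le> 4 * F * exp 4 * C * tail \<nu> (1 - 1 / real N)"
      using F(1) nN by (simp add: c_def exp_minus field_simps)
    moreover have "tail \<nu> t * (8 * F * exp 4 * C) \<le> tail \<nu> t * real k" using k nt by (intro mult_left_mono) auto
    ultimately have "(4 * F * exp 4 * C) * (2 * tail \<nu> t) \<le> (4 * F * exp 4 * C) * tail \<nu> (1 - 1 / real N)" by (simp add: mult_ac)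
    then have "2 * tail \<nu> t \<le> tail \<nu> (1 - 1 / real N)"
      using F(1) C(1) by (subst (asm) mult_le_cancel_left_pos) auto
    then show ?thesis by (simp add: t_def X_def)
  qed
  \<comment> \<open>Rounding \<open>y = 1 / (1 - r)\<close> up to an integer at most doubles it,
    which turns the ratio \<open>2 ^ k\<close> into \<open>2 * 2 ^ k\<close>.\<close>
  have "2 * tail \<nu> (1 - (1 - r) / (2 * 2 ^ k)) \<le> tail \<nu> r" if r: "0 < r" "r < 1" for r
  proof -
    define y where "y = 1 / (1 - r)"
    have y: "1 < y" "r = 1 - 1 / y" using r by (auto simp: y_def field_simps)
    define N where "N = nat \<lceil>y\<rceil>"
    have N: "y \<le> real N" "real N \<le> y + 1" using y by (auto simp: N_def of_nat_nat)
    have N1: "1 \<le> N" using N y by linarith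
    have "tail \<nu> (1 - (1 - r) / (2 * 2 ^ k)) \<le> tail \<nu> (1 - 1 / (2 ^ k * real N))"
    proof (intro tail_antimono n')
      have "1 * 1 \<le> 2 ^ k * real N" using N1 by (intro mult_mono) auto
      then show "0 \<le> 1 - 1 / (2 ^ k * real N)" by simp
      have "2 ^ k * real N \<le> 2 ^ k * (2 * y)" using N y by (intro mult_left_mono) auto
      then have "1 / (2 ^ k * (2 * y)) \<le> 1 / (2 ^ k * real N)" using y N1 by (intro divide_left_mono) auto
      then show "1 - 1 / (2 ^ k * real N) \<le> 1 - (1 - r) / (2 * 2 ^ k)" by (simp add: y(2) mult_ac)
    qed
    then have "2 * tail \<nu> (1 - (1 - r) / (2 * 2 ^ k)) \<le> 2 * tail \<nu> (1 - 1 / (2 ^ k * real N))" by simp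
    also have "\<dots> \<le> tail \<nu> (1 - 1 / real N)" by (rule dec[OF N1])
    also have "\<dots> \<le> tail \<nu> r" using N y r by (intro tail_antimono n') (auto simp: frac_le)
    finally show ?thesis .
  qed
  then have "\<forall>\<^sub>F r in at_left 1. 2 * tail \<nu> (1 - (1 - r) / (2 * 2 ^ k)) \<le> tail \<nu> r"
    unfolding eventually_at_left_field by (intro exI[of _ 0]) auto
  moreover have "(1::real) < 2 * 2 ^ k"
  proof -
    have "(1::real) \<le> 2 ^ k" by simp
    then show ?thesis by linarith
  qed
  ultimately show "\<nu> \<in> D_check" using n' unfolding D_check_def
    by (intro CollectI conjI exI[of _ "2 * 2 ^ k"] exI[of _ 2]) auto
qed

theorem theorem1:
  fixes \<omega> \<nu> :: "real \<Rightarrow> real"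
  assumes "radial_weight \<omega>" and "\<nu> \<in> D_hat"
  shows
    "(bergman_projection_bounded \<omega> \<nu> \<longleftrightarrow>
        \<nu> \<in> D_check \<and>
        (SUP x\<in>{0..}. moment \<nu> x / moment \<omega> (2 * x) * moment (\<lambda>r. \<omega> r / tail \<nu> r) x) < \<infinity>) \<and>
     (bergman_projection_bounded \<omega> \<nu> \<longleftrightarrow>
        \<omega> \<in> D_hat \<and> \<nu> \<in> D_check \<and>
        (SUP r\<in>{0..<1}. ennreal (tail \<nu> r / tail \<omega> r) *
           (\<integral>\<^sup>+ s. ennreal (\<omega> s / tail \<nu> s) \<partial>lebesgue_on {r..<1})) < \<infinity>) \<and>
     (bergman_projection_bounded \<omega> \<nu> \<longleftrightarrow>
        (\<lambda>r. \<omega> r / tail \<nu> r) \<in> D_class \<and> \<nu> \<in> D_check)"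
proof -
  let ?\<sigma> = "\<lambda>r. \<omega> r / tail \<nu> r"
  \<comment> \<open>The finite-valued form of (iii) apart from membership of \<open>\<nu>\<close> in
    \<open>D_check\<close>; every condition is reduced to it.\<close>
  let ?R = "\<omega> \<in> D_hat \<and> radial_weight ?\<sigma> \<and> (\<exists>B>0. \<forall>r. 0 \<le> r \<and> r < 1 \<longrightarrow> tail \<nu> r * tail ?\<sigma> r \<le> B * tail \<omega> r)"
  have i: "bergman_projection_bounded \<omega> \<nu> \<longleftrightarrow> \<nu> \<in> D_check \<and> ?R"
    using bounded_imp_conditions[OF assms] bergman_projection_bounded_sufficient[OF _ assms(2)] by blast
  have ii: "\<nu> \<in> D_check \<Longrightarrow> ((SUP x\<in>{0..}. moment \<nu> x / moment \<omega> (2 * x) * moment ?\<sigma> x) < \<infinity>) = ?R"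
    by (rule conditions_equivalent(1)[OF assms])
  have iv: "\<nu> \<in> D_check \<Longrightarrow> ?\<sigma> \<in> D_class \<longleftrightarrow> ?R"
    by (rule conditions_equivalent(2)[OF assms])
  have iii: "((SUP r\<in>{0..<1}. ennreal (tail \<nu> r / tail \<omega> r) * (\<integral>\<^sup>+ s. ennreal (\<omega> s / tail \<nu> s) \<partial>lebesgue_on {r..<1})) < \<infinity>) \<longleftrightarrow>
     radial_weight ?\<sigma> \<and> (\<exists>B>0. \<forall>r. 0 \<le> r \<and> r < 1 \<longrightarrow> tail \<nu> r * tail ?\<sigma> r \<le> B * tail \<omega> r)"
    by (rule tail_condition_iff[OF assms(1) D_hat_radial_weight[OF assms(2)]])
  show ?thesis unfolding iii using i ii iv by blast
qed

end
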